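(* For both the directed and the undirected complete graph on $n$ vertices with i.i.d. exponential mean-$1$ edge weights, conditional upon the min mean-weight cycle having mean weight $>1/(en)$, with (conditional) probability $1-o(1)$ as $n\to\infty$ its length is at least $$\Big(\frac{2}{\pi^2}-o(1)\Big)\log^2 n\,\log\log n.$$ That is, there is a sequence $\eta_n\to0$ such that, conditionally on the minimum mean weight being greater than $1/(en)$, the probability that the length of the min mean-weight cycle is at least $(2/\pi^2-\eta_n)\log^2 n\log\log n$ tends to $1$ as $n\to\infty$.
   Context: The directed complete graph on $n$ vertices has one arc for each ordered pair of distinct vertices; its cycles are simple directed cycles, of length at least $2$. The undirected complete graph has one edge for each unordered pair of distinct vertices; its cycles are simple cycles, of length at least $3$. Edge (arc) weights are i.i.d. exponential with mean $1$. The mean weight of a cycle is the sum of its edge weights divided by its length (number of edges). The min mean-weight cycle is the cycle of smallest mean weight (almost surely unique). Logarithms are natural. *)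

theory Defs
  imports "HOL-Probability.Probability"
begin

definition complete_arcs :: "nat \<Rightarrow> (nat \<times> nat) set" where
  "complete_arcs n = {(u, v). u < n \<and> v < n \<and> u \<noteq> v}"

definition complete_edges :: "nat \<Rightarrow> nat set set" where
  "complete_edges n = {{u, v} | u v. u < n \<and> v < n \<and> u \<noteq> v}"

text \<open>
  A cycle is represented by its set of edges, so that vertex lists differing by a rotation (and,
  in the undirected case, a reversal) give the same cycle. The lengths are bounded below by 2 and 3
  respectively, so the number of edges of the cycle traversing the distinct vertices \<open>vs\<close> is
  \<open>length vs\<close>, and the length of a cycle \<open>c\<close> is \<open>card c\<close>.
\<close>

definition closed_tour :: "(nat \<Rightarrow> nat \<Rightarrow> 'e) \<Rightarrow> nat list \<Rightarrow> 'e set" where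
  "closed_tour edge vs = {edge (vs ! i) (vs ! (Suc i mod length vs)) | i. i < length vs}"

definition directed_cycles :: "nat \<Rightarrow> (nat \<times> nat) set set" where
  "directed_cycles n =
     {closed_tour (\<lambda>u v. (u, v)) vs | vs. distinct vs \<and> set vs \<subseteq> {..<n} \<and> 2 \<le> length vs}"

definition undirected_cycles :: "nat \<Rightarrow> nat set set set" where
  "undirected_cycles n =
     {closed_tour (\<lambda>u v. {u, v}) vs | vs. distinct vs \<and> set vs \<subseteq> {..<n} \<and> 3 \<le> length vs}"

definition mean_weight :: "('e \<Rightarrow> real) \<Rightarrow> 'e set \<Rightarrow> real" where
  "mean_weight w c = (\<Sum>e\<in>c. w e) / real (card c)"

text \<open>
  On the null event that several cycles attain the minimum, \<open>arg_min\<close> picks one of them.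
\<close>

definition min_mean_cycle :: "'e set set \<Rightarrow> ('e \<Rightarrow> real) \<Rightarrow> 'e set" where
  "min_mean_cycle C w = arg_min (mean_weight w) (\<lambda>c. c \<in> C)"

definition iid_exponential_weights :: "'a measure \<Rightarrow> 'e set \<Rightarrow> ('e \<Rightarrow> 'a \<Rightarrow> real) \<Rightarrow> bool" where
  "iid_exponential_weights M E X \<longleftrightarrow>
     prob_space M \<and>
     prob_space.indep_vars M (\<lambda>_. borel) X E \<and>
     (\<forall>e\<in>E. distributed M lborel (X e) (exponential_density 1))"

end

theory Submission
  imports Defs "HOL-Real_Asymp.Real_Asymp"
begin

text \<open>
  Write \<open>L = ln n\<close> and measure edge weights in units of about \<open>1 / (e n)\<close>. A first moment bound, using
  that there are at most \<open>n ^ k / k\<close> cycles of length \<open>k\<close>, shows that with probability bounded away from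
  \<open>0\<close> no cycle has mean weight at most \<open>1 / (e n)\<close>, and that when \<open>b * (2 / pi\<^sup>2 - \<eta>) < 1\<close> it is unlikely that a cycle
  shorter than \<open>(2 / pi\<^sup>2 - \<eta>) * L\<^sup>2 * ln L\<close> has mean weight between \<open>1 / (e n)\<close> and
  \<open>(1 + b / L\<^sup>2) / (e n)\<close>. It remains to show that for every \<open>b > pi\<^sup>2 / 2\<close> some cycle of mean weight at most
  \<open>(1 + b / L\<^sup>2) / (e n)\<close> is likely to exist. This is a second moment argument over cycles of length about \<open>L ^ 3\<close>
  whose partial weight sums stay within a strip of width slightly less than \<open>L\<close> around a line: the width keeps the
  number of ways to leave a given cycle and to return to it below \<open>n\<close>. The volume of the admissible weights is governed by
  the operator \<open>h \<mapsto> (\<lambda>u. \<integral>\<^sub>0\<^bsup>min (u + 1) W\<^esup> h)\<close> on \<open>[0, W]\<close>, which has explicit sub- and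
  supersolutions of the form \<open>exp (c u) * sin (t (u + s))\<close>.
\<close>

subsection \<open>The transfer operator on a strip\<close>

text \<open>An edge of weight \<open>w\<close> moves the height of a path from \<open>u\<close> to
  \<open>u + 1 - w / \<mu>\<close>, and for small \<open>\<mu>\<close> the density of
  \<open>w\<close> is nearly constant: hence the operator and its upper limit \<open>u + 1\<close>.
  On a strip of width \<open>pi / t\<close> its growth rate is about
  \<open>exp (1 - t^2 / 2)\<close>. Width \<open>L\<close> thus loses a factor
  \<open>1 - pi^2 / (2 L^2)\<close> per edge, which \<open>1 + b / L^2\<close> outweighs when
  \<open>b > pi^2 / 2\<close>. The width must stay below \<open>L\<close> because an excursion from
  a given cycle can gain the spread \<open>exp W\<close> of the eigenfunction, against a factor of
  about \<open>1 / n\<close> for hitting the cycle again.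

  In the window the expected number of cycles of length \<open>k\<close> is about
  \<open>((1 + b / L^2)^k - 1) / k^(3/2)\<close>. Up to \<open>k = c L^2 ln L\<close> the power is
  at most \<open>L^(b c)\<close>, and the sum vanishes if \<open>b c < 1\<close>; this explains both
  \<open>ln ln n\<close> and \<open>c < 2 / pi^2\<close>.

  A tour must also end near the height where it began. No mixing estimate is used for this: sub- and
  supersolution have slightly different rates, and over \<open>L^3\<close> edges the mismatch is a
  power of \<open>n\<close>, hence the nearly equal constants \<open>a\<close>, \<open>a2\<close>,
  \<open>a3\<close>.\<close>

definition strip_op :: "real \<Rightarrow> (real \<Rightarrow> ennreal) \<Rightarrow> real \<Rightarrow> ennreal" where
  "strip_op W h u = indicator {0..W} u * (\<integral>\<^sup>+v. indicator {0..min (u + 1) W} v * h v \<partial>lborel)"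

lemma strip_op_measurable [measurable]:
  assumes [measurable]: "h \<in> borel_measurable borel"
  shows "strip_op W h \<in> borel_measurable borel"
proof -
  have "strip_op W h = (\<lambda>u. indicator {0..W} u *
      (\<integral>\<^sup>+v. (if 0 \<le> v \<and> v \<le> u + 1 \<and> v \<le> W then h v else 0) \<partial>lborel))"
    unfolding strip_op_def
    by (intro ext arg_cong2[where f="(*)"] refl nn_integral_cong) (auto simp: indicator_def)
  also have "\<dots> \<in> borel_measurable borel"
    by measurable
  finally show ?thesis .
qed

lemma strip_op_funpow_measurable [measurable]:
  "h \<in> borel_measurable borel \<Longrightarrow> (strip_op W ^^ k) h \<in> borel_measurable borel"
  by (induction k) auto

lemma strip_op_mono_strip:
  assumes "\<And>v. 0 \<le> v \<Longrightarrow> v \<le> W \<Longrightarrow> h v \<le> h' v"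
  shows "strip_op W h u \<le> strip_op W h' u"
  unfolding strip_op_def
  by (rule mult_left_mono[OF nn_integral_mono]) (use assms in \<open>auto simp: indicator_def\<close>)

lemma strip_op_cmult:
  assumes [measurable]: "h \<in> borel_measurable borel"
  shows "strip_op W (\<lambda>v. c * h v) u = c * strip_op W h u"
proof -
  have "(\<integral>\<^sup>+v. indicator {0..min (u + 1) W} v * (c * h v) \<partial>lborel)
      = (\<integral>\<^sup>+v. c * (indicator {0..min (u + 1) W} v * h v) \<partial>lborel)"
    by (simp add: mult_ac)
  also have "\<dots> = c * (\<integral>\<^sup>+v. indicator {0..min (u + 1) W} v * h v \<partial>lborel)"
    by (intro nn_integral_cmult) measurable
  finally show ?thesis unfolding strip_op_def by (simp add: mult_ac)
qed

lemma strip_op_sum: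
  assumes [measurable]: "\<And>i. i \<in> I \<Longrightarrow> h i \<in> borel_measurable borel"
  shows "strip_op W (\<lambda>v. \<Sum>i\<in>I. h i v) u = (\<Sum>i\<in>I. strip_op W (h i) u)"
  unfolding strip_op_def sum_distrib_left
  by (subst nn_integral_sum) (auto simp: sum_distrib_left)

lemma strip_op_funpow_mono_strip:
  assumes "\<And>v. 0 \<le> v \<Longrightarrow> v \<le> W \<Longrightarrow> h v \<le> h' v" "0 \<le> u" "u \<le> W"
  shows "(strip_op W ^^ k) h u \<le> (strip_op W ^^ k) h' u"
  using assms(2,3)
proof (induction k arbitrary: u)
  case (Suc k)
  then show ?case by (auto intro: strip_op_mono_strip)
qed (use assms in auto)

lemma strip_op_funpow_cmult:
  assumes [measurable]: "h \<in> borel_measurable borel"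
  shows "(strip_op W ^^ k) (\<lambda>v. c * h v) u = c * (strip_op W ^^ k) h u"
proof (induction k arbitrary: u)
  case (Suc k)
  have "(strip_op W ^^ k) (\<lambda>v. c * h v) = (\<lambda>v. c * (strip_op W ^^ k) h v)"
    using Suc by (intro ext)
  then show ?case by (simp add: strip_op_cmult)
qed auto

lemma strip_op_funpow_sum:
  assumes "\<And>i. i \<in> I \<Longrightarrow> h i \<in> borel_measurable borel"
  shows "(strip_op W ^^ k) (\<lambda>v. \<Sum>i\<in>I. h i v) u = (\<Sum>i\<in>I. (strip_op W ^^ k) (h i) u)"
proof (induction k arbitrary: u)
  case (Suc k)
  have "(strip_op W ^^ k) (\<lambda>v. \<Sum>i\<in>I. h i v) = (\<lambda>v. \<Sum>i\<in>I. (strip_op W ^^ k) (h i) v)"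
    using Suc by (intro ext)
  then show ?case using assms by (simp add: strip_op_sum)
qed auto

lemma strip_op_funpow_supersolution:
  assumes [measurable]: "g \<in> borel_measurable borel"
    and "\<And>u. 0 \<le> u \<Longrightarrow> u \<le> W \<Longrightarrow> strip_op W g u \<le> c * g u"
    and "0 \<le> u" "u \<le> W"
  shows "(strip_op W ^^ k) g u \<le> c ^ k * g u"
  using assms(3,4)
proof (induction k arbitrary: u)
  case (Suc k)
  have "(strip_op W ^^ Suc k) g u \<le> strip_op W (\<lambda>v. c ^ k * g v) u"
    using Suc.IH by (auto intro: strip_op_mono_strip)
  also have "\<dots> = c ^ k * strip_op W g u" by (rule strip_op_cmult) measurable
  also have "\<dots> \<le> c ^ k * (c * g u)" using assms(2) Suc.prems by (intro mult_left_mono) auto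
  finally show ?case by (simp add: mult_ac)
qed auto

lemma strip_op_funpow_subsolution:
  assumes [measurable]: "f \<in> borel_measurable borel"
    and "\<And>u. 0 \<le> u \<Longrightarrow> u \<le> W \<Longrightarrow> c * f u \<le> strip_op W f u"
    and "0 \<le> u" "u \<le> W"
  shows "c ^ k * f u \<le> (strip_op W ^^ k) f u"
  using assms(3,4)
proof (induction k arbitrary: u)
  case (Suc k)
  have "c ^ k * (c * f u) \<le> c ^ k * strip_op W f u" using assms(2) Suc.prems by (intro mult_left_mono) auto
  also have "\<dots> = strip_op W (\<lambda>v. c ^ k * f v) u" by (rule strip_op_cmult[symmetric]) measurable
  also have "\<dots> \<le> (strip_op W ^^ Suc k) f u"
    using Suc.IH by (auto intro: strip_op_mono_strip)
  finally show ?case by (simp add: mult_ac)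
qed auto

section \<open>Trigonometric modes as sub- and supersolutions\<close>

definition strip_rate :: "real \<Rightarrow> real" where
  "strip_rate t = exp (t * cot t) * sin t / t"

text \<open>The sine vanishes at \<open>- s\<close> and \<open>pi / t - s\<close>. Phase
  \<open>s = 0\<close> puts these zeros on the ends of a strip of width \<open>pi / t\<close>, for
  the subsolution; phase \<open>s = 1\<close> puts the first zero at \<open>- 1\<close>, where the
  integral from \<open>0\<close> picks up its boundary term, for the supersolution.\<close>

definition strip_mode :: "real \<Rightarrow> real \<Rightarrow> real \<Rightarrow> real" where
  "strip_mode t s u = exp (t * cot t * u) * sin (t * (u + s))"

lemma strip_mode_measurable [measurable]: "strip_mode t s \<in> borel_measurable borel"
  unfolding strip_mode_def by measurable

lemma strip_rate_pos: "0 < t \<Longrightarrow> t < pi \<Longrightarrow> strip_rate t > 0"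
  unfolding strip_rate_def by (auto simp: sin_gt_zero)

text \<open>
  The exponents \<open>t * cot t \<plusminus> \<i> * t\<close> solve \<open>exp z / z = strip_rate t\<close>, so that the mode satisfies the
  advance equation below.
\<close>

lemma strip_mode_deriv:
  assumes "0 < t" "t < pi"
  shows "((\<lambda>v. strip_rate t * strip_mode t s (v - 1)) has_real_derivative strip_mode t s v) (at v)"
proof -
  have s0: "sin t > 0" using assms by (simp add: sin_gt_zero)
  have e: "t * (v + s) = t * (v - 1 + s) + t" by (simp add: algebra_simps)
  have c: "t * cot t * v = t * cot t * (v - 1) + t * cot t" by (simp add: algebra_simps)
  have "strip_mode t s v = exp (t * cot t) * exp (t * cot t * (v - 1)) *
      (sin (t * (v - 1 + s)) * cos t + cos (t * (v - 1 + s)) * sin t)"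
    unfolding strip_mode_def by (subst e, subst c) (simp add: sin_add exp_add mult_ac)
  moreover have "((\<lambda>v. strip_rate t * strip_mode t s (v - 1)) has_real_derivative
     strip_rate t * (exp (t * cot t * (v - 1)) * (t * cot t) * sin (t * (v - 1 + s)) +
        exp (t * cot t * (v - 1)) * (cos (t * (v - 1 + s)) * t))) (at v)"
    unfolding strip_mode_def by (auto intro!: derivative_eq_intros)
  moreover have "strip_rate t * (exp (t * cot t * (v - 1)) * (t * cot t) * sin (t * (v - 1 + s)) +
        exp (t * cot t * (v - 1)) * (cos (t * (v - 1 + s)) * t)) =
      exp (t * cot t) * exp (t * cot t * (v - 1)) *
      (sin (t * (v - 1 + s)) * cos t + cos (t * (v - 1 + s)) * sin t)"
    using s0 assms unfolding strip_rate_def cot_def by (simp add: field_simps)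
  ultimately show ?thesis by simp
qed

lemma nn_integral_strip_mode:
  assumes "0 < t" "t < pi" "0 \<le> x" "\<And>v. 0 \<le> v \<Longrightarrow> v \<le> x \<Longrightarrow> 0 \<le> strip_mode t s v"
  shows "(\<integral>\<^sup>+v. indicator {0..x} v * ennreal (strip_mode t s v) \<partial>lborel)
    = ennreal (strip_rate t * (strip_mode t s (x - 1) - strip_mode t s (- 1)))"
proof -
  have "(\<integral>\<^sup>+v. ennreal (strip_mode t s v) * indicator {0..x} v \<partial>lborel)
    = ennreal (strip_rate t * strip_mode t s (x - 1) - strip_rate t * strip_mode t s (0 - 1))"
    using assms by (intro nn_integral_FTC_Icc strip_mode_deriv) auto
  then show ?thesis by (simp add: mult.commute right_diff_distrib)
qed

text \<open>Integrating the mode gives its values at \<open>min (u + 1) W - 1\<close> and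
  \<open>- 1\<close>. The second is nonpositive and helps. Near the upper end the truncation
  replaces \<open>u\<close> by \<open>W - 1\<close>, which also helps, because the mode decreases on
  \<open>[W - 1, W]\<close>.\<close>

lemma strip_mode_subsolution:
  assumes t: "0 < t" "t < pi" and W: "W = pi / t" and u: "0 \<le> u" "u \<le> W"
  shows "ennreal (strip_rate t) * ennreal (strip_mode t 0 u)
    \<le> strip_op W (\<lambda>v. ennreal (strip_mode t 0 v)) u"
proof -
  have W1: "W > 1" unfolding W using t by simp
  have pos: "0 \<le> strip_mode t 0 v" if "0 \<le> v" "v \<le> W" for v
    using that t W unfolding strip_mode_def
    by (auto intro!: mult_nonneg_nonneg sin_ge_zero simp: field_simps)
  have m1: "strip_mode t 0 (-1) \<le> 0"
    using t unfolding strip_mode_def by (simp add: sin_ge_zero)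
  have decr: "strip_mode t 0 u \<le> strip_mode t 0 (W - 1)" if "u > W - 1"
  proof -
    \<comment> \<open>The derivative of the shifted mode is the mode one unit further on, which is
      nonpositive beyond the zero at \<open>W\<close>.\<close>
    have d: "\<exists>y. ((\<lambda>v. strip_rate t * strip_mode t 0 (v - 1)) has_real_derivative y) (at v) \<and> y \<le> 0"
      if v: "W \<le> v" "v \<le> u + 1" for v
    proof (intro exI conjI)
      have "pi \<le> t * v" "t * v \<le> 2 * pi"
      proof -
        show "pi \<le> t * v" using v W t by (simp add: field_simps)
        have "t * v \<le> t * (W + 1)" using v u t by (intro mult_left_mono) auto
        then have "t * v \<le> t * W + t" by (simp add: algebra_simps)
        then show "t * v \<le> 2 * pi" using t W by simp
      qed
      then have "0 \<le> sin (t * v - pi)" by (intro sin_ge_zero) auto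
      then have "sin (t * v) \<le> 0" by simp
      then show "strip_mode t 0 v \<le> 0"
        unfolding strip_mode_def by (simp add: mult_nonneg_nonpos)
    qed (rule strip_mode_deriv[OF t])
    have "strip_rate t * strip_mode t 0 (u + 1 - 1) \<le> strip_rate t * strip_mode t 0 (W - 1)"
      using that d by (intro DERIV_nonpos_imp_nonincreasing[of W "u + 1"]) auto
    then show ?thesis using strip_rate_pos[OF t] by simp
  qed
  have "strip_op W (\<lambda>v. ennreal (strip_mode t 0 v)) u =
     ennreal (strip_rate t * (strip_mode t 0 (min (u + 1) W - 1) - strip_mode t 0 (- 1)))"
    using u W1 pos t unfolding strip_op_def by (subst nn_integral_strip_mode) auto
  moreover have "strip_mode t 0 u \<le> strip_mode t 0 (min (u + 1) W - 1) - strip_mode t 0 (- 1)"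
    using m1 decr by (cases "u + 1 \<le> W") (auto simp: min_def)
  ultimately show ?thesis
    using strip_rate_pos[OF t] pos[OF u]
    by (auto simp: ennreal_mult[symmetric] intro!: ennreal_leI)
qed

text \<open>With phase \<open>1\<close> the boundary term at \<open>- 1\<close> is \<open>0\<close>,
  so the untruncated integral up to \<open>u + 1\<close> is exactly the rate times the mode.
  Dropping the truncation gives an upper bound as long as the mode is nonnegative up to
  \<open>W + 1\<close>; this is \<open>t * (W + 2) \<le> pi\<close>.\<close>

lemma strip_mode_supersolution:
  assumes t: "0 < t" "t < pi" and W: "0 \<le> W" "t * (W + 2) \<le> pi" and u: "0 \<le> u" "u \<le> W"
  shows "strip_op W (\<lambda>v. ennreal (strip_mode t 1 v)) u
    \<le> ennreal (strip_rate t) * ennreal (strip_mode t 1 u)"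
proof -
  have pos: "0 \<le> strip_mode t 1 v" if "0 \<le> v" "v \<le> W + 1" for v
  proof -
    have "t * (v + 1) \<le> t * (W + 2)" using that t by (intro mult_left_mono) auto
    then have "t * (v + 1) \<le> pi" using W by linarith
    then have "0 \<le> sin (t * (v + 1))" using that t by (intro sin_ge_zero) auto
    then show ?thesis unfolding strip_mode_def by simp
  qed
  have "strip_op W (\<lambda>v. ennreal (strip_mode t 1 v)) u
      \<le> (\<integral>\<^sup>+v. indicator {0..u + 1} v * ennreal (strip_mode t 1 v) \<partial>lborel)"
    using u unfolding strip_op_def by (auto intro!: nn_integral_mono simp: indicator_def)
  also have "\<dots> = ennreal (strip_rate t * (strip_mode t 1 (u + 1 - 1) - strip_mode t 1 (- 1)))"
    using u pos t by (intro nn_integral_strip_mode) auto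
  also have "\<dots> = ennreal (strip_rate t) * ennreal (strip_mode t 1 u)"
    using strip_rate_pos[OF t] pos[of u] u
    by (subst ennreal_mult[symmetric]) (auto simp: strip_mode_def)
  finally show ?thesis .
qed

lemma t_cot_bounds:
  assumes t: "0 < t" "t < pi / 2"
  shows "0 \<le> t * cot t" "t * cot t \<le> (1::real)"
proof -
  have sc: "0 < sin t" "0 < cos t" using t by (auto simp: sin_gt_zero cos_gt_zero)
  have "sin 0 - 0 * cos 0 \<le> sin t - t * cos t"
  proof (rule DERIV_nonneg_imp_nondecreasing[of 0 t "\<lambda>x. sin x - x * cos x"])
    fix x :: real assume "0 \<le> x" "x \<le> t"
    then have "((\<lambda>x. sin x - x * cos x) has_real_derivative x * sin x) (at x)" "0 \<le> x * sin x"
      using t by (auto intro!: derivative_eq_intros mult_nonneg_nonneg sin_ge_zero)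
    then show "\<exists>y. ((\<lambda>x. sin x - x * cos x) has_real_derivative y) (at x) \<and> 0 \<le> y" by blast
  qed (use t in auto)
  then show "0 \<le> t * cot t" "t * cot t \<le> 1"
    using sc t by (auto simp: cot_def field_simps)
qed

text \<open>After division by \<open>sin t\<close> the supersolution lies between \<open>1\<close>
  and \<open>exp W / sin t\<close>, the normalisation under which it serves as a potential for fresh
  runs.\<close>

lemma strip_mode_bounds:
  assumes t: "0 < t" "t < pi / 2" and W: "t * (W + 2) \<le> pi" and u: "0 \<le> u" "u \<le> W"
  shows "sin t \<le> strip_mode t 1 u" "strip_mode t 1 u \<le> exp u"
proof -
  note ct = t_cot_bounds[OF t]
  have le: "t \<le> t * (u + 1)" using t u by simp
  have "t * (u + 1) \<le> t * (W + 1)" using t u by (intro mult_left_mono) auto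
  then have ge: "t * (u + 1) \<le> pi - t" using W by (simp add: algebra_simps)
  have s: "sin t \<le> sin (t * (u + 1))"
  proof (cases "t * (u + 1) \<le> pi / 2")
    case True
    then show ?thesis using le t by (intro sin_monotone_2pi_le) auto
  next
    case False
    have "sin t \<le> sin (pi - t * (u + 1))" using False ge t by (intro sin_monotone_2pi_le) auto
    then show ?thesis by simp
  qed
  have st: "0 < sin t" using t by (simp add: sin_gt_zero)
  have "1 \<le> exp (t * cot t * u)" using ct u by simp
  then have "1 * sin t \<le> exp (t * cot t * u) * sin (t * (u + 1))"
    using s st by (intro mult_mono) auto
  then show "sin t \<le> strip_mode t 1 u" unfolding strip_mode_def by simp
  have "exp (t * cot t * u) \<le> exp u" using ct u by (simp add: mult_left_le_one_le)
  moreover have "exp (t * cot t * u) * sin (t * (u + 1)) \<le> exp (t * cot t * u) * 1"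
    by (intro mult_left_mono) auto
  ultimately show "strip_mode t 1 u \<le> exp u" unfolding strip_mode_def by linarith
qed

section \<open>Windows observed every \<open>T\<close> steps\<close>

fun strip_chain :: "real \<Rightarrow> nat \<Rightarrow> (nat \<Rightarrow> real set) \<Rightarrow> nat list \<Rightarrow> (real \<Rightarrow> ennreal) \<Rightarrow> real \<Rightarrow> ennreal" where
  "strip_chain W T J [] f = f"
| "strip_chain W T J (j # js) f = (strip_op W ^^ T) (\<lambda>v. indicator (J j) v * strip_chain W T J js f v)"

lemma strip_chain_append:
  "strip_chain W T J (xs @ ys) f = strip_chain W T J xs (strip_chain W T J ys f)"
  by (induction xs) auto

context
  fixes J :: "nat \<Rightarrow> real set" and r :: nat and W :: real
  assumes J_borel [measurable]: "\<And>i. J i \<in> sets borel"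
    and J_sub: "\<And>i. J i \<subseteq> {0..W}"
    and J_cover: "{0..W} \<subseteq> (\<Union>i<r. J i)"
begin

lemma strip_chain_measurable [measurable]:
  "f \<in> borel_measurable borel \<Longrightarrow> strip_chain W T J xs f \<in> borel_measurable borel"
  by (induction xs) auto

lemma strip_chain_le:
  assumes "f \<in> borel_measurable borel" "0 \<le> u" "u \<le> W"
  shows "strip_chain W T J xs f u \<le> (strip_op W ^^ (length xs * T)) f u"
  using assms(2,3)
proof (induction xs arbitrary: u)
  case (Cons a xs)
  have "strip_chain W T J (a # xs) f u \<le> (strip_op W ^^ T) ((strip_op W ^^ (length xs * T)) f) u"
    unfolding strip_chain.simps using Cons
    by (intro strip_op_funpow_mono_strip) (auto simp: indicator_def)
  then show ?case by (simp add: funpow_add)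
qed auto

text \<open>Every path is in some window at each observation time, so the window sequences account
  for all of the mass; windows may overlap, hence only an inequality. Observing only every
  \<open>T\<close> steps makes any return between two observations at least \<open>T\<close> steps
  long.\<close>

lemma strip_op_le_sum_chain:
  assumes f [measurable]: "f \<in> borel_measurable borel" and "0 \<le> u" "u \<le> W"
  shows "(strip_op W ^^ (m * T)) f u
    \<le> (\<Sum>xs | set xs \<subseteq> {..<r} \<and> length xs = m. strip_chain W T J xs f u)"
  using assms(2,3)
proof (induction m arbitrary: u)
  case 0
  have "{xs. set xs \<subseteq> {..<r} \<and> length xs = 0} = {[]}" by auto
  then show ?case by simp
next
  case (Suc m)
  let ?L = "\<lambda>m. {xs. set xs \<subseteq> {..<r} \<and> length xs = m}"
  have fin: "finite (?L m)" by (rule finite_lists_length_eq) simp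
  have split: "h v \<le> (\<Sum>j<r. indicator (J j) v * h v)" if v: "0 \<le> v" "v \<le> W" for v and h :: "real \<Rightarrow> ennreal"
  proof -
    obtain j where j: "j < r" "v \<in> J j" using J_cover v by auto
    have "h v = indicator (J j) v * h v" using j by simp
    also have "\<dots> \<le> (\<Sum>j<r. indicator (J j) v * h v)"
      using j by (intro member_le_sum) auto
    finally show ?thesis .
  qed
  have "(strip_op W ^^ (Suc m * T)) f u = (strip_op W ^^ T) ((strip_op W ^^ (m * T)) f) u"
    by (simp add: funpow_add)
  also have "\<dots> \<le> (strip_op W ^^ T) (\<lambda>v. \<Sum>xs\<in>?L m. strip_chain W T J xs f v) u"
    using Suc by (intro strip_op_funpow_mono_strip) auto
  also have "\<dots> \<le> (strip_op W ^^ T) (\<lambda>v. \<Sum>xs\<in>?L m. \<Sum>j<r. indicator (J j) v * strip_chain W T J xs f v) u"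
    using Suc.prems by (intro strip_op_funpow_mono_strip sum_mono split) auto
  also have "\<dots> = (\<Sum>xs\<in>?L m. \<Sum>j<r. strip_chain W T J (j # xs) f u)"
  proof -
    have "(strip_op W ^^ T) (\<lambda>v. \<Sum>j<r. indicator (J j) v * strip_chain W T J xs f v) u
       = (\<Sum>j<r. strip_chain W T J (j # xs) f u)" for xs
      unfolding strip_chain.simps by (rule strip_op_funpow_sum) measurable
    then show ?thesis by (subst strip_op_funpow_sum) simp_all
  qed
  also have "\<dots> = (\<Sum>(xs, j)\<in>?L m \<times> {..<r}. strip_chain W T J (j # xs) f u)"
    by (simp add: sum.cartesian_product)
  also have "\<dots> = (\<Sum>xs\<in>?L (Suc m). strip_chain W T J xs f u)"
    by (rule sum.reindex_bij_witness[of _ "\<lambda>xs. (tl xs, hd xs)" "\<lambda>(xs, j). j # xs"])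
       (auto simp: length_Suc_conv)
  finally show ?case .
qed

text \<open>
  Among \<open>r + 1\<close> observation times two must lie in the same window, so a lower bound on the total mass
  gives a lower bound on the mass returning to some window.
\<close>

lemma strip_window_return_bound:
  fixes f g :: "real \<Rightarrow> ennreal" and c1 c2 A H \<kappa> :: ennreal
  assumes f [measurable]: "f \<in> borel_measurable borel" and g [measurable]: "g \<in> borel_measurable borel"
    and sub: "\<And>u. 0 \<le> u \<Longrightarrow> u \<le> W \<Longrightarrow> c1 * f u \<le> strip_op W f u"
    and sup: "\<And>u. 0 \<le> u \<Longrightarrow> u \<le> W \<Longrightarrow> strip_op W g u \<le> c2 * g u"
    and fg: "\<And>u. 0 \<le> u \<Longrightarrow> u \<le> W \<Longrightarrow> f u \<le> A * g u"
    and H: "\<And>i u v. i < r \<Longrightarrow> u \<in> J i \<Longrightarrow> v \<in> J i \<Longrightarrow> g u \<le> H * g v"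
    and ret: "\<And>i s u. i < r \<Longrightarrow> 1 \<le> s \<Longrightarrow> s \<le> r \<Longrightarrow> u \<in> J i \<Longrightarrow>
      (strip_op W ^^ (s * T)) (indicator (J i)) u \<le> \<kappa> * c2 ^ (s * T)"
    and u0: "0 \<le> u0" "u0 \<le> W"
  shows "c1 ^ (Suc r * T) * f u0 \<le> of_nat (r ^ Suc r) * (A * H * \<kappa> * c2 ^ (Suc r * T) * g u0)"
proof -
  let ?L = "{xs. set xs \<subseteq> {..<r} \<and> length xs = Suc r}"
  have bound: "strip_chain W T J xs f u0 \<le> A * H * \<kappa> * c2 ^ (Suc r * T) * g u0" if xs: "xs \<in> ?L" for xs
  proof -
    have "\<not> distinct xs"
    proof
      assume "distinct xs"
      then have "card (set xs) = Suc r" using xs distinct_card by fastforce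
      moreover have "card (set xs) \<le> card {..<r}" using xs by (intro card_mono) auto
      ultimately show False by simp
    qed
    \<comment> \<open>The path is cut at two visits to window \<open>j\<close>. It is bounded from
      its end: \<open>tail\<close> is the part after the second visit, \<open>mid\<close> adds the
      return, and the part before the first visit comes last.\<close>
    then obtain as bs cs j where dec: "xs = as @ [j] @ bs @ [j] @ cs"
      using not_distinct_decomp by metis
    have j: "j < r" using xs dec by auto
    have len: "length as + length bs + length cs + 1 = r" using xs dec by auto
    let ?a = "length as * T + T" and ?s = "Suc (length bs) * T" and ?c = "length cs * T"
    have sT: "Suc r * T = ?a + (?s + ?c)" using len by (auto simp: algebra_simps)
    have s: "1 \<le> Suc (length bs)" "Suc (length bs) \<le> r" using len by auto
    have Jj: "0 \<le> u \<and> u \<le> W" if "u \<in> J j" for u using J_sub that by force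
    have tail: "strip_chain W T J cs f u \<le> A * (c2 ^ ?c * g u)" if u: "0 \<le> u" "u \<le> W" for u
    proof -
      have "strip_chain W T J cs f u \<le> (strip_op W ^^ ?c) f u"
        by (rule strip_chain_le[OF f u])
      also have "\<dots> \<le> (strip_op W ^^ ?c) (\<lambda>v. A * g v) u"
        using fg u by (intro strip_op_funpow_mono_strip) auto
      also have "\<dots> = A * (strip_op W ^^ ?c) g u" by (rule strip_op_funpow_cmult[OF g])
      also have "\<dots> \<le> A * (c2 ^ ?c * g u)"
        using u sup by (intro mult_left_mono strip_op_funpow_supersolution) auto
      finally show ?thesis .
    qed
    let ?Q = "\<lambda>u. indicator (J j) u * strip_chain W T J (bs @ [j] @ cs) f u"
    have mid: "?Q u \<le> A * H * \<kappa> * c2 ^ (?s + ?c) * g u" for u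
    proof (cases "u \<in> J j")
      case True
      then have u: "0 \<le> u" "u \<le> W" using Jj by auto
      let ?R = "\<lambda>v. indicator (J j) v * strip_chain W T J cs f v"
      have "strip_chain W T J (bs @ [j] @ cs) f u = strip_chain W T J bs ((strip_op W ^^ T) ?R) u"
        by (simp add: strip_chain_append)
      also have "\<dots> \<le> (strip_op W ^^ (length bs * T)) ((strip_op W ^^ T) ?R) u"
        by (rule strip_chain_le[OF _ u]) measurable
      also have "\<dots> = (strip_op W ^^ ?s) ?R u"
      proof -
        have "?s = length bs * T + T" by simp
        then show ?thesis by (simp only: funpow_add o_apply)
      qed
      \<comment> \<open>Both visits lie in \<open>J j\<close>, so \<open>H\<close> trades
        \<open>g v\<close> for the constant \<open>g u\<close>; what remains is the return mass of
        the window, to which \<open>ret\<close> applies.\<close>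
      also have "\<dots> \<le> (strip_op W ^^ ?s) (\<lambda>v. (A * (c2 ^ ?c * (H * g u))) * indicator (J j) v) u"
      proof (rule strip_op_funpow_mono_strip[OF _ u])
        fix v assume v: "0 \<le> v" "v \<le> W"
        show "?R v \<le> (A * (c2 ^ ?c * (H * g u))) * indicator (J j) v"
        proof (cases "v \<in> J j")
          case vj: True
          have "strip_chain W T J cs f v \<le> A * (c2 ^ ?c * g v)" by (rule tail[OF v])
          also have "\<dots> \<le> A * (c2 ^ ?c * (H * g u))"
            using H[OF j vj True] by (intro mult_left_mono) auto
          finally show ?thesis using vj by simp
        qed simp
      qed
      also have "\<dots> = (A * (c2 ^ ?c * (H * g u))) * (strip_op W ^^ ?s) (indicator (J j)) u"
        by (rule strip_op_funpow_cmult) measurable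
      also have "\<dots> \<le> (A * (c2 ^ ?c * (H * g u))) * (\<kappa> * c2 ^ ?s)"
        using ret[OF j s True] by (intro mult_left_mono) auto
      finally show ?thesis using True by (simp add: mult_ac power_add)
    qed simp
    have "strip_chain W T J xs f u0 = strip_chain W T J as ((strip_op W ^^ T) ?Q) u0"
      by (simp add: dec strip_chain_append)
    also have "\<dots> \<le> (strip_op W ^^ (length as * T)) ((strip_op W ^^ T) ?Q) u0"
      by (rule strip_chain_le[OF _ u0]) measurable
    also have "\<dots> = (strip_op W ^^ ?a) ?Q u0"
      by (simp add: funpow_add)
    also have "\<dots> \<le> (strip_op W ^^ ?a) (\<lambda>u. (A * H * \<kappa> * c2 ^ (?s + ?c)) * g u) u0"
      using mid by (intro strip_op_funpow_mono_strip u0) 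
    also have "\<dots> = (A * H * \<kappa> * c2 ^ (?s + ?c)) * (strip_op W ^^ ?a) g u0"
      by (rule strip_op_funpow_cmult[OF g])
    also have "\<dots> \<le> (A * H * \<kappa> * c2 ^ (?s + ?c)) * (c2 ^ ?a * g u0)"
      using sup u0 by (intro mult_left_mono strip_op_funpow_supersolution) auto
    finally show ?thesis unfolding sT by (simp add: mult_ac power_add)
  qed
  have "c1 ^ (Suc r * T) * f u0 \<le> (strip_op W ^^ (Suc r * T)) f u0"
    using sub u0 by (intro strip_op_funpow_subsolution) auto
  also have "\<dots> \<le> (\<Sum>xs\<in>?L. strip_chain W T J xs f u0)"
    by (rule strip_op_le_sum_chain[OF f u0])
  also have "\<dots> \<le> of_nat (card ?L) * (A * H * \<kappa> * c2 ^ (Suc r * T) * g u0)"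
    by (rule sum_bounded_above) (rule bound)
  also have "card ?L = r ^ Suc r" by (subst card_lists_length_eq) auto
  finally show ?thesis .
qed

end

subsection \<open>Weights along a path\<close>

definition exp_measure :: "real measure" where
  "exp_measure = density lborel (exponential_density 1)"

lemma sets_exp_measure [measurable_cong, simp]: "sets exp_measure = sets borel"
  by (simp add: exp_measure_def)

lemma space_exp_measure [simp]: "space exp_measure = UNIV"
  by (simp add: exp_measure_def)

lemma prob_space_exp_measure: "prob_space exp_measure"
  unfolding exp_measure_def by (rule prob_space_exponential_density) simp

interpretation exp_measure: prob_space exp_measure
  by (rule prob_space_exp_measure)

interpretation exp_prod: product_sigma_finite "\<lambda>_ :: 'e. exp_measure"
  by standard

lemma prob_space_exp_prod: "prob_space (Pi\<^sub>M J (\<lambda>_ :: 'e. exp_measure))"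
  by (intro prob_space_PiM prob_space_exp_measure)

abbreviation exp_prod :: "'e set \<Rightarrow> ('e \<Rightarrow> real) measure" where
  "exp_prod J \<equiv> Pi\<^sub>M J (\<lambda>_. exp_measure)"

text \<open>Heights are tested after each edge; the starting height \<open>u\<close> is not. The
  weight function is global, so that weights shared with another tour can be frozen in it.\<close>

fun strip_path :: "real \<Rightarrow> real \<Rightarrow> (real \<Rightarrow> ennreal) \<Rightarrow> 'e list \<Rightarrow> real \<Rightarrow> ('e \<Rightarrow> real) \<Rightarrow> ennreal" where
  "strip_path \<mu> W h [] u w = h u"
| "strip_path \<mu> W h (e # es) u w =
     indicator {0..W} (u + 1 - w e / \<mu>) * strip_path \<mu> W h es (u + 1 - w e / \<mu>) w"

lemma strip_path_cong:
  "(\<And>e. e \<in> set es \<Longrightarrow> w e = w' e) \<Longrightarrow> strip_path \<mu> W h es u w = strip_path \<mu> W h es u w'"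
  by (induction es arbitrary: u) auto

lemma strip_path_measurable:
  assumes [measurable]: "h \<in> borel_measurable borel" "u \<in> borel_measurable N"
    and "\<And>e. e \<in> set es \<Longrightarrow> (\<lambda>z. w z e) \<in> borel_measurable N"
  shows "(\<lambda>z. strip_path \<mu> W h es (u z) (w z)) \<in> borel_measurable N"
  using assms(2,3)
proof (induction es arbitrary: u)
  case (Cons e es)
  have [measurable]: "u \<in> borel_measurable N" "(\<lambda>z. w z e) \<in> borel_measurable N"
    using Cons.prems by auto
  have [measurable]: "(\<lambda>z. strip_path \<mu> W h es (u z + 1 - w z e / \<mu>) (w z)) \<in> borel_measurable N"
    using Cons.prems by (intro Cons.IH) auto
  show ?case by simp
qed simp

definition override :: "'e set \<Rightarrow> ('e \<Rightarrow> real) \<Rightarrow> ('e \<Rightarrow> real) \<Rightarrow> 'e \<Rightarrow> real" where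
  "override J x z = (\<lambda>e. if e \<in> J then z e else x e)"

lemma override_measurable [measurable]: "(\<lambda>z. override J x z e) \<in> borel_measurable (exp_prod J)"
  unfolding override_def by (cases "e \<in> J") auto

lemma nn_integral_exp_measure_affine:
  assumes [measurable]: "G \<in> borel_measurable borel" and \<mu>: "0 < \<mu>"
  shows "(\<integral>\<^sup>+y. G (u + 1 - y / \<mu>) \<partial>exp_measure)
    = ennreal \<mu> * (\<integral>\<^sup>+v. ennreal (exponential_density 1 (\<mu> * (u + 1 - v))) * G v \<partial>lborel)"
proof -
  have "(\<integral>\<^sup>+y. G (u + 1 - y / \<mu>) \<partial>exp_measure)
     = (\<integral>\<^sup>+y. ennreal (exponential_density 1 y) * G (u + 1 - y / \<mu>) \<partial>lborel)"
    unfolding exp_measure_def by (subst nn_integral_density) auto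
  also have "\<dots> = ennreal \<bar>- \<mu>\<bar> * (\<integral>\<^sup>+v. ennreal (exponential_density 1 (\<mu> * (u + 1) + (- \<mu>) * v)) *
      G (u + 1 - (\<mu> * (u + 1) + (- \<mu>) * v) / \<mu>) \<partial>lborel)"
    using \<mu> by (intro nn_integral_real_affine) auto
  also have "\<dots> = ennreal \<mu> * (\<integral>\<^sup>+v. ennreal (exponential_density 1 (\<mu> * (u + 1 - v))) * G v \<partial>lborel)"
  proof -
    have "u + 1 - (\<mu> * (u + 1) + (- \<mu>) * v) / \<mu> = v" for v
      using \<mu> by (simp add: field_simps)
    moreover have "\<mu> * (u + 1) + (- \<mu>) * v = \<mu> * (u + 1 - v)" for v by (simp add: algebra_simps)
    ultimately show ?thesis using \<mu> by (simp only:) simp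
  qed
  finally show ?thesis .
qed

text \<open>The exponential density is at most \<open>1\<close>, and nonnegative weights give
  heights \<open>v \<le> u + 1\<close>; substituting the height for the weight turns a step into
  \<open>\<mu>\<close> times the operator.\<close>

lemma exp_measure_step_le:
  assumes [measurable]: "F \<in> borel_measurable borel" and "0 < \<mu>" "0 \<le> u" "u \<le> W"
  shows "(\<integral>\<^sup>+y. indicator {0..W} (u + 1 - y / \<mu>) * F (u + 1 - y / \<mu>) \<partial>exp_measure)
    \<le> ennreal \<mu> * strip_op W F u"
proof -
  have d: "ennreal (exponential_density 1 (\<mu> * (u + 1 - v))) * x \<le> (if v \<le> u + 1 then x else 0)" for v x
  proof (cases "v \<le> u + 1")
    case True
    then have "exponential_density 1 (\<mu> * (u + 1 - v)) \<le> 1"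
      using assms(2) by (auto simp: exponential_density_def)
    then have "ennreal (exponential_density 1 (\<mu> * (u + 1 - v))) * x \<le> ennreal 1 * x"
      by (intro mult_right_mono ennreal_leI) auto
    then show ?thesis using True by simp
  next
    case False
    then have "\<mu> * (u + 1 - v) < 0" using assms(2) by (simp add: mult_pos_neg)
    then show ?thesis by (simp add: exponential_density_def)
  qed
  have "ennreal (exponential_density 1 (\<mu> * (u + 1 - v))) * (indicator {0..W} v * F v)
      \<le> indicator {0..min (u + 1) W} v * F v" for v
    using d[of v "indicator {0..W} v * F v"] by (auto simp: indicator_def split: if_splits)
  then show ?thesis
    using assms(2-)
    by (subst nn_integral_exp_measure_affine[where G="\<lambda>v. indicator {0..W} v * F v"])
       (auto simp: strip_op_def intro!: mult_left_mono nn_integral_mono)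
qed

text \<open>Heights in the strip correspond to weights of at most \<open>\<mu> * (W + 1)\<close>, on
  which the density is at least \<open>exp (- \<mu> * (W + 1))\<close>.\<close>

lemma exp_measure_step_ge:
  assumes [measurable]: "F \<in> borel_measurable borel" and "0 < \<mu>" "0 \<le> u" "u \<le> W"
  shows "ennreal (\<mu> * exp (- \<mu> * (W + 1))) * strip_op W F u
    \<le> (\<integral>\<^sup>+y. indicator {0..W} (u + 1 - y / \<mu>) * F (u + 1 - y / \<mu>) \<partial>exp_measure)"
proof -
  have d: "exp (- \<mu> * (W + 1)) \<le> exponential_density 1 (\<mu> * (u + 1 - v))"
    if v: "0 \<le> v" "v \<le> u + 1" for v
  proof -
    have "0 \<le> \<mu> * (u + 1 - v)" "\<mu> * (u + 1 - v) \<le> \<mu> * (W + 1)"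
      using v assms by (auto intro!: mult_nonneg_nonneg mult_left_mono)
    then show ?thesis by (auto simp: exponential_density_def)
  qed
  have "ennreal (\<mu> * exp (- \<mu> * (W + 1))) * strip_op W F u =
     ennreal \<mu> * (ennreal (exp (- \<mu> * (W + 1))) * (\<integral>\<^sup>+v. indicator {0..min (u + 1) W} v * F v \<partial>lborel))"
    using assms by (simp add: strip_op_def ennreal_mult mult_ac)
  also have "\<dots> = ennreal \<mu> * (\<integral>\<^sup>+v. ennreal (exp (- \<mu> * (W + 1))) * (indicator {0..min (u + 1) W} v * F v) \<partial>lborel)"
    by (subst nn_integral_cmult) auto
  also have "\<dots> \<le> ennreal \<mu> * (\<integral>\<^sup>+v. ennreal (exponential_density 1 (\<mu> * (u + 1 - v))) *
      (indicator {0..W} v * F v) \<partial>lborel)"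
    using d by (intro mult_left_mono nn_integral_mono) (auto simp: indicator_def intro!: mult_right_mono ennreal_leI)
  also have "\<dots> = (\<integral>\<^sup>+y. indicator {0..W} (u + 1 - y / \<mu>) * F (u + 1 - y / \<mu>) \<partial>exp_measure)"
    using assms by (subst nn_integral_exp_measure_affine[where G="\<lambda>v. indicator {0..W} v * F v"]) auto
  finally show ?thesis .
qed

lemma strip_path_nn_integral_ge:
  assumes [measurable]: "h \<in> borel_measurable borel" and \<mu>: "0 < \<mu>"
    and "finite J" "distinct es" "set es \<subseteq> J" "0 \<le> u" "u \<le> W"
  shows "ennreal (\<mu> * exp (- \<mu> * (W + 1))) ^ length es * (strip_op W ^^ length es) h u
    \<le> (\<integral>\<^sup>+z. strip_path \<mu> W h es u z \<partial>exp_prod J)"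
  using assms(3-)
proof (induction es arbitrary: u J)
  case Nil
  interpret prob_space "exp_prod J" by (rule prob_space_exp_prod)
  show ?case by (simp add: emeasure_space_1)
next
  case (Cons e es)
  let ?c = "ennreal (\<mu> * exp (- \<mu> * (W + 1)))"
  define J' where "J' = J - {e}"
  have J: "J = insert e J'" "e \<notin> J'" "finite J'" using Cons.prems by (auto simp: J'_def)
  have es: "set es \<subseteq> J'" "e \<notin> set es" "distinct es" using Cons.prems by (auto simp: J'_def)
  have m: "(\<lambda>z. strip_path \<mu> W h (e # es) u z) \<in> borel_measurable (exp_prod (insert e J'))"
    using es by (intro strip_path_measurable) auto
  have [measurable]: "(\<lambda>z. strip_path \<mu> W h es v z) \<in> borel_measurable (exp_prod J')" for v
    using es by (intro strip_path_measurable) auto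
  let ?F = "(strip_op W ^^ length es) h"
  have "?c ^ length (e # es) * (strip_op W ^^ length (e # es)) h u
      = ?c ^ length es * (?c * strip_op W ?F u)" by (simp add: mult_ac)
  also have "\<dots> \<le> ?c ^ length es *
     (\<integral>\<^sup>+y. indicator {0..W} (u + 1 - y / \<mu>) * ?F (u + 1 - y / \<mu>) \<partial>exp_measure)"
    using Cons.prems \<mu> by (intro mult_left_mono exp_measure_step_ge) auto
  also have "\<dots> = (\<integral>\<^sup>+y. ?c ^ length es * (indicator {0..W} (u + 1 - y / \<mu>) * ?F (u + 1 - y / \<mu>)) \<partial>exp_measure)"
    by (subst nn_integral_cmult) auto
  also have "\<dots> \<le> (\<integral>\<^sup>+y. indicator {0..W} (u + 1 - y / \<mu>) *
      (\<integral>\<^sup>+z. strip_path \<mu> W h es (u + 1 - y / \<mu>) z \<partial>exp_prod J') \<partial>exp_measure)"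
    using Cons.IH[OF J(3) es(3,1)] by (intro nn_integral_mono) (auto simp: indicator_def)
  also have "\<dots> = (\<integral>\<^sup>+y. (\<integral>\<^sup>+z. strip_path \<mu> W h (e # es) u (z(e := y)) \<partial>exp_prod J') \<partial>exp_measure)"
  proof (intro nn_integral_cong)
    fix y :: real
    have "strip_path \<mu> W h es v (z(e := y)) = strip_path \<mu> W h es v z" for v z
      using es by (intro strip_path_cong) auto
    then show "indicator {0..W} (u + 1 - y / \<mu>) *
      (\<integral>\<^sup>+z. strip_path \<mu> W h es (u + 1 - y / \<mu>) z \<partial>exp_prod J')
      = (\<integral>\<^sup>+z. strip_path \<mu> W h (e # es) u (z(e := y)) \<partial>exp_prod J')"
      by (simp add: nn_integral_cmult)
  qed
  also have "\<dots> = (\<integral>\<^sup>+z. strip_path \<mu> W h (e # es) u z \<partial>exp_prod (insert e J'))"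
    using J m by (intro exp_prod.product_nn_integral_insert_rev[symmetric])
  finally show ?case by (simp only: J(1))
qed

text \<open>
  \<open>J\<close> is the set of edges with fresh weights, and the flag tells whether the preceding edge was
  fresh. A run of fresh edges costs a factor \<open>Mx\<close> at its start.
\<close>

fun fresh_cost :: "real \<Rightarrow> real \<Rightarrow> 'e set \<Rightarrow> bool \<Rightarrow> 'e list \<Rightarrow> real" where
  "fresh_cost q Mx J b [] = 1"
| "fresh_cost q Mx J b (e # es) =
     (if e \<in> J then (if b then q else Mx * q) * fresh_cost q Mx J True es else fresh_cost q Mx J False es)"

lemma fresh_cost_nonneg: "0 \<le> q \<Longrightarrow> 0 \<le> Mx \<Longrightarrow> 0 \<le> fresh_cost q Mx J b es"
  by (induction es arbitrary: b) auto

lemma fresh_cost_cong: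
  "(\<And>e. e \<in> set es \<Longrightarrow> e \<in> J \<longleftrightarrow> e \<in> J') \<Longrightarrow> fresh_cost q Mx J b es = fresh_cost q Mx J' b es"
  by (induction es arbitrary: b) auto

text \<open>The two bounds need each other. While a fresh run continues, the potential
  \<open>g\<close> is carried along and every edge costs \<open>\<mu> * \<rho>\<close>. A frozen
  edge puts the height at an uncontrolled point of the strip, so \<open>g \<ge> 1\<close> discards
  the potential there, and the next fresh run pays \<open>g \<le> Mx\<close> once.\<close>

lemma strip_path_nn_integral_le:
  fixes g :: "real \<Rightarrow> ennreal"
  assumes [measurable]: "g \<in> borel_measurable borel" and \<mu>: "0 < \<mu>" and \<rho>: "0 \<le> \<rho>" and Mx: "0 \<le> Mx"
    and g: "\<And>u. 0 \<le> u \<Longrightarrow> u \<le> W \<Longrightarrow> 1 \<le> g u \<and> g u \<le> ennreal Mx"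
    and sup: "\<And>u. 0 \<le> u \<Longrightarrow> u \<le> W \<Longrightarrow> strip_op W g u \<le> ennreal \<rho> * g u"
    and "finite J" "distinct es" "0 \<le> u" "u \<le> W"
  shows "(\<integral>\<^sup>+z. strip_path \<mu> W (\<lambda>_. 1) es u (override J x z) \<partial>exp_prod J)
      \<le> ennreal (fresh_cost (\<mu> * \<rho>) Mx J True es) * g u \<and>
    (\<integral>\<^sup>+z. strip_path \<mu> W (\<lambda>_. 1) es u (override J x z) \<partial>exp_prod J)
      \<le> ennreal (fresh_cost (\<mu> * \<rho>) Mx J False es)"
  using assms(7-)
proof (induction es arbitrary: u J x)
  case Nil
  interpret prob_space "exp_prod J" by (rule prob_space_exp_prod)
  show ?case using g Nil by (simp add: emeasure_space_1)
next
  case (Cons e es)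
  let ?q = "\<mu> * \<rho>"
  let ?I = "\<integral>\<^sup>+z. strip_path \<mu> W (\<lambda>_. 1) (e # es) u (override J x z) \<partial>exp_prod J"
  have q: "0 \<le> ?q" using \<mu> \<rho> by simp
  have [measurable]: "(\<lambda>z. strip_path \<mu> W (\<lambda>_. 1) es v (override J x z)) \<in> borel_measurable (exp_prod J)" for J x v
    by (intro strip_path_measurable) auto
  have gu: "1 \<le> g u" "g u \<le> ennreal Mx" using g Cons.prems by auto
  show ?case
  proof (cases "e \<in> J")
    case True
    define J' where "J' = J - {e}"
    have J: "J = insert e J'" "e \<notin> J'" "finite J'" using Cons.prems True by (auto simp: J'_def)
    have es: "e \<notin> set es" "distinct es" using Cons.prems by auto
    let ?c = "fresh_cost ?q Mx J True es"
    have c0: "0 \<le> ?c" by (rule fresh_cost_nonneg[OF q Mx])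
    have c: "fresh_cost ?q Mx J' True es = ?c"
      using es J by (intro fresh_cost_cong) auto
    have m: "(\<lambda>z. strip_path \<mu> W (\<lambda>_. 1) (e # es) u (override J x z)) \<in> borel_measurable (exp_prod (insert e J'))"
      unfolding J(1)[symmetric] by (intro strip_path_measurable) auto
    have "?I = (\<integral>\<^sup>+y. (\<integral>\<^sup>+z. strip_path \<mu> W (\<lambda>_. 1) (e # es) u (override J x (z(e := y))) \<partial>exp_prod J') \<partial>exp_measure)"
      using exp_prod.product_nn_integral_insert_rev[OF J(3,2) m] by (simp only: J(1)[symmetric])
    also have "\<dots> = (\<integral>\<^sup>+y. indicator {0..W} (u + 1 - y / \<mu>) *
        (\<integral>\<^sup>+z. strip_path \<mu> W (\<lambda>_. 1) es (u + 1 - y / \<mu>) (override J' (x(e := y)) z) \<partial>exp_prod J') \<partial>exp_measure)"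
    proof (intro nn_integral_cong)
      fix y :: real
      have "override J x (z(e := y)) e' = override J' (x(e := y)) z e'" for z e'
        using J by (auto simp: override_def)
      then have "override J x (z(e := y)) = override J' (x(e := y)) z" for z by (intro ext)
      moreover have "override J' (x(e := y)) z e = y" for z using J by (simp add: override_def)
      ultimately show "(\<integral>\<^sup>+z. strip_path \<mu> W (\<lambda>_. 1) (e # es) u (override J x (z(e := y))) \<partial>exp_prod J')
        = indicator {0..W} (u + 1 - y / \<mu>) *
        (\<integral>\<^sup>+z. strip_path \<mu> W (\<lambda>_. 1) es (u + 1 - y / \<mu>) (override J' (x(e := y)) z) \<partial>exp_prod J')"
        by (simp add: nn_integral_cmult)
    qed
    also have "\<dots> \<le> (\<integral>\<^sup>+y. indicator {0..W} (u + 1 - y / \<mu>) * (ennreal ?c * g (u + 1 - y / \<mu>)) \<partial>exp_measure)"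
      using Cons.IH[OF J(3) es(2)] by (intro nn_integral_mono) (auto simp: indicator_def c)
    also have "\<dots> \<le> ennreal \<mu> * strip_op W (\<lambda>v. ennreal ?c * g v) u"
      using Cons.prems \<mu> by (intro exp_measure_step_le) auto
    also have "\<dots> = ennreal \<mu> * (ennreal ?c * strip_op W g u)" by (subst strip_op_cmult) auto
    also have "\<dots> \<le> ennreal \<mu> * (ennreal ?c * (ennreal \<rho> * g u))"
      using sup Cons.prems by (intro mult_left_mono) auto
    also have "\<dots> = ennreal (?q * ?c) * g u"
      using \<mu> \<rho> c0 by (simp add: ennreal_mult mult_ac)
    finally have I: "?I \<le> ennreal (?q * ?c) * g u" .
    have "ennreal (?q * ?c) * g u \<le> ennreal (?q * ?c) * ennreal Mx"
      using gu by (intro mult_left_mono) auto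
    also have "\<dots> = ennreal (Mx * ?q * ?c)"
      using mult_nonneg_nonneg[OF q c0] Mx by (subst ennreal_mult[symmetric]) (auto simp: mult_ac)
    finally show ?thesis using I True by auto
  next
    case False
    have "override J x z e = x e" for z using False by (simp add: override_def)
    then have "?I = indicator {0..W} (u + 1 - x e / \<mu>) *
        (\<integral>\<^sup>+z. strip_path \<mu> W (\<lambda>_. 1) es (u + 1 - x e / \<mu>) (override J x z) \<partial>exp_prod J)"
      by (simp add: nn_integral_cmult)
    also have "\<dots> \<le> ennreal (fresh_cost ?q Mx J False es)"
      using Cons.IH[of J "u + 1 - x e / \<mu>" x] Cons.prems by (auto simp: indicator_def)
    finally have I: "?I \<le> ennreal (fresh_cost ?q Mx J False es)" .
    also have "\<dots> \<le> ennreal (fresh_cost ?q Mx J False es) * g u"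
      using mult_left_mono[OF gu(1), of "ennreal (fresh_cost ?q Mx J False es)"] by simp
    finally show ?thesis using I False by auto
  qed
qed

subsection \<open>Walks overlapping a fixed cycle\<close>

definition words :: "nat \<Rightarrow> nat \<Rightarrow> nat list set" where
  "words n i = {ws. set ws \<subseteq> {..<n} \<and> length ws = i}"

lemma finite_words [simp]: "finite (words n i)"
  unfolding words_def by (rule finite_lists_length_eq) simp

lemma sum_words_0: "(\<Sum>ws\<in>words n 0. F ws) = F []"
proof -
  have "words n 0 = {[]}" by (auto simp: words_def)
  then show ?thesis by simp
qed

lemma sum_words_Suc: "(\<Sum>ws\<in>words n (Suc i). F ws) = (\<Sum>x<n. \<Sum>ws\<in>words n i. F (x # ws))"
proof -
  have "(\<Sum>ws\<in>words n (Suc i). F ws) = (\<Sum>(x, ws)\<in>{..<n} \<times> words n i. F (x # ws))"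
    by (rule sum.reindex_bij_witness[of _ "\<lambda>(x, ws). x # ws" "\<lambda>ws. (hd ws, tl ws)"])
       (auto simp: words_def length_Suc_conv)
  then show ?thesis by (simp add: sum.cartesian_product)
qed

text \<open>
  The state \<open>p\<close> is \<open>None\<close> after a fresh step and \<open>Some u\<close> after a shared step from \<open>u\<close>; a walk that
  turns back along a shared edge, or does not end with a shared step, has cost \<open>0\<close>.
\<close>

fun walk_cost :: "(nat \<Rightarrow> nat \<Rightarrow> bool) \<Rightarrow> real \<Rightarrow> real \<Rightarrow> nat option \<Rightarrow> nat \<Rightarrow> nat list \<Rightarrow> real" where
  "walk_cost S q Mx p v [] = (if p = None then 0 else 1)"
| "walk_cost S q Mx p v (x # ws) =
     (if S v x then (if p = Some x then 0 else walk_cost S q Mx (Some v) x ws)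
      else (if p = None then q else Mx * q) * walk_cost S q Mx None x ws)"

lemma walk_cost_nonneg: "0 \<le> q \<Longrightarrow> 0 \<le> Mx \<Longrightarrow> 0 \<le> walk_cost S q Mx p v ws"
  by (induction ws arbitrary: p v) auto

text \<open>\<open>S v x\<close> will mean that the edge from \<open>v\<close> to \<open>x\<close>
  lies on a fixed cycle with vertex set \<open>V\<close>. A vertex then has at most two shared
  continuations, and at most one if the walk arrived along a shared edge and does not turn back.
  \<open>q\<close> is the cost of a fresh edge, so \<open>n * q\<close> governs the growth by fresh
  steps.\<close>

locale sparse_overlap =
  fixes S :: "nat \<Rightarrow> nat \<Rightarrow> bool" and V :: "nat set" and n k :: nat and q Mx :: real
  assumes S_V: "S v x \<Longrightarrow> v \<in> V \<and> x \<in> V"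
    and V_fin: "finite V" and V_card: "card V \<le> k"
    and S_deg: "card {x. S v x} \<le> 2"
    and S_forward: "S u v \<Longrightarrow> card ({x. S v x} - {u}) \<le> 1"
    and q: "0 \<le> q" and Mx: "1 \<le> Mx" and n: "0 < n"
begin

definition Q where "Q = max 1 (real n * q)"

definition W where "W i p v = (\<Sum>ws\<in>words n i. walk_cost S q Mx p v ws)"

lemma Q1: "1 \<le> Q" by (simp add: Q_def)

lemma W_nonneg: "0 \<le> W i p v"
  unfolding W_def using q Mx by (intro sum_nonneg walk_cost_nonneg) auto

lemma S_fin: "finite {x. S v x}"
  using S_V V_fin by (auto intro: finite_subset[of _ V])

lemma W_Suc:
  "W (Suc i) p v = (\<Sum>x<n. if S v x then (if p = Some x then 0 else W i (Some v) x)
     else (if p = None then q else Mx * q) * W i None x)"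
  unfolding W_def sum_words_Suc by (intro sum.cong refl) (auto simp: sum_distrib_left)

text \<open>Fresh steps are overcounted by allowing all \<open>n\<close> targets, which makes their
  sum independent of \<open>v\<close>.\<close>

lemma W_Suc_le:
  "W (Suc i) p v \<le> (\<Sum>x\<in>{x. S v x} - set_option p. W i (Some v) x)
     + (if p = None then 1 else Mx) * (q * (\<Sum>x<n. W i None x))"
proof -
  have "W (Suc i) p v = (\<Sum>x<n. (if S v x \<and> p \<noteq> Some x then W i (Some v) x else 0) +
      (if S v x then 0 else (if p = None then q else Mx * q) * W i None x))"
    unfolding W_Suc by (intro sum.cong) auto
  also have "\<dots> \<le> (\<Sum>x<n. if S v x \<and> p \<noteq> Some x then W i (Some v) x else 0) +
      (\<Sum>x<n. (if p = None then q else Mx * q) * W i None x)"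
    unfolding sum.distrib using W_nonneg q Mx by (intro add_left_mono sum_mono) auto
  also have "(\<Sum>x<n. (if p = None then q else Mx * q) * W i None x)
      = (if p = None then 1 else Mx) * (q * (\<Sum>x<n. W i None x))"
    by (auto simp: sum_distrib_left mult_ac)
  also have "(\<Sum>x<n. if S v x \<and> p \<noteq> Some x then W i (Some v) x else 0)
      = (\<Sum>x\<in>{x. x < n \<and> S v x \<and> p \<noteq> Some x}. W i (Some v) x)"
    by (subst sum.inter_filter[symmetric]) (auto intro!: sum.cong)
  also have "\<dots> \<le> (\<Sum>x\<in>{x. S v x} - set_option p. W i (Some v) x)"
    using S_fin W_nonneg by (intro sum_mono2) auto
  finally show ?thesis by simp
qed

context
  fixes K :: nat
  assumes small: "5 * real K ^ 2 * k * Mx \<le> n"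
begin

lemma small_linear: "i \<le> K \<Longrightarrow> 5 * real i * k \<le> n"
proof -
  assume "i \<le> K"
  moreover have "K \<le> K ^ 2" by (cases K) (auto simp: power2_eq_square)
  ultimately have "real i \<le> real (K ^ 2)" by (intro of_nat_mono) simp
  then have "real i \<le> real K ^ 2" by simp
  then have "5 * real i * k \<le> 5 * real K ^ 2 * k * 1" by (simp add: mult_right_mono)
  also have "\<dots> \<le> 5 * real K ^ 2 * k * Mx" using Mx by (intro mult_left_mono) auto
  finally show ?thesis using small by linarith
qed

text \<open>A walk of nonzero cost ends with a shared step, so from a fresh state off
  \<open>V\<close> it must still hit \<open>V\<close>; each remaining step does so with weight about
  \<open>k / n\<close>. On a shared run the walk follows the cycle with weight \<open>1\<close>, and
  an excursion costs \<open>Mx\<close> times the weight of coming back; the at most \<open>i\<close>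
  places to leave the cycle give the term in \<open>i ^ 2\<close>. The last bound averages the first
  two over the target of a fresh step and feeds the next induction step.\<close>

lemma walk_bounds_aux:
  assumes "i \<le> K"
  shows "(\<forall>v. v \<notin> V \<longrightarrow> W i None v \<le> Q ^ i * (5 * real i * k / n)) \<and>
    (\<forall>v. W i None v \<le> Q ^ i * 5) \<and>
    (\<forall>u v. S u v \<longrightarrow> W i (Some u) v \<le> Q ^ i * (1 + 5 * real i ^ 2 * k * Mx / n)) \<and>
    q * (\<Sum>x<n. W i None x) \<le> Q ^ Suc i * (5 * real (Suc i) * k / n)"
  using assms
proof (induction i)
  case 0
  then show ?case using Q1 by (simp add: W_def sum_words_0)
next
  case (Suc i)
  have i: "i \<le> K" using Suc.prems by simp
  have IH: "v \<notin> V \<Longrightarrow> W i None v \<le> Q ^ i * (5 * real i * k / n)"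
    "W i None v \<le> Q ^ i * 5"
    "S u v \<Longrightarrow> W i (Some u) v \<le> Q ^ i * (1 + 5 * real i ^ 2 * k * Mx / n)"
    "q * (\<Sum>x<n. W i None x) \<le> Q ^ Suc i * (5 * real (Suc i) * k / n)" for u v
    using Suc.IH[OF i] by auto
  have Qi: "0 \<le> Q ^ i" "Q ^ i \<le> Q ^ Suc i" using Q1 by auto
  have d2: "1 + 5 * real i ^ 2 * k * Mx / n \<le> 2"
  proof -
    have "5 * real i ^ 2 * k * Mx \<le> 5 * real K ^ 2 * k * Mx"
      using i Mx by (intro mult_right_mono mult_left_mono power_mono) auto
    then show ?thesis using small n by (simp add: field_simps)
  qed
  have lin: "5 * real (Suc i) * k / n \<le> 1"
    using small_linear[OF Suc.prems] n by (simp add: field_simps)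
  have A: "W (Suc i) None v \<le> Q ^ Suc i * (5 * real (Suc i) * k / n)" if v: "v \<notin> V" for v
  proof -
    have "{x. S v x} = {}" using S_V v by blast
    then have "W (Suc i) None v \<le> q * (\<Sum>x<n. W i None x)"
      using W_Suc_le[of i None v] by simp
    then show ?thesis using IH(4) by linarith
  qed
  have sh: "W i (Some v) x \<le> Q ^ i * 2" if "S v x" for v x
    using IH(3)[OF that] mult_left_mono[OF d2 Qi(1)] by linarith
  \<comment> \<open>The constant \<open>5\<close>: two shared neighbours, with factors of at most
    \<open>2\<close> each by \<open>small\<close>, plus at most \<open>1\<close> for leaving by a
    fresh edge.\<close>
  have B: "W (Suc i) None v \<le> Q ^ Suc i * 5" for v
  proof -
    have "(\<Sum>x\<in>{x. S v x}. W i (Some v) x) \<le> real (card {x. S v x}) * (Q ^ i * 2)"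
      using sh by (intro sum_bounded_above) auto
    also have "\<dots> \<le> 2 * (Q ^ i * 2)" using S_deg[of v] Qi by (intro mult_right_mono) auto
    also have "\<dots> \<le> Q ^ Suc i * 4" using Qi by linarith
    finally have "(\<Sum>x\<in>{x. S v x}. W i (Some v) x) \<le> Q ^ Suc i * 4" .
    moreover have "Q ^ Suc i * (5 * real (Suc i) * k / n) \<le> Q ^ Suc i * 1"
      using lin Qi by (intro mult_left_mono) auto
    ultimately show ?thesis using W_Suc_le[of i None v] IH(4) by simp
  qed
  have C: "W (Suc i) (Some u) v \<le> Q ^ Suc i * (1 + 5 * real (Suc i) ^ 2 * k * Mx / n)" if uv: "S u v" for u v
  proof -
    let ?d = "1 + 5 * real i ^ 2 * k * Mx / n"
    have d0: "0 \<le> ?d" using Mx by simp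
    have "(\<Sum>x\<in>{x. S v x} - {u}. W i (Some v) x) \<le> real (card ({x. S v x} - {u})) * (Q ^ i * ?d)"
      using IH(3) by (intro sum_bounded_above) auto
    also have "\<dots> \<le> 1 * (Q ^ i * ?d)" using S_forward[OF uv] Qi d0 by (intro mult_right_mono) auto
    also have "\<dots> \<le> Q ^ Suc i * ?d" using Qi d0 by (auto intro!: mult_right_mono)
    finally have 1: "(\<Sum>x\<in>{x. S v x} - {u}. W i (Some v) x) \<le> Q ^ Suc i * ?d" .
    have 2: "Mx * (q * (\<Sum>x<n. W i None x)) \<le> Mx * (Q ^ Suc i * (5 * real (Suc i) * k / n))"
      using IH(4) Mx by (intro mult_left_mono) auto
    have "?d + Mx * (5 * real (Suc i) * k / n) \<le> 1 + 5 * real (Suc i) ^ 2 * k * Mx / n"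
    proof -
      have "real i ^ 2 + Suc i \<le> real (Suc i) ^ 2" by (simp add: power2_eq_square algebra_simps)
      then have "(real i ^ 2 + Suc i) * (5 * k * Mx / n) \<le> real (Suc i) ^ 2 * (5 * k * Mx / n)"
        using Mx by (intro mult_right_mono) auto
      then show ?thesis by (simp add: algebra_simps add_divide_distrib)
    qed
    then have "Q ^ Suc i * (?d + Mx * (5 * real (Suc i) * k / n)) \<le> Q ^ Suc i * (1 + 5 * real (Suc i) ^ 2 * k * Mx / n)"
      using Qi by (intro mult_left_mono) auto
    moreover have "Q ^ Suc i * (?d + Mx * (5 * real (Suc i) * k / n)) =
      Q ^ Suc i * ?d + Mx * (Q ^ Suc i * (5 * real (Suc i) * k / n))" by (simp add: algebra_simps)
    ultimately show ?thesis using W_Suc_le[of i "Some u" v] 1 2 by simp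
  qed
  have D: "q * (\<Sum>x<n. W (Suc i) None x) \<le> Q ^ Suc (Suc i) * (5 * real (Suc (Suc i)) * k / n)"
  proof -
    let ?a = "Q ^ Suc i * (5 * real (Suc i) * k / n)"
    have a0: "0 \<le> ?a" using Q1 by simp
    \<comment> \<open>All \<open>n\<close> vertices are charged the bound for vertices off
      \<open>V\<close>, and the at most \<open>k\<close> vertices of \<open>V\<close> a further
      \<open>5\<close> each; together the coefficient of \<open>5 * k\<close> grows by one.\<close>
    have "(\<Sum>x<n. W (Suc i) None x) \<le> (\<Sum>x<n. ?a + (if x \<in> V then Q ^ Suc i * 5 else 0))"
      using A B a0 by (intro sum_mono) (smt (verit))
    also have "\<dots> = real n * ?a + (\<Sum>x<n. if x \<in> V then Q ^ Suc i * 5 else 0)"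
      by (simp add: sum.distrib)
    also have "(\<Sum>x<n. if x \<in> V then Q ^ Suc i * 5 else 0) = real (card ({..<n} \<inter> V)) * (Q ^ Suc i * 5)"
      by (subst sum.inter_restrict[symmetric]) auto
    also have "\<dots> \<le> k * (Q ^ Suc i * 5)"
    proof -
      have "card ({..<n} \<inter> V) \<le> card V" using V_fin by (intro card_mono) auto
      then have "card ({..<n} \<inter> V) \<le> k" using V_card by simp
      then show ?thesis using Q1 by (intro mult_right_mono) auto
    qed
    also have "real n * ?a + k * (Q ^ Suc i * 5) = n * (Q ^ Suc i * (5 * real (Suc (Suc i)) * k / n))"
      using n by (simp add: field_simps)
    finally have "q * (\<Sum>x<n. W (Suc i) None x) \<le> q * (n * (Q ^ Suc i * (5 * real (Suc (Suc i)) * k / n)))"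
      using q by (intro mult_left_mono) auto
    also have "\<dots> = (n * q) * (Q ^ Suc i * (5 * real (Suc (Suc i)) * k / n))" by simp
    also have "\<dots> \<le> Q * (Q ^ Suc i * (5 * real (Suc (Suc i)) * k / n))"
      using Q1 by (intro mult_right_mono) (auto simp: Q_def)
    finally show ?thesis by simp
  qed
  show ?case using A B C D by blast
qed

lemma walk_bound_any: "i \<le> K \<Longrightarrow> W i None v \<le> Q ^ i * 5"
  and walk_bound_fresh: "i \<le> K \<Longrightarrow> q * (\<Sum>x<n. W i None x) \<le> Q ^ Suc i * (5 * real (Suc i) * k / n)"
  using walk_bounds_aux[of i] by auto

end

end

subsection \<open>Tours and cycles\<close>

lemma mod_less_of_less: "(i :: nat) < n \<Longrightarrow> j mod n < n"
  by (rule mod_less_divisor) simp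

text \<open>
  The directed case is \<open>edge u v = (u, v)\<close> with minimal cycle length \<open>m0 = 2\<close>, the undirected case
  \<open>edge u v = {u, v}\<close> with \<open>m0 = 3\<close>.
\<close>

locale tour_graph =
  fixes edge :: "nat \<Rightarrow> nat \<Rightarrow> 'e" and m0 :: nat
  assumes edge_eq: "edge u v = edge u' v' \<Longrightarrow> (u = u' \<and> v = v') \<or> (u = v' \<and> v = u')"
    and m0: "2 \<le> m0"
    and two: "m0 = 2 \<Longrightarrow> edge u v = edge v u \<Longrightarrow> u = v"
begin

definition tour :: "nat list \<Rightarrow> 'e list" where
  "tour vs = map (\<lambda>i. edge (vs ! i) (vs ! (Suc i mod length vs))) [0..<length vs]"

definition edges :: "nat \<Rightarrow> 'e set" where
  "edges n = {edge u v | u v. u < n \<and> v < n \<and> u \<noteq> v}"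

definition cycles :: "nat \<Rightarrow> 'e set set" where
  "cycles n = {closed_tour edge vs | vs. distinct vs \<and> set vs \<subseteq> {..<n} \<and> m0 \<le> length vs}"

definition simple_lists :: "nat \<Rightarrow> nat \<Rightarrow> nat list set" where
  "simple_lists n k = {vs. length vs = k \<and> distinct vs \<and> set vs \<subseteq> {..<n}}"

fun walk_edges :: "nat \<Rightarrow> nat list \<Rightarrow> 'e list" where
  "walk_edges v [] = []"
| "walk_edges v (x # ws) = edge v x # walk_edges x ws"

lemma length_tour [simp]: "length (tour vs) = length vs"
  by (simp add: tour_def)

lemma nth_tour: "i < length vs \<Longrightarrow> tour vs ! i = edge (vs ! i) (vs ! (Suc i mod length vs))"
  by (simp add: tour_def)

lemma set_tour: "set (tour vs) = closed_tour edge vs"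
  by (auto simp: tour_def closed_tour_def)

lemma length_walk_edges [simp]: "length (walk_edges v ws) = length ws"
  by (induction ws arbitrary: v) auto

lemma walk_edges_eq_Nil [simp]: "walk_edges v ws = [] \<longleftrightarrow> ws = []"
  by (cases ws) auto

lemma nth_walk_edges: "i < length ws \<Longrightarrow> walk_edges v ws ! i = edge ((v # ws) ! i) (ws ! i)"
  by (induction ws arbitrary: v i) (auto simp: nth_Cons split: nat.split)

lemma tour_eq_walk_edges:
  assumes "vs \<noteq> []"
  shows "tour vs = walk_edges (hd vs) (tl vs @ [hd vs])"
proof (rule nth_equalityI)
  obtain a xs where vs: "vs = a # xs" using assms by (cases vs) auto
  show "length (tour vs) = length (walk_edges (hd vs) (tl vs @ [hd vs]))" using vs by simp
  fix i assume "i < length (tour vs)"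
  then have i: "i < length vs" by simp
  show "tour vs ! i = walk_edges (hd vs) (tl vs @ [hd vs]) ! i"
  proof (cases "Suc i = length vs")
    case True
    then show ?thesis using i vs
      by (simp add: nth_tour nth_walk_edges nth_append nth_Cons split: nat.split)
  next
    case False
    then have "Suc i < length vs" using i by simp
    then show ?thesis using i vs
      by (auto simp: nth_tour nth_walk_edges nth_append nth_Cons split: nat.split)
  qed
qed

lemma tour_rotate: "tour (rotate r vs) = rotate r (tour vs)"
proof (cases "vs = []")
  case False
  show ?thesis
  proof (rule nth_equalityI)
    fix i assume "i < length (tour (rotate r vs))"
    then have i: "i < length vs" by simp
    have s: "Suc i mod length vs < length vs" "(r + i) mod length vs < length vs" using i by (auto intro: mod_less_of_less)
    have "(r + Suc i mod length vs) mod length vs = Suc ((r + i) mod length vs) mod length vs"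
      by (metis add_Suc_right mod_Suc_eq mod_add_right_eq)
    then show "tour (rotate r vs) ! i = rotate r (tour vs) ! i"
      using i s by (simp add: nth_tour nth_rotate)
  qed simp
qed simp

lemma succ_mod_inj:
  assumes "distinct vs" "i < length vs" "j < length vs"
    and "vs ! (Suc i mod length vs) = vs ! (Suc j mod length vs)"
  shows "i = j"
proof -
  have "Suc i mod length vs = Suc j mod length vs"
    using assms by (subst (asm) nth_eq_iff_index_eq) (auto intro: mod_less_of_less)
  then show ?thesis using assms by (auto simp: mod_Suc split: if_splits)
qed

text \<open>Equal edges at different positions are traversed in opposite directions, so each
  position is the cyclic successor of the other. This forces length \<open>2\<close>, a case that
  \<open>two\<close> rules out.\<close>

lemma distinct_tour:
  assumes "distinct vs" "m0 \<le> length vs"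
  shows "distinct (tour vs)"
  unfolding distinct_conv_nth
proof (intro allI impI)
  fix i j assume ij: "i < length (tour vs)" "j < length (tour vs)" "i \<noteq> j"
  let ?k = "length vs"
  have i: "i < ?k" and j: "j < ?k" using ij by auto
  show "tour vs ! i \<noteq> tour vs ! j"
  proof
    assume eq: "tour vs ! i = tour vs ! j"
    then have e: "edge (vs ! i) (vs ! (Suc i mod ?k)) = edge (vs ! j) (vs ! (Suc j mod ?k))"
      using i j by (simp add: nth_tour)
    have ne: "vs ! i \<noteq> vs ! j" using assms i j ij by (simp add: nth_eq_iff_index_eq)
    then have sw: "vs ! i = vs ! (Suc j mod ?k)" "vs ! (Suc i mod ?k) = vs ! j"
      using edge_eq[OF e] by auto
    have m: "Suc i mod ?k < ?k" "Suc j mod ?k < ?k" using i by (auto intro: mod_less_of_less)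
    have ij_mod: "i = Suc j mod ?k" "j = Suc i mod ?k"
      using sw assms i j m by (auto simp: nth_eq_iff_index_eq)
    have si: "j = (if Suc i = ?k then 0 else Suc i)"
      using ij_mod(2) i by (metis Suc_lessI mod_less mod_self)
    have sj: "i = (if Suc j = ?k then 0 else Suc j)"
      using ij_mod(1) j by (metis Suc_lessI mod_less mod_self)
    have k2: "?k = 2"
    proof (cases "Suc i = ?k")
      case True
      then have j0: "j = 0" using si by metis
      then have "Suc j \<noteq> ?k" using assms(2) m0 by linarith
      then have "i = Suc j" using sj by metis
      then show ?thesis using True j0 by linarith
    next
      case False
      then have "j = Suc i" using si by metis
      then show ?thesis using sj ij by (cases "Suc j = ?k") simp_all
    qed
    then have "m0 = 2" using assms m0 by simp
    moreover have "edge (vs ! i) (vs ! j) = edge (vs ! j) (vs ! i)" using e sw by simp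
    ultimately show False using two ne by blast
  qed
qed

lemma card_closed_tour:
  assumes "distinct vs" "m0 \<le> length vs"
  shows "card (closed_tour edge vs) = length vs"
  using distinct_card[OF distinct_tour[OF assms]] by (simp add: set_tour)

lemma set_tour_subset:
  assumes "distinct vs" "set vs \<subseteq> {..<n}" "2 \<le> length vs"
  shows "set (tour vs) \<subseteq> edges n"
proof
  fix e assume "e \<in> set (tour vs)"
  then obtain i where i: "i < length vs" "e = edge (vs ! i) (vs ! (Suc i mod length vs))"
    by (auto simp: tour_def)
  have m: "Suc i mod length vs < length vs" using i by (auto intro: mod_less_of_less)
  have "i \<noteq> Suc i mod length vs" using i assms by (auto simp: mod_Suc)
  then have "vs ! i \<noteq> vs ! (Suc i mod length vs)" using assms i m by (simp add: nth_eq_iff_index_eq)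
  moreover have "vs ! i < n" "vs ! (Suc i mod length vs) < n" using assms i m nth_mem by blast+
  ultimately show "e \<in> edges n" using i by (auto simp: edges_def)
qed

lemma finite_edges [simp]: "finite (edges n)"
proof -
  have "edges n \<subseteq> (\<lambda>(u, v). edge u v) ` ({..<n} \<times> {..<n})" by (auto simp: edges_def)
  then show ?thesis by (rule finite_subset) auto
qed

lemma cycles_subset: "c \<in> cycles n \<Longrightarrow> c \<subseteq> edges n"
  using set_tour_subset m0 unfolding cycles_def set_tour[symmetric]
  by (smt (verit, del_insts) le_trans mem_Collect_eq)

lemma finite_cycles [simp]: "finite (cycles n)"
  using cycles_subset by (intro finite_subset[of "cycles n" "Pow (edges n)"]) auto

lemma cyclesE:
  assumes "c \<in> cycles n"
  obtains vs where "vs \<in> simple_lists n (card c)" "c = closed_tour edge vs" "m0 \<le> card c"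
proof -
  obtain vs where vs: "c = closed_tour edge vs" "distinct vs" "set vs \<subseteq> {..<n}" "m0 \<le> length vs"
    using assms unfolding cycles_def by auto
  then show thesis using that[of vs] card_closed_tour by (simp add: simple_lists_def)
qed

lemma closed_tour_in_cycles:
  "vs \<in> simple_lists n k \<Longrightarrow> m0 \<le> k \<Longrightarrow> closed_tour edge vs \<in> cycles n"
  unfolding cycles_def simple_lists_def by auto

lemma finite_simple_lists [simp]: "finite (simple_lists n k)"
  by (rule finite_subset[OF _ finite_words[of n k]]) (auto simp: words_def simple_lists_def)

lemma card_simple_lists_le: "card (simple_lists n k) \<le> n ^ k"
proof -
  have "card (simple_lists n k) \<le> card (words n k)"
    by (intro card_mono finite_words) (auto simp: words_def simple_lists_def)
  also have "\<dots> = n ^ k" unfolding words_def by (subst card_lists_length_eq) auto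
  finally show ?thesis .
qed

lemma card_simple_lists_ge:
  assumes "k \<le> n"
  shows "(n - k) ^ k \<le> card (simple_lists n k)"
proof -
  have "(n - k) ^ k = (\<Prod>i\<in>{n - k + 1..n}. n - k)" using assms by simp
  also have "\<dots> \<le> \<Prod>{n - k + 1..n}" by (intro prod_mono) auto
  also have "\<dots> = card (simple_lists n k)"
    using card_lists_distinct_length_eq[of "{..<n}" k] assms by (simp add: simple_lists_def)
  finally show ?thesis .
qed

lemma rotate_simple_lists: "vs \<in> simple_lists n k \<Longrightarrow> rotate r vs \<in> simple_lists n k"
  by (auto simp: simple_lists_def)

lemma rotate_inj_on:
  assumes "distinct vs"
  shows "inj_on (\<lambda>r. rotate r vs) {..<length vs}"
proof (rule inj_onI)
  fix r s assume rs: "r \<in> {..<length vs}" "s \<in> {..<length vs}" "rotate r vs = rotate s vs"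
  then have "rotate r vs ! 0 = rotate s vs ! 0" by simp
  then have "vs ! (r mod length vs) = vs ! (s mod length vs)" using rs by (subst (asm) (1 2) nth_rotate) auto
  then show "r = s" using rs assms by (simp add: nth_eq_iff_index_eq)
qed

text \<open>The \<open>k\<close> rotations of a vertex list are different lists that trace the same
  edge set, so each cycle is counted at least \<open>k\<close> times. This factor \<open>k\<close>
  is what makes the first moment series converge.\<close>

lemma card_cycles_le:
  assumes "m0 \<le> k"
  shows "k * card {c \<in> cycles n. card c = k} \<le> n ^ k"
proof -
  let ?C = "{c \<in> cycles n. card c = k}"
  let ?fib = "\<lambda>c. {vs \<in> simple_lists n k. closed_tour edge vs = c}"
  have fib: "k \<le> card (?fib c)" if c: "c \<in> ?C" for c
  proof -
    obtain vs where vs: "vs \<in> simple_lists n k" "c = closed_tour edge vs"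
      using c by (auto elim: cyclesE)
    have len: "length vs = k" "distinct vs" using vs by (auto simp: simple_lists_def)
    have "closed_tour edge (rotate r vs) = c" for r
      using vs by (simp flip: set_tour add: tour_rotate)
    then have sub: "(\<lambda>r. rotate r vs) ` {..<k} \<subseteq> ?fib c"
      using vs rotate_simple_lists by auto
    have "k = card ((\<lambda>r. rotate r vs) ` {..<k})"
      using card_image[OF rotate_inj_on[OF len(2)]] len by simp
    also have "\<dots> \<le> card (?fib c)" using sub by (intro card_mono) auto
    finally show ?thesis .
  qed
  have "k * card ?C = (\<Sum>c\<in>?C. k)" by simp
  also have "\<dots> \<le> (\<Sum>c\<in>?C. card (?fib c))" using fib by (intro sum_mono)
  also have "\<dots> = card (\<Union>c\<in>?C. ?fib c)" by (intro card_UN_disjoint[symmetric]) auto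
  also have "\<dots> \<le> card (simple_lists n k)" by (intro card_mono) auto
  also have "\<dots> \<le> n ^ k" by (rule card_simple_lists_le)
  finally show ?thesis .
qed

section \<open>From edge lists to vertex walks\<close>

fun no_return :: "nat option \<Rightarrow> nat \<Rightarrow> nat list \<Rightarrow> bool" where
  "no_return p v [] = True"
| "no_return p v (x # ws) = (p \<noteq> Some x \<and> no_return (Some v) x ws)"

lemma no_return_Some_nth:
  assumes "\<And>i. Suc i < length (v # ws) \<Longrightarrow> (u # v # ws) ! i \<noteq> ws ! i"
  shows "no_return (Some u) v ws"
  using assms
proof (induction ws arbitrary: u v)
  case (Cons x ws)
  have "u \<noteq> x" using Cons.prems[of 0] by simp
  moreover have "no_return (Some v) x ws"
  proof (rule Cons.IH)
    fix i assume "Suc i < length (x # ws)"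
    then show "(v # x # ws) ! i \<noteq> ws ! i" using Cons.prems[of "Suc i"] by simp
  qed
  ultimately show ?case by simp
qed simp

text \<open>A directed cycle of length \<open>2\<close> does go straight back, hence length at least
  \<open>3\<close>. Excluding this move allows \<open>walk_cost\<close> to give it cost
  \<open>0\<close>; otherwise a shared step could have two shared continuations, and the count could
  double at each step.\<close>

lemma no_return_tour:
  assumes "distinct vs" "3 \<le> length vs"
  shows "no_return None (hd vs) (tl vs @ [hd vs])"
proof -
  obtain a b xs where vs: "vs = a # b # xs" using assms by (cases vs; cases "tl vs") auto
  have "no_return (Some a) b (xs @ [a])"
  proof (rule no_return_Some_nth)
    fix i assume i: "Suc i < length (b # xs @ [a])"
    show "(a # b # xs @ [a]) ! i \<noteq> (xs @ [a]) ! i"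
    proof (cases "i < length xs")
      case True
      have "vs ! i \<noteq> vs ! (Suc (Suc i))"
        using assms vs True by (subst nth_eq_iff_index_eq) auto
      moreover have "(a # b # xs @ [a]) ! i = vs ! i"
        using True vs by (auto simp: nth_append nth_Cons split: nat.split)
      ultimately show ?thesis using True vs by (simp add: nth_append)
    next
      case False
      then have i': "i = length xs" using i by simp
      have "vs ! i \<noteq> vs ! 0" using assms vs i' by (subst nth_eq_iff_index_eq) auto
      moreover have "(a # b # xs @ [a]) ! i = vs ! i"
        using i' vs assms by (auto simp: nth_append nth_Cons split: nat.split)
      ultimately show ?thesis using i' vs by (simp add: nth_append)
    qed
  qed
  then show ?thesis using vs by simp
qed

text \<open>Costs of edge lists become costs of vertex words, which can be summed step by step.
  \<open>p'\<close> is always the previous vertex, while \<open>p\<close> remembers it only after a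
  shared edge. As the last edge is shared and the walk does not turn back, neither of the zeros of
  \<open>walk_cost\<close> occurs.\<close>

lemma fresh_cost_eq_walk_cost:
  assumes "no_return p' v ws" "p = None \<or> p = p'"
    and "ws = [] \<Longrightarrow> p \<noteq> None" "ws \<noteq> [] \<Longrightarrow> last (walk_edges v ws) \<in> E0"
    and "\<And>e. e \<in> set (walk_edges v ws) \<Longrightarrow> e \<in> J \<longleftrightarrow> e \<notin> E0"
  shows "fresh_cost q Mx J (p = None) (walk_edges v ws) = walk_cost (\<lambda>v x. edge v x \<in> E0) q Mx p v ws"
  using assms
proof (induction ws arbitrary: p' p v)
  case (Cons x ws)
  show ?case
  proof (cases "edge v x \<in> E0")
    case True
    have "fresh_cost q Mx J (Some v = None) (walk_edges x ws)
        = walk_cost (\<lambda>v x. edge v x \<in> E0) q Mx (Some v) x ws"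
      using Cons.prems by (intro Cons.IH[of "Some v"]) (auto split: if_splits)
    then show ?thesis using True Cons.prems by auto
  next
    case False
    then have ne: "ws \<noteq> []" using Cons.prems(4) by auto
    have "fresh_cost q Mx J (None = (None :: nat option)) (walk_edges x ws)
        = walk_cost (\<lambda>v x. edge v x \<in> E0) q Mx None x ws"
      using Cons.prems ne by (intro Cons.IH[of "Some v"]) (auto split: if_splits)
    then show ?thesis using False Cons.prems by auto
  qed
qed auto

text \<open>A shared neighbour of \<open>v\<close> is its successor or predecessor on the tour, each
  unique because \<open>vs\<close> is distinct; arriving from \<open>u\<close> uses up one of the
  two.\<close>

lemma sparse_overlap_tour:
  assumes vs: "distinct vs" "length vs = k" and "0 \<le> q" "1 \<le> Mx" "0 < n"
  shows "sparse_overlap (\<lambda>v x. edge v x \<in> set (tour vs)) (set vs) n k q Mx"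
proof -
  let ?S = "\<lambda>v x. edge v x \<in> set (tour vs)"
  define nx where "nx v = {x. \<exists>i<k. vs ! i = v \<and> x = vs ! (Suc i mod k)}" for v
  define pr where "pr v = {x. \<exists>i<k. vs ! i = x \<and> v = vs ! (Suc i mod k)}" for v
  have S: "\<exists>i<k. (v = vs ! i \<and> x = vs ! (Suc i mod k)) \<or> (x = vs ! i \<and> v = vs ! (Suc i mod k))"
    if "?S v x" for v x
    using that vs edge_eq unfolding tour_def by fastforce
  have nx1: "nx v \<subseteq> {x}" if "x \<in> nx v" for v x
    using that vs unfolding nx_def by (auto simp: nth_eq_iff_index_eq)
  have pr1: "pr v \<subseteq> {x}" if "x \<in> pr v" for v x
    using that vs succ_mod_inj[of vs] unfolding pr_def by fastforce
  have small: "\<exists>y. A \<subseteq> {y :: nat}" if "\<And>x. x \<in> A \<Longrightarrow> A \<subseteq> {x}" for A using that by blast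
  obtain y z where yz: "nx v \<subseteq> {y v}" "pr v \<subseteq> {z v}" for v
    using small[OF nx1] small[OF pr1] by metis
  have Ssub: "{x. ?S v x} \<subseteq> nx v \<union> pr v" for v
    using S unfolding nx_def pr_def by blast
  have Ssub': "u \<in> nx v \<union> pr v" if "?S u v" for u v
    using S[OF that] unfolding nx_def pr_def by blast
  show ?thesis
  proof
    show "v \<in> set vs \<and> x \<in> set vs" if vx: "?S v x" for v x
    proof -
      obtain i where "i < k" "(v = vs ! i \<and> x = vs ! (Suc i mod k)) \<or> (x = vs ! i \<and> v = vs ! (Suc i mod k))"
        using S[OF vx] by blast
      moreover from this have "Suc i mod k < k" by (auto intro: mod_less_of_less)
      ultimately show ?thesis using vs by (metis nth_mem)
    qed
    show "card (set vs) \<le> k" using vs card_length by auto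
    have two': "card A \<le> 2" if "A \<subseteq> {y v, z v}" for A v
    proof -
      have "card A \<le> card {y v, z v}" using that by (intro card_mono) auto
      also have "\<dots> \<le> 2" by (simp add: card_insert_if)
      finally show ?thesis .
    qed
    show "card {x. ?S v x} \<le> 2" for v
      using Ssub[of v] yz[of v] by (intro two'[of _ v]) auto
    show "card ({x. ?S v x} - {u}) \<le> 1" if "?S u v" for u v
    proof -
      have sub: "{x. ?S v x} - {u} \<subseteq> {y v, z v} - {u}" using Ssub[of v] yz[of v] by auto
      have "u \<in> {y v, z v}" using Ssub'[OF that] yz[of v] by auto
      have "card ({x. ?S v x} - {u}) \<le> card ({y v, z v} - {u})" using sub by (intro card_mono) auto
      also have "\<dots> = card {y v, z v} - 1" using \<open>u \<in> {y v, z v}\<close> by (subst card_Diff_singleton) auto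
      also have "\<dots> \<le> 1" by (simp add: card_insert_if)
      finally show ?thesis .
    qed
  qed (use assms in auto)
qed

end

subsection \<open>Steady tours and the second moment method\<close>

text \<open>Chebyshev's inequality for the number of events that occur. Pairs that are not dependent
  contribute at most the squared expectation, so the variance is at most \<open>R\<close> times the
  expectation; \<open>R\<close> bounds the expected number of dependent events given that one event
  occurs.\<close>

lemma (in prob_space) second_moment_none:
  fixes A :: "'i \<Rightarrow> 'a set" and R :: real
  assumes I: "finite I" and A [measurable]: "\<And>i. i \<in> I \<Longrightarrow> A i \<in> events"
    and indep: "\<And>i j. i \<in> I \<Longrightarrow> j \<in> I \<Longrightarrow> \<not> dep i j \<Longrightarrow> prob (A i \<inter> A j) \<le> prob (A i) * prob (A j)"
    and dep: "\<And>i. i \<in> I \<Longrightarrow> (\<Sum>j | j \<in> I \<and> dep i j. prob (A i \<inter> A j)) \<le> R * prob (A i)"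
    and pos: "0 < (\<Sum>i\<in>I. prob (A i))"
  shows "prob (space M - (\<Union>i\<in>I. A i)) \<le> R / (\<Sum>i\<in>I. prob (A i))"
proof -
  let ?S = "\<Sum>i\<in>I. prob (A i)"
  define Z where "Z x = (\<Sum>i\<in>I. indicat_real (A i) x)" for x
  have Zm [measurable]: "Z \<in> borel_measurable M" unfolding Z_def by measurable
  have EZ: "expectation Z = ?S"
    unfolding Z_def using A by (subst Bochner_Integration.integral_sum) (auto simp: less_top[symmetric])
  have Z2: "(Z x)\<^sup>2 = (\<Sum>i\<in>I. \<Sum>j\<in>I. indicat_real (A i \<inter> A j) x)" for x
    unfolding Z_def power2_eq_square sum_product by (simp add: indicator_inter_arith)
  have AA [measurable]: "A i \<inter> A j \<in> events" if "i \<in> I" "j \<in> I" for i j using that by auto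
  have int2: "integrable M (\<lambda>x. (Z x)\<^sup>2)"
    unfolding Z2 using AA by (intro Bochner_Integration.integrable_sum) (auto simp: less_top[symmetric])
  have EZ2: "expectation (\<lambda>x. (Z x)\<^sup>2) = (\<Sum>i\<in>I. \<Sum>j\<in>I. prob (A i \<inter> A j))"
  proof -
    have i: "integrable M (indicat_real (A i \<inter> A j))" if "i \<in> I" "j \<in> I" for i j
      using AA[OF that] by (auto simp: less_top[symmetric])
    have "expectation (\<lambda>x. (Z x)\<^sup>2) = (\<Sum>i\<in>I. expectation (\<lambda>x. \<Sum>j\<in>I. indicat_real (A i \<inter> A j) x))"
      unfolding Z2 using i by (intro Bochner_Integration.integral_sum Bochner_Integration.integrable_sum) auto
    also have "\<dots> = (\<Sum>i\<in>I. \<Sum>j\<in>I. expectation (\<lambda>x. indicat_real (A i \<inter> A j) x))"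
      using i by (intro sum.cong refl Bochner_Integration.integral_sum) auto
    also have "\<dots> = (\<Sum>i\<in>I. \<Sum>j\<in>I. prob (A i \<inter> A j))" using AA by (intro sum.cong refl) simp
    finally show ?thesis .
  qed
  have row: "(\<Sum>j\<in>I. prob (A i \<inter> A j)) \<le> R * prob (A i) + prob (A i) * ?S" if i: "i \<in> I" for i
  proof -
    have "(\<Sum>j\<in>I. prob (A i \<inter> A j)) = (\<Sum>j | j \<in> I \<and> dep i j. prob (A i \<inter> A j)) + (\<Sum>j | j \<in> I \<and> \<not> dep i j. prob (A i \<inter> A j))"
      using I by (subst sum.union_disjoint[symmetric]) (auto intro!: sum.cong)
    also have "(\<Sum>j | j \<in> I \<and> \<not> dep i j. prob (A i \<inter> A j)) \<le> (\<Sum>j | j \<in> I \<and> \<not> dep i j. prob (A i) * prob (A j))"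
      using indep i by (intro sum_mono) auto
    also have "\<dots> \<le> (\<Sum>j\<in>I. prob (A i) * prob (A j))" using I by (intro sum_mono2) auto
    also have "\<dots> = prob (A i) * ?S" by (simp add: sum_distrib_left)
    finally show ?thesis using dep[OF i] by linarith
  qed
  have "expectation (\<lambda>x. (Z x)\<^sup>2) \<le> (\<Sum>i\<in>I. R * prob (A i) + prob (A i) * ?S)"
    unfolding EZ2 by (intro sum_mono row)
  also have "\<dots> = R * ?S + ?S\<^sup>2"
    by (simp add: sum.distrib power2_eq_square flip: sum_distrib_left sum_distrib_right)
  finally have var: "variance Z \<le> R * ?S"
    using variance_eq[OF _ int2] square_integrable_imp_integrable[OF Zm int2] EZ by simp
  have "prob (space M - (\<Union>i\<in>I. A i)) \<le> prob {x \<in> space M. \<bar>Z x - expectation Z\<bar> \<ge> ?S}"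
  proof (rule finite_measure_mono)
    show "space M - (\<Union>i\<in>I. A i) \<subseteq> {x \<in> space M. ?S \<le> \<bar>Z x - expectation Z\<bar>}"
    proof
      fix x assume x: "x \<in> space M - (\<Union>i\<in>I. A i)"
      then have "Z x = 0" unfolding Z_def by (intro sum.neutral) (auto simp: indicator_def)
      then show "x \<in> {x \<in> space M. ?S \<le> \<bar>Z x - expectation Z\<bar>}" using x EZ by auto
    qed
  qed measurable
  also have "\<dots> \<le> variance Z / ?S\<^sup>2"
    using Chebyshev_inequality[OF Zm int2 pos] by simp
  also have "\<dots> \<le> R * ?S / ?S\<^sup>2" using var pos by (intro divide_right_mono) auto
  also have "\<dots> = R / ?S" using pos by (simp add: power2_eq_square)
  finally show ?thesis .
qed

section \<open>Excess over the line and steady tours\<close>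

definition excess :: "real \<Rightarrow> 'e list \<Rightarrow> ('e \<Rightarrow> real) \<Rightarrow> real" where
  "excess \<mu> es w = (\<Sum>e\<leftarrow>es. 1 - w e / \<mu>)"

lemma excess_simps [simp]:
  "excess \<mu> [] w = 0"
  "excess \<mu> (e # es) w = 1 - w e / \<mu> + excess \<mu> es w"
  "excess \<mu> (xs @ ys) w = excess \<mu> xs w + excess \<mu> ys w"
  by (simp_all add: excess_def)

lemma excess_measurable:
  "(\<And>e. e \<in> set es \<Longrightarrow> (\<lambda>z. w z e) \<in> borel_measurable N) \<Longrightarrow> (\<lambda>z. excess \<mu> es (w z)) \<in> borel_measurable N"
  by (induction es) auto

lemma excess_cong: "(\<And>e. e \<in> set es \<Longrightarrow> w e = w' e) \<Longrightarrow> excess \<mu> es w = excess \<mu> es w'"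
  unfolding excess_def by (intro arg_cong[where f=sum_list] map_cong) auto

text \<open>In units of \<open>\<mu>\<close> the excess is length minus weight. Bounding every
  segment says that the partial sums stay in some strip of width \<open>W\<close> without naming its
  position; in this form the condition survives rotation up to \<open>\<tau>\<close>. The last
  conjunct says that the tour closes up.\<close>

definition steady :: "real \<Rightarrow> real \<Rightarrow> real \<Rightarrow> 'e list \<Rightarrow> ('e \<Rightarrow> real) \<Rightarrow> bool" where
  "steady \<mu> W \<tau> es w \<longleftrightarrow> (\<forall>i j. \<bar>excess \<mu> (take j (drop i es)) w\<bar> \<le> W) \<and> \<bar>excess \<mu> es w\<bar> \<le> \<tau>"

abbreviation (input) steady_event :: "real \<Rightarrow> real \<Rightarrow> real \<Rightarrow> 'e set \<Rightarrow> 'e list \<Rightarrow> ('e \<Rightarrow> real) set" where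
  "steady_event \<mu> W \<tau> E es \<equiv> {z \<in> space (exp_prod E). steady \<mu> W \<tau> es z}"

lemma steady_measurable:
  assumes "\<And>e. e \<in> set es \<Longrightarrow> (\<lambda>z. w z e) \<in> borel_measurable N"
  shows "Measurable.pred N (\<lambda>z. steady \<mu> W \<tau> es (w z))"
proof -
  have [measurable]: "(\<lambda>z. excess \<mu> (take j (drop i es)) (w z)) \<in> borel_measurable N" for i j
    using assms by (intro excess_measurable) (auto dest!: in_set_takeD in_set_dropD)
  have [measurable]: "(\<lambda>z. excess \<mu> es (w z)) \<in> borel_measurable N"
    using assms by (intro excess_measurable)
  show ?thesis unfolding steady_def by measurable
qed

lemma steady_cong: "(\<And>e. e \<in> set es \<Longrightarrow> w e = w' e) \<Longrightarrow> steady \<mu> W \<tau> es w = steady \<mu> W \<tau> es w'"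
  unfolding steady_def
  by (intro arg_cong2[where f="(\<and>)"] all_cong1 arg_cong2[where f="(\<le>)"] arg_cong[where f=abs] refl excess_cong)
     (auto dest!: in_set_takeD in_set_dropD)

lemma steady_segment:
  assumes "steady \<mu> W \<tau> (a @ b @ c) w"
  shows "\<bar>excess \<mu> b w\<bar> \<le> W"
proof -
  have "take (length b) (drop (length a) (a @ b @ c)) = b" by simp
  then show ?thesis using assms unfolding steady_def by metis
qed

text \<open>A segment of the rotated list that crosses the old starting point is the complement of
  an ordinary segment, so its excess is the total minus that of the complement.\<close>

lemma steady_swap_segment:
  assumes st: "steady \<mu> W \<tau> (x @ y) w" and eq: "y @ x = a @ b @ c"
  shows "\<bar>excess \<mu> b w\<bar> \<le> W + \<tau>"
proof -
  have \<tau>: "0 \<le> \<tau>" "\<bar>excess \<mu> (x @ y) w\<bar> \<le> \<tau>" using st unfolding steady_def by auto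
  consider (yb) c' where "y = a @ b @ c'" | (xb) a' where "x = a' @ b @ c"
    | (cross) b1 b2 where "y = a @ b1" "b = b1 @ b2" "x = b2 @ c"
    using eq by (auto simp: append_eq_append_conv2)
  then show ?thesis
  proof cases
    case yb
    then have "x @ y = (x @ a) @ b @ c'" by simp
    then show ?thesis using steady_segment[of \<mu> W \<tau> "x @ a" b c' w] st \<tau> by simp
  next
    case xb
    then have "x @ y = a' @ b @ (c @ y)" by simp
    then show ?thesis using steady_segment[of \<mu> W \<tau> a' b "c @ y" w] st \<tau> by simp
  next
    case cross
    then have e: "x @ y = b2 @ (c @ a) @ b1" by simp
    have "\<bar>excess \<mu> (c @ a) w\<bar> \<le> W" using steady_segment[of \<mu> W \<tau> b2 "c @ a" b1 w] st e by simp
    moreover have "excess \<mu> b w = excess \<mu> (x @ y) w - excess \<mu> (c @ a) w" using cross by simp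
    ultimately show ?thesis using \<tau> by linarith
  qed
qed

lemma strip_path_eq_1:
  assumes "\<And>j. j \<le> length es \<Longrightarrow> u + excess \<mu> (take j es) w \<in> {0..W}"
  shows "strip_path \<mu> W (\<lambda>_. 1) es u w = 1"
  using assms
proof (induction es arbitrary: u)
  case (Cons e es)
  have "strip_path \<mu> W (\<lambda>_. 1) es (u + 1 - w e / \<mu>) w = 1"
  proof (rule Cons.IH)
    fix j assume "j \<le> length es"
    then show "u + 1 - w e / \<mu> + excess \<mu> (take j es) w \<in> {0..W}"
      using Cons.prems[of "Suc j"] by (simp add: algebra_simps)
  qed
  moreover have "u + 1 - w e / \<mu> \<in> {0..W}" using Cons.prems[of 1] by (simp add: algebra_simps)
  ultimately show ?case by simp
qed simp

text \<open>The position of the strip is unknown, and a union bound needs finitely many candidates: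
  starting heights are rounded up to integers, which costs one unit of width.\<close>

lemma steady_le_sum_strip_path:
  assumes seg: "\<And>a b c. es = a @ b @ c \<Longrightarrow> \<bar>excess \<mu> b w\<bar> \<le> W"
  shows "1 \<le> (\<Sum>c\<le>nat \<lceil>W\<rceil>. strip_path \<mu> (W + 1) (\<lambda>_. 1) es (real c) w)"
proof -
  let ?P = "\<lambda>j. excess \<mu> (take j es) w"
  define m where "m = Min (?P ` {..length es})"
  have m: "m \<in> ?P ` {..length es}" "\<And>j. j \<le> length es \<Longrightarrow> m \<le> ?P j"
    unfolding m_def by (auto intro: Min_in Min_le)
  obtain i where i: "i \<le> length es" "m = ?P i" using m(1) by auto
  have W: "0 \<le> W" using seg[of "[]" "[]" es] by simp
  have diff: "?P j - m \<le> W" if j: "j \<le> length es" for j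
  proof -
    have s: "\<bar>?P b - ?P a\<bar> \<le> W" if "a \<le> b" "b \<le> length es" for a b
    proof -
      have t: "take b es = take a es @ drop a (take b es)"
        using that by (metis append_take_drop_id min.absorb1 take_take)
      have "es = take a es @ drop a (take b es) @ drop b es"
        using t append_take_drop_id[of b es] by (metis append.assoc)
      from seg[OF this] show ?thesis using arg_cong[OF t, of "\<lambda>l. excess \<mu> l w"] by simp
    qed
    show ?thesis using s[of i j] s[of j i] i j by (cases "i \<le> j") auto
  qed
  have m0: "m \<le> 0" using m(2)[of 0] by simp
  have "- m \<le> W" using diff[of 0] by simp
  define c where "c = nat \<lceil>- m\<rceil>"
  have c: "c \<le> nat \<lceil>W\<rceil>" using \<open>- m \<le> W\<close> unfolding c_def by (intro nat_mono ceiling_mono)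
  have cm: "- m \<le> real c" "real c \<le> - m + 1" using m0 unfolding c_def by linarith+
  have "strip_path \<mu> (W + 1) (\<lambda>_. 1) es (real c) w = 1"
  proof (rule strip_path_eq_1)
    fix j assume "j \<le> length es"
    then show "real c + ?P j \<in> {0..W + 1}" using m(2)[of j] diff[of j] cm by simp
  qed
  then have "1 = strip_path \<mu> (W + 1) (\<lambda>_. 1) es (real c) w" by simp
  also have "\<dots> \<le> (\<Sum>c\<le>nat \<lceil>W\<rceil>. strip_path \<mu> (W + 1) (\<lambda>_. 1) es (real c) w)"
    using c by (intro member_le_sum) auto
  finally show ?thesis .
qed

lemma strip_path_indicator_cases:
  "strip_path \<mu> W (indicator J) es u w = (if (\<forall>j. 1 \<le> j \<and> j \<le> length es \<longrightarrow> u + excess \<mu> (take j es) w \<in> {0..W})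
     \<and> u + excess \<mu> es w \<in> J then 1 else 0)"
proof (induction es arbitrary: u)
  case (Cons e es)
  have eq: "(\<forall>j. 1 \<le> j \<and> j \<le> length (e # es) \<longrightarrow> u + excess \<mu> (take j (e # es)) w \<in> {0..W}) \<longleftrightarrow>
    u + 1 - w e / \<mu> \<in> {0..W} \<and> (\<forall>j. 1 \<le> j \<and> j \<le> length es \<longrightarrow> u + 1 - w e / \<mu> + excess \<mu> (take j es) w \<in> {0..W})"
    (is "?L \<longleftrightarrow> ?R")
  proof
    assume L: ?L
    have "u + 1 - w e / \<mu> \<in> {0..W}" using L[rule_format, of 1] by (simp add: algebra_simps)
    moreover have "u + 1 - w e / \<mu> + excess \<mu> (take j es) w \<in> {0..W}" if "1 \<le> j" "j \<le> length es" for j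
      using L[rule_format, of "Suc j"] that by (simp add: algebra_simps)
    ultimately show ?R by blast
  next
    assume R: ?R
    show ?L
    proof (intro allI impI)
      fix j assume j: "1 \<le> j \<and> j \<le> length (e # es)"
      then obtain i where i: "j = Suc i" by (cases j) auto
      show "u + excess \<mu> (take j (e # es)) w \<in> {0..W}"
        using R j i by (cases "i = 0") (auto simp: algebra_simps)
    qed
  qed
  show ?case unfolding eq using Cons.IH[of "u + 1 - w e / \<mu>"]
    by (auto simp: indicator_def add.assoc algebra_simps)
qed (auto simp: indicator_def)

text \<open>Differences of heights in the strip bound every segment by \<open>W\<close>; starting
  and ending in the same window \<open>J\<close> of diameter \<open>\<tau>\<close> closes the
  tour.\<close>

lemma strip_path_le_steady:
  assumes u: "0 \<le> u" "u \<le> W" "u \<in> J" and J: "\<And>x y. x \<in> J \<Longrightarrow> y \<in> J \<Longrightarrow> \<bar>x - y\<bar> \<le> \<tau>"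
  shows "strip_path \<mu> W (indicator J) es u w \<le> (if steady \<mu> W \<tau> es w then 1 else 0)"
proof -
  have "steady \<mu> W \<tau> es w"
    if h: "\<forall>j. 1 \<le> j \<and> j \<le> length es \<longrightarrow> u + excess \<mu> (take j es) w \<in> {0..W}" "u + excess \<mu> es w \<in> J"
  proof -
    have P: "u + excess \<mu> (take j es) w \<in> {0..W}" for j
    proof -
      consider "j = 0" | "1 \<le> j" "j \<le> length es" | "length es < j" by linarith
      then show ?thesis
      proof cases
        case 3
        then have "take j es = take (length es) es" by simp
        then show ?thesis using h(1)[rule_format, of "length es"] u by (cases es) auto
      qed (use h u in auto)
    qed
    have "excess \<mu> (take j (drop i es)) w = excess \<mu> (take (i + j) es) w - excess \<mu> (take i es) w" for i j
      by (simp add: take_add)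
    then have "\<bar>excess \<mu> (take j (drop i es)) w\<bar> \<le> W" for i j
      using P[of "i + j"] P[of i] by auto
    moreover have "\<bar>excess \<mu> es w\<bar> \<le> \<tau>" using J[OF h(2) u(3)] by simp
    ultimately show ?thesis unfolding steady_def by blast
  qed
  then show ?thesis unfolding strip_path_indicator_cases by auto
qed

section \<open>Conditioning one tour on another\<close>

lemma emeasure_eq_nn_integral_if:
  assumes "Measurable.pred M P"
  shows "emeasure M {z \<in> space M. P z} = (\<integral>\<^sup>+z. (if P z then 1 else 0) \<partial>M)"
proof -
  have "emeasure M {z \<in> space M. P z} = (\<integral>\<^sup>+z. indicator {z \<in> space M. P z} z \<partial>M)"
    using assms by (intro nn_integral_indicator[symmetric]) measurable
  also have "\<dots> = (\<integral>\<^sup>+z. (if P z then 1 else 0) \<partial>M)"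
    by (intro nn_integral_cong) (auto simp: indicator_def)
  finally show ?thesis .
qed

lemma steady_measurable_exp_prod:
  "set es \<subseteq> E \<Longrightarrow> Measurable.pred (exp_prod E) (\<lambda>z. steady \<mu> W \<tau> es z)"
  by (rule steady_measurable) auto

lemma exp_prod_pair_split:
  assumes fin: "finite E" and es0: "set es0 \<subseteq> E" and es1: "set es1 \<subseteq> E"
  shows "emeasure (exp_prod E) {z \<in> space (exp_prod E). steady \<mu> W \<tau> es0 z \<and> steady \<mu> W \<tau> es1 z}
    = (\<integral>\<^sup>+x. (if steady \<mu> W \<tau> es0 x then 1 else 0) *
        (\<integral>\<^sup>+y. (if steady \<mu> W \<tau> es1 (override (E - set es0) x y) then 1 else 0) \<partial>exp_prod (E - set es0))
        \<partial>exp_prod (set es0))"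
proof -
  let ?I = "set es0" and ?J = "E - set es0"
  have EIJ: "E = ?I \<union> ?J" using es0 by auto
  have m: "Measurable.pred (exp_prod E) (\<lambda>z. steady \<mu> W \<tau> es0 z \<and> steady \<mu> W \<tau> es1 z)"
    using steady_measurable_exp_prod[OF es0] steady_measurable_exp_prod[OF es1] by measurable
  have "emeasure (exp_prod E) {z \<in> space (exp_prod E). steady \<mu> W \<tau> es0 z \<and> steady \<mu> W \<tau> es1 z}
    = (\<integral>\<^sup>+z. (if steady \<mu> W \<tau> es0 z \<and> steady \<mu> W \<tau> es1 z then 1 else 0) \<partial>exp_prod E)"
    by (rule emeasure_eq_nn_integral_if[OF m])
  also have "\<dots> = (\<integral>\<^sup>+x. \<integral>\<^sup>+y. (if steady \<mu> W \<tau> es0 (merge ?I ?J (x, y)) \<and> steady \<mu> W \<tau> es1 (merge ?I ?J (x, y)) then 1 else 0)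
      \<partial>exp_prod ?J \<partial>exp_prod ?I)"
  proof -
    have "(\<lambda>z. if steady \<mu> W \<tau> es0 z \<and> steady \<mu> W \<tau> es1 z then 1 else 0 :: ennreal) \<in> borel_measurable (exp_prod E)"
      using m by measurable
    then show ?thesis
      using fin by (intro exp_prod.product_nn_integral_fold[of ?I ?J, unfolded EIJ[symmetric]]) auto
  qed
  also have "\<dots> = (\<integral>\<^sup>+x. (if steady \<mu> W \<tau> es0 x then 1 else 0) *
        (\<integral>\<^sup>+y. (if steady \<mu> W \<tau> es1 (override ?J x y) then 1 else 0) \<partial>exp_prod ?J) \<partial>exp_prod ?I)"
  proof (intro nn_integral_cong)
    fix x
    have "steady \<mu> W \<tau> es0 (merge ?I ?J (x, y)) = steady \<mu> W \<tau> es0 x" for y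
      by (intro steady_cong) (auto simp: merge_def)
    moreover have "steady \<mu> W \<tau> es1 (merge ?I ?J (x, y)) = steady \<mu> W \<tau> es1 (override ?J x y)" for y
      using es1 by (intro steady_cong) (auto simp: merge_def override_def)
    ultimately show "(\<integral>\<^sup>+y. (if steady \<mu> W \<tau> es0 (merge ?I ?J (x, y)) \<and> steady \<mu> W \<tau> es1 (merge ?I ?J (x, y)) then 1 else 0)
      \<partial>exp_prod ?J) = (if steady \<mu> W \<tau> es0 x then 1 else 0) *
        (\<integral>\<^sup>+y. (if steady \<mu> W \<tau> es1 (override ?J x y) then 1 else 0) \<partial>exp_prod ?J)"
      by auto
  qed
  finally show ?thesis .
qed

lemma exp_prod_marginal:
  assumes fin: "finite E" and "set es1 \<subseteq> I" "I \<subseteq> E"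
  shows "emeasure (exp_prod E) (steady_event \<mu> W \<tau> E es1)
    = (\<integral>\<^sup>+x. (if steady \<mu> W \<tau> es1 x then 1 else 0) \<partial>exp_prod I)"
proof -
  let ?J = "E - I"
  have EIJ: "E = I \<union> ?J" using assms by auto
  have m: "Measurable.pred (exp_prod E) (\<lambda>z. steady \<mu> W \<tau> es1 z)"
    using assms by (intro steady_measurable_exp_prod) auto
  interpret J: prob_space "exp_prod ?J" by (rule prob_space_exp_prod)
  have "emeasure (exp_prod E) (steady_event \<mu> W \<tau> E es1)
    = (\<integral>\<^sup>+z. (if steady \<mu> W \<tau> es1 z then 1 else 0) \<partial>exp_prod E)"
    by (rule emeasure_eq_nn_integral_if[OF m])
  also have "\<dots> = (\<integral>\<^sup>+x. \<integral>\<^sup>+y. (if steady \<mu> W \<tau> es1 (merge I ?J (x, y)) then 1 else 0) \<partial>exp_prod ?J \<partial>exp_prod I)"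
  proof -
    have "(\<lambda>z. if steady \<mu> W \<tau> es1 z then 1 else 0 :: ennreal) \<in> borel_measurable (exp_prod E)"
      using m by measurable
    then show ?thesis
      using fin assms finite_subset
      by (intro exp_prod.product_nn_integral_fold[of I ?J, unfolded EIJ[symmetric]]) auto
  qed
  also have "\<dots> = (\<integral>\<^sup>+x. (if steady \<mu> W \<tau> es1 x then 1 else 0) \<partial>exp_prod I)"
  proof (intro nn_integral_cong)
    fix x
    have "steady \<mu> W \<tau> es1 (merge I ?J (x, y)) = steady \<mu> W \<tau> es1 x" for y
      using assms by (intro steady_cong) (auto simp: merge_def)
    then show "(\<integral>\<^sup>+y. (if steady \<mu> W \<tau> es1 (merge I ?J (x, y)) then 1 else 0) \<partial>exp_prod ?J)
      = (if steady \<mu> W \<tau> es1 x then 1 else 0)" by (simp add: J.emeasure_space_1)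
  qed
  finally show ?thesis .
qed

text \<open>The weights off the first tour are integrated first, with those on it frozen at
  \<open>x\<close>. Since \<open>B\<close> is uniform in \<open>x\<close>, it comes out of the outer
  integral.\<close>

lemma steady_pair_le:
  assumes fin: "finite E" and es0: "set es0 \<subseteq> E" and es1: "set es1 \<subseteq> E"
    and B: "\<And>x. (\<integral>\<^sup>+y. (if steady \<mu> W \<tau> es1 (override (E - set es0) x y) then 1 else 0) \<partial>exp_prod (E - set es0)) \<le> B"
  shows "emeasure (exp_prod E) {z \<in> space (exp_prod E). steady \<mu> W \<tau> es0 z \<and> steady \<mu> W \<tau> es1 z}
    \<le> emeasure (exp_prod E) (steady_event \<mu> W \<tau> E es0) * B"
proof -
  have [measurable]: "Measurable.pred (exp_prod (set es0)) (\<lambda>z. steady \<mu> W \<tau> es0 z)"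
    by (rule steady_measurable_exp_prod) auto
  have "emeasure (exp_prod E) {z \<in> space (exp_prod E). steady \<mu> W \<tau> es0 z \<and> steady \<mu> W \<tau> es1 z}
    \<le> (\<integral>\<^sup>+x. (if steady \<mu> W \<tau> es0 x then 1 else 0) * B \<partial>exp_prod (set es0))"
    unfolding exp_prod_pair_split[OF fin es0 es1] using B
    by (intro nn_integral_mono mult_left_mono) auto
  also have "\<dots> = (\<integral>\<^sup>+x. (if steady \<mu> W \<tau> es0 x then 1 else 0) \<partial>exp_prod (set es0)) * B"
    by (rule nn_integral_multc) measurable
  also have "\<dots> = emeasure (exp_prod E) (steady_event \<mu> W \<tau> E es0) * B"
    using es0 by (subst exp_prod_marginal[OF fin, of es0 "set es0"]) auto
  finally show ?thesis .
qed

lemma steady_pair_indep: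
  assumes fin: "finite E" and es0: "set es0 \<subseteq> E" and es1: "set es1 \<subseteq> E" and disj: "set es0 \<inter> set es1 = {}"
  shows "emeasure (exp_prod E) {z \<in> space (exp_prod E). steady \<mu> W \<tau> es0 z \<and> steady \<mu> W \<tau> es1 z}
    \<le> emeasure (exp_prod E) (steady_event \<mu> W \<tau> E es0) *
      emeasure (exp_prod E) (steady_event \<mu> W \<tau> E es1)"
proof (rule steady_pair_le[OF fin es0 es1])
  fix x
  have sub: "set es1 \<subseteq> E - set es0" using es1 disj by auto
  have "steady \<mu> W \<tau> es1 (override (E - set es0) x y) = steady \<mu> W \<tau> es1 y" for y
    using sub by (intro steady_cong) (auto simp: override_def)
  then show "(\<integral>\<^sup>+y. (if steady \<mu> W \<tau> es1 (override (E - set es0) x y) then 1 else 0) \<partial>exp_prod (E - set es0))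
    \<le> emeasure (exp_prod E) (steady_event \<mu> W \<tau> E es1)"
    using exp_prod_marginal[OF fin sub] by simp
qed

text \<open>The second tour may be read from any starting point; the flag \<open>False\<close>
  charges \<open>Mx\<close> to an initial fresh run. Rotation widens the strip by
  \<open>\<tau>\<close>, rounding of the starting height by \<open>1\<close>, and there are at most
  \<open>W + \<tau> + 2\<close> starting heights.\<close>

lemma steady_rotated_le:
  fixes g :: "real \<Rightarrow> ennreal"
  assumes W: "0 \<le> W" "0 \<le> \<tau>" and \<mu>: "0 < \<mu>" and \<rho>: "0 \<le> \<rho>" and Mx: "0 \<le> Mx"
    and [measurable]: "g \<in> borel_measurable borel"
    and g: "\<And>u. 0 \<le> u \<Longrightarrow> u \<le> W + \<tau> + 1 \<Longrightarrow> 1 \<le> g u \<and> g u \<le> ennreal Mx"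
    and sup: "\<And>u. 0 \<le> u \<Longrightarrow> u \<le> W + \<tau> + 1 \<Longrightarrow> strip_op (W + \<tau> + 1) g u \<le> ennreal \<rho> * g u"
    and J: "finite J" and dist: "distinct es" and rot: "es = rotate r es1"
  shows "(\<integral>\<^sup>+y. (if steady \<mu> W \<tau> es1 (override J x y) then 1 else 0) \<partial>exp_prod J)
    \<le> ennreal ((W + \<tau> + 2) * fresh_cost (\<mu> * \<rho>) Mx J False es)"
proof -
  let ?W = "W + \<tau>"
  let ?c = "fresh_cost (\<mu> * \<rho>) Mx J False es"
  have c0: "0 \<le> ?c" using \<mu> \<rho> Mx by (intro fresh_cost_nonneg) auto
  have step: "(if steady \<mu> W \<tau> es1 w then 1 else 0) \<le> (\<Sum>c\<le>nat \<lceil>?W\<rceil>. strip_path \<mu> (?W + 1) (\<lambda>_. 1) es (real c) w)" for w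
  proof (cases "steady \<mu> W \<tau> es1 w")
    case True
    obtain xs ys where xy: "es1 = xs @ ys" "es = ys @ xs"
      using rot by (metis append_take_drop_id rotate_drop_take)
    have "\<bar>excess \<mu> b w\<bar> \<le> W + \<tau>" if "es = a @ b @ c" for a b c
      using steady_swap_segment[of \<mu> W \<tau> xs ys w a b c] True xy that by simp
    then show ?thesis using True steady_le_sum_strip_path[of es \<mu> w ?W] by simp
  qed simp
  have [measurable]: "(\<lambda>y. strip_path \<mu> (?W + 1) (\<lambda>_. 1) es (real c) (override J x y)) \<in> borel_measurable (exp_prod J)" for c
    by (intro strip_path_measurable) auto
  have "(\<integral>\<^sup>+y. (if steady \<mu> W \<tau> es1 (override J x y) then 1 else 0) \<partial>exp_prod J)
    \<le> (\<integral>\<^sup>+y. (\<Sum>c\<le>nat \<lceil>?W\<rceil>. strip_path \<mu> (?W + 1) (\<lambda>_. 1) es (real c) (override J x y)) \<partial>exp_prod J)"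
    by (intro nn_integral_mono step)
  also have "\<dots> = (\<Sum>c\<le>nat \<lceil>?W\<rceil>. \<integral>\<^sup>+y. strip_path \<mu> (?W + 1) (\<lambda>_. 1) es (real c) (override J x y) \<partial>exp_prod J)"
    by (rule nn_integral_sum) measurable
  also have "\<dots> \<le> (\<Sum>c\<le>nat \<lceil>?W\<rceil>. ennreal ?c)"
  proof (rule sum_mono)
    fix c assume "c \<in> {..nat \<lceil>?W\<rceil>}"
    then have "real c \<le> ?W + 1" using W by simp linarith
    then show "(\<integral>\<^sup>+y. strip_path \<mu> (?W + 1) (\<lambda>_. 1) es (real c) (override J x y) \<partial>exp_prod J) \<le> ennreal ?c"
      using strip_path_nn_integral_le[of g \<mu> \<rho> Mx "?W + 1" J es "real c" x] assms by auto
  qed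
  also have "\<dots> = ennreal (real (Suc (nat \<lceil>?W\<rceil>)) * ?c)"
    using c0 by (simp add: ennreal_of_nat_eq_real_of_nat ennreal_mult)
  also have "\<dots> \<le> ennreal ((W + \<tau> + 2) * ?c)"
    using W c0 by (intro ennreal_leI mult_right_mono) linarith+
  finally show ?thesis .
qed

section \<open>Summing over the tours that meet a given tour\<close>

context tour_graph
begin

text \<open>Otherwise \<open>P\<close> would pass from each entry to its cyclic successor and hold
  everywhere. With \<open>P\<close> for shared edges, the rotated tour begins with a fresh run and
  ends with a shared edge, as \<open>walk_cost\<close> requires.\<close>

lemma rotate_to_boundary:
  assumes "length es = k" "e1 \<in> set es" "P e1" "e2 \<in> set es" "\<not> P e2"
  shows "\<exists>r<k. \<not> P (hd (rotate r es)) \<and> P (last (rotate r es))"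
proof -
  have k: "0 < k" using assms by (cases es) auto
  have "\<exists>i<k. P (es ! i) \<and> \<not> P (es ! (Suc i mod k))"
  proof (rule ccontr)
    assume "\<not> ?thesis"
    then have step: "i < k \<Longrightarrow> P (es ! i) \<Longrightarrow> P (es ! (Suc i mod k))" for i by blast
    obtain i where i: "i < k" "es ! i = e1" using assms by (auto simp: in_set_conv_nth)
    have all: "P (es ! ((i + d) mod k))" for d
    proof (induction d)
      case (Suc d)
      have "P (es ! (Suc ((i + d) mod k) mod k))" using step[of "(i + d) mod k"] Suc k by simp
      then show ?case by (simp add: mod_Suc_eq)
    qed (use i assms in simp)
    obtain j where j: "j < k" "es ! j = e2" using assms by (auto simp: in_set_conv_nth)
    have "(i + (k - i + j)) mod k = j" using i j by simp
    then show False using all[of "k - i + j"] j assms by simp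
  qed
  then obtain i where i: "i < k" "P (es ! i)" "\<not> P (es ! (Suc i mod k))" by blast
  let ?r = "Suc i mod k"
  have r: "?r < k" using k by simp
  have ne: "es \<noteq> []" using assms by auto
  have "hd (rotate ?r es) = es ! ?r" using hd_rotate_conv_nth[OF ne, of ?r] assms r by simp
  moreover have "last (rotate ?r es) = es ! i"
  proof -
    have "last (rotate ?r es) = rotate ?r es ! (k - 1)" using ne assms by (subst last_conv_nth) auto
    also have "\<dots> = es ! ((?r + (k - 1)) mod k)" using assms k by (subst nth_rotate) auto
    also have "(?r + (k - 1)) mod k = i"
    proof -
      have "(?r + (k - 1)) mod k = (Suc i + (k - 1)) mod k" by (simp add: mod_add_left_eq)
      also have "Suc i + (k - 1) = i + k" using k by simp
      finally show ?thesis using i by simp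
    qed
    finally show ?thesis .
  qed
  ultimately show ?thesis using i r by metis
qed

lemma inj_on_hd_tl: "inj_on (\<lambda>vs. (hd vs, tl vs @ [hd vs])) {vs. vs \<noteq> []}"
  by (rule inj_onI) (auto simp: neq_Nil_conv)

text \<open>Vertex lists are embedded into all words with a start in \<open>V\<close>. Forgetting
  that the vertices are distinct only enlarges the sum and opens the way to the recursion over
  steps.\<close>

lemma sum_over_closed_walks:
  assumes k: "1 \<le> k" and V: "finite V"
    and F: "\<And>v ws. 0 \<le> (F v ws :: real)"
    and G: "\<And>vs. vs \<in> A \<Longrightarrow> hd vs \<in> V \<and> G vs \<le> F (hd vs) (tl vs @ [hd vs])"
    and A: "A \<subseteq> simple_lists n k"
  shows "(\<Sum>vs\<in>A. G vs) \<le> (\<Sum>v\<in>V. \<Sum>ws\<in>words n k. F v ws)"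
proof -
  let ?h = "\<lambda>vs. (hd vs, tl vs @ [hd vs])"
  have ne: "vs \<noteq> []" if "vs \<in> A" for vs using that A k by (auto simp: simple_lists_def)
  have inj: "inj_on ?h A" using ne by (intro inj_on_subset[OF inj_on_hd_tl]) auto
  have "(\<Sum>vs\<in>A. G vs) \<le> (\<Sum>vs\<in>A. case_prod F (?h vs))" using G by (intro sum_mono) auto
  also have "\<dots> = (\<Sum>p\<in>?h ` A. case_prod F p)" using inj by (simp add: sum.reindex)
  also have "\<dots> \<le> (\<Sum>p\<in>V \<times> words n k. case_prod F p)"
  proof (rule sum_mono2)
    show "?h ` A \<subseteq> V \<times> words n k"
    proof
      fix p assume "p \<in> ?h ` A"
      then obtain vs where vs: "vs \<in> A" "p = ?h vs" by auto
      then obtain a xs where c: "vs = a # xs" using ne by (cases vs) auto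
      have "vs \<in> simple_lists n k" using vs A by blast
      then show "p \<in> V \<times> words n k" using vs c G[of vs] by (auto simp: words_def simple_lists_def)
    qed
  qed (use V F in auto)
  finally show ?thesis by (simp add: sum.cartesian_product)
qed

text \<open>With \<open>q = 0\<close> and \<open>Mx = 1\<close> a fresh step costs \<open>0\<close>
  and a shared one \<open>1\<close>, so the walk cost counts walks that stay on the given tour. Then
  \<open>Q = 1\<close>, and each of the \<open>k\<close> starting vertices contributes at most
  \<open>5\<close>.\<close>

lemma card_same_edges_le:
  assumes vs: "vs \<in> simple_lists n k" and k: "3 \<le> k" and small: "5 * real k ^ 2 * k \<le> n"
  shows "real (card {vs' \<in> simple_lists n k. set (tour vs') \<subseteq> set (tour vs)}) \<le> 5 * k"
proof -
  let ?A = "{vs' \<in> simple_lists n k. set (tour vs') \<subseteq> set (tour vs)}"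
  have d: "distinct vs" "length vs = k" using vs by (auto simp: simple_lists_def)
  have "0 < 5 * real k ^ 2 * k" using k by simp
  then have n: "0 < n" using small by (cases n) (auto simp del: of_nat_power)
  interpret S: sparse_overlap "\<lambda>v x. edge v x \<in> set (tour vs)" "set vs" n k 0 1
    using d n by (intro sparse_overlap_tour) auto
  have "real (card ?A) = (\<Sum>vs'\<in>?A. 1)" by simp
  also have "\<dots> \<le> (\<Sum>v\<in>set vs. \<Sum>ws\<in>words n k. walk_cost (\<lambda>v x. edge v x \<in> set (tour vs)) 0 1 None v ws)"
  proof (rule sum_over_closed_walks)
    fix vs' assume vs': "vs' \<in> ?A"
    then have d': "distinct vs'" "length vs' = k" by (auto simp: simple_lists_def)
    then have ne: "vs' \<noteq> []" using k by auto
    let ?ws = "tl vs' @ [hd vs']"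
    have t: "tour vs' = walk_edges (hd vs') ?ws" by (rule tour_eq_walk_edges[OF ne])
    have sub: "set (walk_edges (hd vs') ?ws) \<subseteq> set (tour vs)" using vs' t by auto
    have "fresh_cost 0 1 (- set (tour vs)) (None = (None :: nat option)) (walk_edges (hd vs') ?ws)
        = walk_cost (\<lambda>v x. edge v x \<in> set (tour vs)) 0 1 None (hd vs') ?ws"
      using no_return_tour[of vs'] d' k sub ne
      by (intro fresh_cost_eq_walk_cost[of None]) (auto intro!: subsetD[OF sub] last_in_set)
    moreover have "fresh_cost 0 1 (- set (tour vs)) b es = 1" if "set es \<subseteq> set (tour vs)" for es b
      using that by (induction es arbitrary: b) auto
    ultimately have "walk_cost (\<lambda>v x. edge v x \<in> set (tour vs)) 0 1 None (hd vs') ?ws = 1"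
      using sub by metis
    moreover have "edge (hd vs') (hd ?ws) \<in> set (tour vs)"
      using sub by (cases ?ws) auto
    ultimately show "hd vs' \<in> set vs \<and> 1 \<le> walk_cost (\<lambda>v x. edge v x \<in> set (tour vs)) 0 1 None (hd vs') ?ws"
      using S.S_V by auto
  qed (use k in \<open>auto intro!: walk_cost_nonneg\<close>)
  also have "\<dots> = (\<Sum>v\<in>set vs. S.W k None v)" by (simp add: S.W_def)
  also have "\<dots> \<le> (\<Sum>v\<in>set vs. S.Q ^ k * 5)"
    using small by (intro sum_mono S.walk_bound_any[of k]) auto
  also have "\<dots> = 5 * k" using d by (simp add: S.Q_def distinct_card)
  finally show ?thesis .
qed

text \<open>The last edge is shared and ends at the starting vertex, which therefore lies on the
  given tour: only \<open>k\<close> starts. The first edge is fresh and pays \<open>Mx * q\<close>;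
  after it the walk has \<open>k - 1\<close> steps in which to return, and the need to hit the tour
  again produces the saving factor with denominator \<open>n\<close>.\<close>

lemma sum_fresh_cost_le:
  assumes vs: "vs \<in> simple_lists n k" and k: "3 \<le> k" and small: "5 * real k ^ 2 * k * Mx \<le> n"
    and q: "0 \<le> q" and Mx: "1 \<le> Mx"
  shows "(\<Sum>vs' | vs' \<in> simple_lists n k \<and> hd (tour vs') \<notin> set (tour vs) \<and> last (tour vs') \<in> set (tour vs).
      fresh_cost q Mx (edges n - set (tour vs)) False (tour vs'))
    \<le> k * (Mx * (max 1 (n * q) ^ k * (5 * real k * k / n)))"
proof -
  let ?A = "{vs' \<in> simple_lists n k. hd (tour vs') \<notin> set (tour vs) \<and> last (tour vs') \<in> set (tour vs)}"
  let ?S = "\<lambda>v x. edge v x \<in> set (tour vs)"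
  have d: "distinct vs" "length vs = k" using vs by (auto simp: simple_lists_def)
  have n: "0 < n"
  proof (rule ccontr)
    assume "\<not> 0 < n"
    then have "5 * real k ^ 2 * k * Mx \<le> 0" using small by simp
    moreover have "0 < 5 * real k ^ 2 * k * Mx" using k Mx by simp
    ultimately show False by simp
  qed
  interpret S: sparse_overlap ?S "set vs" n k q Mx
    using d n q Mx by (intro sparse_overlap_tour) auto
  \<comment> \<open>The first step is charged as fresh whatever vertex it leads to: the tours in
    \<open>?A\<close> do start with a fresh edge, and for other words any nonnegative value will
    do.\<close>
  define F where "F v ws = Mx * q * walk_cost ?S q Mx None (hd ws) (tl ws)" for v :: nat and ws
  have F0: "0 \<le> F v ws" for v ws
    unfolding F_def using q Mx by (intro mult_nonneg_nonneg walk_cost_nonneg) auto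
  have "(\<Sum>vs'\<in>?A. fresh_cost q Mx (edges n - set (tour vs)) False (tour vs')) \<le> (\<Sum>v\<in>set vs. \<Sum>ws\<in>words n k. F v ws)"
  proof (rule sum_over_closed_walks)
    fix vs' assume vs': "vs' \<in> ?A"
    then have d': "distinct vs'" "length vs' = k" "set vs' \<subseteq> {..<n}" by (auto simp: simple_lists_def)
    then obtain a b xs where c: "vs' = a # b # xs" using k by (cases vs'; cases "tl vs'") auto
    let ?ws = "xs @ [a]"
    have t: "tour vs' = walk_edges a (b # ?ws)" using tour_eq_walk_edges[of vs'] c by simp
    have sub: "set (tour vs') \<subseteq> edges n" using d' k by (intro set_tour_subset) auto
    have h: "edge a b \<notin> set (tour vs)" "last (walk_edges b ?ws) \<in> set (tour vs)" using vs' t by auto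
    have "no_return (Some a) b ?ws" using no_return_tour[of vs'] d' k c by simp
    then have fc: "fresh_cost q Mx (edges n - set (tour vs)) True (walk_edges b ?ws)
        = walk_cost ?S q Mx None b ?ws"
      using fresh_cost_eq_walk_cost[of "Some a" b ?ws None "set (tour vs)" "edges n - set (tour vs)" q Mx] h sub t by auto
    have "edge a b \<in> edges n" using sub t by auto
    then have "fresh_cost q Mx (edges n - set (tour vs)) False (tour vs') = F a (b # ?ws)"
      using h fc unfolding t F_def by simp
    moreover have "a \<in> set vs"
    proof -
      have "last (walk_edges b ?ws) = edge (last (b # xs)) a"
      proof -
        have "last (walk_edges b ?ws) = walk_edges b ?ws ! length xs" by (subst last_conv_nth) auto
        also have "\<dots> = edge ((b # ?ws) ! length xs) a" by (subst nth_walk_edges) auto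
        also have "(b # ?ws) ! length xs = last (b # xs)"
          by (subst last_conv_nth) (auto simp: nth_append nth_Cons split: nat.split)
        finally show ?thesis .
      qed
      then show ?thesis using h S.S_V by auto
    qed
    ultimately show "hd vs' \<in> set vs \<and> fresh_cost q Mx (edges n - set (tour vs)) False (tour vs') \<le> F (hd vs') (tl vs' @ [hd vs'])"
      using c by simp
  qed (use k F0 in auto)
  also have "(\<Sum>v\<in>set vs. \<Sum>ws\<in>words n k. F v ws) = k * (Mx * (q * (\<Sum>x<n. S.W (k - 1) None x)))"
  proof -
    have "(\<Sum>ws\<in>words n (Suc (k - 1)). F v ws) = Mx * (q * (\<Sum>x<n. S.W (k - 1) None x))" for v
      unfolding sum_words_Suc F_def S.W_def by (simp add: sum_distrib_left mult_ac)
    then show ?thesis using k d by (simp add: distinct_card)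
  qed
  also have "\<dots> \<le> k * (Mx * (S.Q ^ Suc (k - 1) * (5 * real (Suc (k - 1)) * real k / real n)))"
    using S.walk_bound_fresh[OF small, of "k - 1"] Mx by (intro mult_left_mono) auto
  also have "\<dots> = k * (Mx * (max 1 (n * q) ^ k * (5 * real k * k / n)))"
    using k by (simp add: S.Q_def)
  finally show ?thesis .
qed

end

lemma emeasure_steady_ge:
  assumes "finite E" "distinct es" "set es \<subseteq> E" "0 < \<mu>" and [measurable]: "J \<in> sets borel"
    and u: "0 \<le> u" "u \<le> W" "u \<in> J" and J: "\<And>x y. x \<in> J \<Longrightarrow> y \<in> J \<Longrightarrow> \<bar>x - y\<bar> \<le> \<tau>"
  shows "ennreal (\<mu> * exp (- \<mu> * (W + 1))) ^ length es * (strip_op W ^^ length es) (indicator J) u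
    \<le> emeasure (exp_prod E) (steady_event \<mu> W \<tau> E es)"
proof -
  have "ennreal (\<mu> * exp (- \<mu> * (W + 1))) ^ length es * (strip_op W ^^ length es) (indicator J) u
    \<le> (\<integral>\<^sup>+z. strip_path \<mu> W (indicator J) es u z \<partial>exp_prod E)"
    using assms by (intro strip_path_nn_integral_ge) auto
  also have "\<dots> \<le> (\<integral>\<^sup>+z. (if steady \<mu> W \<tau> es z then 1 else 0) \<partial>exp_prod E)"
    using u J by (intro nn_integral_mono strip_path_le_steady) auto
  also have "\<dots> = emeasure (exp_prod E) (steady_event \<mu> W \<tau> E es)"
    using assms by (intro emeasure_eq_nn_integral_if[symmetric] steady_measurable_exp_prod)
  finally show ?thesis .
qed

context tour_graph
begin

lemma sum_rotate_le:
  assumes G: "\<And>vs. 0 \<le> (G vs :: real)"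
  shows "(\<Sum>vs\<in>simple_lists n k. G (rotate r vs)) \<le> (\<Sum>vs\<in>simple_lists n k. G vs)"
proof -
  have inj: "inj_on (rotate r) (simple_lists n k)"
    unfolding rotate_def by (rule inj_on_subset[OF inj_fn[OF inj_rotate1]]) auto
  have "(\<Sum>vs\<in>simple_lists n k. G (rotate r vs)) = (\<Sum>vs\<in>rotate r ` simple_lists n k. G vs)"
    using inj by (simp add: sum.reindex)
  also have "\<dots> \<le> (\<Sum>vs\<in>simple_lists n k. G vs)"
    using G rotate_simple_lists by (intro sum_mono2) auto
  finally show ?thesis .
qed

text \<open>Tours count as dependent when they share an edge. Either all edges of the second lie on
  the first, which holds for at most \<open>5 * k\<close> lists, or some rotation of the second
  starts with a fresh and ends with a shared edge. Which rotation does so varies with the tour, so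
  all \<open>k\<close> are summed; each maps the vertex lists injectively to themselves, hence the
  factor \<open>k\<close>.\<close>

lemma prob_no_steady_tour:
  fixes g :: "real \<Rightarrow> ennreal" and n k :: nat and W \<tau> \<mu> \<rho> Mx p :: real
  defines "PP \<equiv> exp_prod (edges n)"
  assumes k: "3 \<le> k" "m0 \<le> k"
    and W: "0 \<le> W" "0 \<le> \<tau>" and \<mu>: "0 < \<mu>" and \<rho>: "0 \<le> \<rho>" and Mx: "1 \<le> Mx"
    and gm: "g \<in> borel_measurable borel"
    and g: "\<And>u. 0 \<le> u \<Longrightarrow> u \<le> W + \<tau> + 1 \<Longrightarrow> 1 \<le> g u \<and> g u \<le> ennreal Mx"
    and sup: "\<And>u. 0 \<le> u \<Longrightarrow> u \<le> W + \<tau> + 1 \<Longrightarrow> strip_op (W + \<tau> + 1) g u \<le> ennreal \<rho> * g u"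
    and small: "5 * real k ^ 2 * k * Mx \<le> n"
    and p: "0 < p" "\<And>vs. vs \<in> simple_lists n k \<Longrightarrow> p \<le> measure PP {z \<in> space PP. steady \<mu> W \<tau> (tour vs) z}"
    and N: "0 < card (simple_lists n k)"
  shows "measure PP {z \<in> space PP. \<forall>vs\<in>simple_lists n k. \<not> steady \<mu> W \<tau> (tour vs) z}
    \<le> (5 * k + k * ((W + \<tau> + 2) * (k * (Mx * (max 1 (n * (\<mu> * \<rho>)) ^ k * (5 * real k * k / n))))))
       / (card (simple_lists n k) * p)"
proof -
  let ?L = "simple_lists n k" and ?q = "\<mu> * \<rho>"
  let ?A = "\<lambda>vs. {z \<in> space PP. steady \<mu> W \<tau> (tour vs) z}"
  let ?T = "k * (Mx * (max 1 (n * ?q) ^ k * (5 * real k * k / n)))"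
  define R where "R = 5 * k + k * ((W + \<tau> + 2) * ?T)"
  interpret prob_space PP unfolding PP_def by (rule prob_space_exp_prod)
  have L: "distinct vs" "length vs = k" "set vs \<subseteq> {..<n}" "set (tour vs) \<subseteq> edges n" "distinct (tour vs)"
    if "vs \<in> ?L" for vs
    using that k m0 set_tour_subset[of vs n] distinct_tour[of vs] by (auto simp: simple_lists_def)
  have Aev [measurable]: "?A vs \<in> events" if "vs \<in> ?L" for vs
    using steady_measurable_exp_prod[OF L(4)[OF that]] unfolding PP_def by measurable
  have inter: "?A vs \<inter> ?A vs' = {z \<in> space PP. steady \<mu> W \<tau> (tour vs) z \<and> steady \<mu> W \<tau> (tour vs') z}" for vs vs'
    by auto
  let ?dep = "\<lambda>vs vs'. set (tour vs) \<inter> set (tour vs') \<noteq> {}"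
  have sumA: "card ?L * p \<le> (\<Sum>vs\<in>?L. prob (?A vs))"
    using p(2) by (intro sum_bounded_below) auto
  have Np: "0 < card ?L * p" using N p by simp
  have R0: "0 \<le> R"
    unfolding R_def using W Mx by (intro add_nonneg_nonneg mult_nonneg_nonneg) auto
  have "prob (space PP - (\<Union>vs\<in>?L. ?A vs)) \<le> R / (\<Sum>vs\<in>?L. prob (?A vs))"
  proof (rule second_moment_none[where dep="?dep"])
    fix vs vs' assume vs: "vs \<in> ?L" "vs' \<in> ?L" and "\<not> ?dep vs vs'"
    then have disj: "set (tour vs) \<inter> set (tour vs') = {}" by simp
    have "emeasure PP (?A vs \<inter> ?A vs') \<le> emeasure PP (?A vs) * emeasure PP (?A vs')"
      unfolding inter unfolding PP_def by (rule steady_pair_indep[OF finite_edges L(4)[OF vs(1)] L(4)[OF vs(2)] disj])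
    then show "prob (?A vs \<inter> ?A vs') \<le> prob (?A vs) * prob (?A vs')"
      by (simp add: emeasure_eq_measure ennreal_mult[symmetric] ennreal_le_iff)
  next
    fix vs assume vs: "vs \<in> ?L"
    let ?I = "set (tour vs)" let ?J = "edges n - ?I"
    define G where "G vs' = (if hd (tour vs') \<notin> ?I \<and> last (tour vs') \<in> ?I
       then (W + \<tau> + 2) * fresh_cost ?q Mx ?J False (tour vs') else 0)" for vs'
    have G0: "0 \<le> G vs'" for vs'
      unfolding G_def using W \<mu> \<rho> Mx by (auto intro!: mult_nonneg_nonneg fresh_cost_nonneg)
    have P0: "0 \<le> prob (?A vs)" by simp
    have pair: "prob (?A vs \<inter> ?A vs') \<le> prob (?A vs) * (of_bool (set (tour vs') \<subseteq> ?I) + (\<Sum>r<k. G (rotate r vs')))"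
      if vs': "vs' \<in> ?L" and dep: "?dep vs vs'" for vs'
    proof (cases "set (tour vs') \<subseteq> ?I")
      case True
      have "prob (?A vs \<inter> ?A vs') \<le> prob (?A vs) * 1" using vs vs' by (simp add: finite_measure_mono)
      also have "\<dots> \<le> prob (?A vs) * (of_bool (set (tour vs') \<subseteq> ?I) + (\<Sum>r<k. G (rotate r vs')))"
        using True G0 by (intro mult_left_mono P0) (auto simp: sum_nonneg)
      finally show ?thesis .
    next
      case False
      obtain e1 e2 where e: "e1 \<in> set (tour vs')" "e1 \<in> ?I" "e2 \<in> set (tour vs')" "e2 \<notin> ?I"
        using dep False by blast
      obtain r where r: "r < k" "hd (rotate r (tour vs')) \<notin> ?I" "last (rotate r (tour vs')) \<in> ?I"
        using rotate_to_boundary[of "tour vs'" k e1 "\<lambda>e. e \<in> ?I" e2] e L(2)[OF vs'] by auto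
      let ?es = "rotate r (tour vs')"
      let ?B = "(W + \<tau> + 2) * fresh_cost ?q Mx ?J False ?es"
      have B0: "0 \<le> ?B" using W \<mu> \<rho> Mx by (auto intro!: mult_nonneg_nonneg fresh_cost_nonneg)
      have "emeasure PP (?A vs \<inter> ?A vs') \<le> emeasure PP (?A vs) * ennreal ?B"
        unfolding inter unfolding PP_def
      proof (rule steady_pair_le[OF finite_edges L(4)[OF vs] L(4)[OF vs']])
        fix x
        show "(\<integral>\<^sup>+y. (if steady \<mu> W \<tau> (tour vs') (override ?J x y) then 1 else 0) \<partial>exp_prod ?J) \<le> ennreal ?B"
          using W \<mu> \<rho> Mx L(5)[OF vs']
          by (intro steady_rotated_le[OF W \<mu> \<rho> _ gm g sup]) auto
      qed
      then have "prob (?A vs \<inter> ?A vs') \<le> prob (?A vs) * ?B"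
        using B0 by (simp add: emeasure_eq_measure ennreal_mult[symmetric] ennreal_le_iff)
      also have "?B = G (rotate r vs')" using r by (simp add: G_def tour_rotate)
      also have "prob (?A vs) * G (rotate r vs') \<le> prob (?A vs) * (\<Sum>r<k. G (rotate r vs'))"
        using r G0 by (intro mult_left_mono P0 member_le_sum) auto
      finally show ?thesis using False by simp
    qed
    have "(\<Sum>vs' | vs' \<in> ?L \<and> ?dep vs vs'. prob (?A vs \<inter> ?A vs'))
      \<le> (\<Sum>vs' | vs' \<in> ?L \<and> ?dep vs vs'. prob (?A vs) * (of_bool (set (tour vs') \<subseteq> ?I) + (\<Sum>r<k. G (rotate r vs'))))"
      using pair by (intro sum_mono) auto
    also have "\<dots> \<le> (\<Sum>vs'\<in>?L. prob (?A vs) * (of_bool (set (tour vs') \<subseteq> ?I) + (\<Sum>r<k. G (rotate r vs'))))"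
      using G0 by (intro sum_mono2 mult_nonneg_nonneg P0 add_nonneg_nonneg sum_nonneg) auto
    also have "\<dots> = prob (?A vs) * (real (card {vs' \<in> ?L. set (tour vs') \<subseteq> ?I}) + (\<Sum>r<k. \<Sum>vs'\<in>?L. G (rotate r vs')))"
    proof -
      have "(\<Sum>vs'\<in>?L. of_bool (set (tour vs') \<subseteq> ?I)) = real (card {vs' \<in> ?L. set (tour vs') \<subseteq> ?I})"
        by (simp add: of_bool_def sum.If_cases Int_def)
      then show ?thesis
        unfolding sum_distrib_left[symmetric] sum.distrib by (subst sum.swap) simp
    qed
    also have "\<dots> \<le> prob (?A vs) * (5 * k + (\<Sum>r<k. (W + \<tau> + 2) * ?T))"
    proof (intro mult_left_mono P0 add_mono sum_mono)
      have "5 * real k ^ 2 * k * 1 \<le> 5 * real k ^ 2 * k * Mx" using Mx by (intro mult_left_mono) auto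
      then show "real (card {vs' \<in> ?L. set (tour vs') \<subseteq> ?I}) \<le> 5 * k"
        using small by (intro card_same_edges_le vs k) linarith
      fix r
      have "(\<Sum>vs'\<in>?L. G (rotate r vs')) \<le> (\<Sum>vs'\<in>?L. G vs')" by (rule sum_rotate_le[OF G0])
      also have "\<dots> = (W + \<tau> + 2) * (\<Sum>vs' | vs' \<in> ?L \<and> hd (tour vs') \<notin> ?I \<and> last (tour vs') \<in> ?I. fresh_cost ?q Mx ?J False (tour vs'))"
        unfolding G_def sum_distrib_left by (subst sum.inter_filter) auto
      also have "\<dots> \<le> (W + \<tau> + 2) * ?T"
        using W \<mu> \<rho> by (intro mult_left_mono sum_fresh_cost_le vs k small Mx) auto
      finally show "(\<Sum>vs'\<in>?L. G (rotate r vs')) \<le> (W + \<tau> + 2) * ?T" .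
    qed
    also have "\<dots> = R * prob (?A vs)" by (simp add: R_def)
    finally show "(\<Sum>vs' | vs' \<in> ?L \<and> ?dep vs vs'. prob (?A vs \<inter> ?A vs')) \<le> R * prob (?A vs)" .
  qed (use sumA Np in auto)
  also have "\<dots> \<le> R / (card ?L * p)" using sumA Np R0 by (intro divide_left_mono) auto
  also have "space PP - (\<Union>vs\<in>?L. ?A vs) = {z \<in> space PP. \<forall>vs\<in>?L. \<not> steady \<mu> W \<tau> (tour vs) z}" by auto
  finally show ?thesis unfolding R_def .
qed

end

subsection \<open>Light cycles\<close>

lemma real_le_of_ennreal_products:
  assumes "ennreal x ^ N * ennreal f \<le> of_nat m * (ennreal a * ennreal h * ennreal c * ennreal y ^ N * ennreal g)"
    and "0 \<le> x" "0 \<le> f" "0 \<le> a" "0 \<le> h" "0 \<le> c" "0 \<le> y" "0 \<le> g"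
  shows "x ^ N * f \<le> real m * (a * h * c * y ^ N * g)"
proof -
  have "ennreal (x ^ N * f) \<le> ennreal (real m * (a * h * c * y ^ N * g))"
    using assms by (simp add: ennreal_mult ennreal_power ennreal_of_nat_eq_real_of_nat)
  then show ?thesis using assms by (subst (asm) ennreal_le_iff) auto
qed

text \<open>If every return mass were below the claimed bound, the window return bound at
  \<open>u = W / 2\<close> would make a positive quantity at most half of itself. In
  \<open>\<kappa>\<close>, the power of \<open>strip_rate t / strip_rate t2\<close> is the mismatch
  of sub- and supersolution, \<open>r ^ Suc r\<close> counts window sequences,
  \<open>(sin t2)\<^sup>2\<close> and \<open>exp (- \<tau> - 2)\<close> come from comparing the
  modes, and the \<open>2\<close> yields the contradiction.\<close>

lemma strip_return:
  fixes t t2 W \<tau> :: real and r T :: nat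
  defines "\<kappa> \<equiv> (strip_rate t / strip_rate t2) ^ (Suc r * T) * (sin t2)\<^sup>2 * exp (- \<tau> - 2) / (2 * real r ^ Suc r)"
  assumes t: "0 < t" "t < pi / 2" and t2: "0 < t2" "t2 < pi / 2"
    and W: "W = pi / t" and \<tau>: "\<tau> = W / r" and r: "0 < r"
    and fit: "t2 * (W + 2) \<le> pi"
    and cot: "1 - t\<^sup>2 \<le> t * cot t" "1 - t2\<^sup>2 \<le> t2 * cot t2"
    and small: "t\<^sup>2 * W \<le> 1" "t2\<^sup>2 * W \<le> 1"
  shows "\<exists>i s u. i < r \<and> 1 \<le> s \<and> s \<le> r \<and> u \<in> {i * \<tau>..Suc i * \<tau>} \<and>
     ennreal (\<kappa> * strip_rate t2 ^ (s * T)) \<le> (strip_op W ^^ (s * T)) (indicator {i * \<tau>..Suc i * \<tau>}) u"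
proof (rule ccontr)
  assume contra: "\<not> ?thesis"
  have tp: "t < pi" "t2 < pi" using t t2 by auto
  have W0: "0 < W" "0 \<le> W" using W t by auto
  have \<tau>0: "0 < \<tau>" "r * \<tau> = W" using \<tau> W0 r by auto
  have ch: "0 < strip_rate t" "0 < strip_rate t2" using strip_rate_pos t t2 tp by auto
  have s2: "0 < sin t2" using t2 tp by (simp add: sin_gt_zero)
  have \<kappa>0: "0 < \<kappa>" unfolding \<kappa>_def using ch s2 r by simp
  note tc = t_cot_bounds[OF t] and tc2 = t_cot_bounds[OF t2]
  \<comment> \<open>Beyond \<open>r\<close> the windows are empty, so that every \<open>J i\<close>
    lies in the strip.\<close>
  define J where "J i = (if i < r then {i * \<tau>..Suc i * \<tau>} else {})" for i :: nat
  have Jm: "J i \<in> sets borel" for i by (simp add: J_def)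
  have top: "real (Suc i) * \<tau> \<le> W" if "i < r" for i
  proof -
    have "real (Suc i) * \<tau> \<le> real r * \<tau>" using that \<tau>0 by (intro mult_right_mono) auto
    then show ?thesis using \<tau>0 by simp
  qed
  have Jsub: "J i \<subseteq> {0..W}" for i
    using top[of i] \<tau>0 by (auto simp: J_def intro: order_trans[of _ "real (Suc i) * \<tau>"] order_trans[of 0 "i * \<tau>"])
  have Jcov: "{0..W} \<subseteq> (\<Union>i<r. J i)"
  proof
    fix u assume u: "u \<in> {0..W}"
    show "u \<in> (\<Union>i<r. J i)"
    proof (cases "u = W")
      case True
      have "u \<in> J (r - 1)" using True r \<tau>0 by (auto simp: J_def mult_right_mono)
      then show ?thesis using r by auto
    next
      case False
      define i where "i = nat \<lfloor>u / \<tau>\<rfloor>"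
      have "0 \<le> u / \<tau>" using u \<tau>0 by simp
      then have i: "real i \<le> u / \<tau>" "u / \<tau> < real i + 1" unfolding i_def by linarith+
      have "u / \<tau> < r" using u False \<tau>0 by (simp add: field_simps)
      then have "i < r" using i by linarith
      moreover have "u \<in> {i * \<tau>..Suc i * \<tau>}" using i \<tau>0 by (simp add: field_simps)
      ultimately show ?thesis by (auto simp: J_def)
    qed
  qed
  let ?f = "\<lambda>v. ennreal (strip_mode t 0 v)" and ?g = "\<lambda>v. ennreal (strip_mode t2 1 v)"
  have glow: "exp (t2 * cot t2 * u) * sin t2 \<le> strip_mode t2 1 u" if u: "0 \<le> u" "u \<le> W" for u
  proof -
    have "t2 * (u + 1) \<le> t2 * (W + 1)" using t2 u by (intro mult_left_mono) auto
    then have ge: "t2 * (u + 1) \<le> pi - t2" using fit by (simp add: algebra_simps)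
    have le: "t2 \<le> t2 * (u + 1)" using t2 u by simp
    have "sin t2 \<le> sin (t2 * (u + 1))"
    proof (cases "t2 * (u + 1) \<le> pi / 2")
      case True
      then show ?thesis using le t2 by (intro sin_monotone_2pi_le) auto
    next
      case False
      have "sin t2 \<le> sin (pi - t2 * (u + 1))" using False ge t2 by (intro sin_monotone_2pi_le) auto
      then show ?thesis by simp
    qed
    then show ?thesis unfolding strip_mode_def by (intro mult_left_mono) auto
  qed
  have gup: "strip_mode t2 1 u \<le> exp (t2 * cot t2 * u)" for u
    unfolding strip_mode_def using mult_left_mono[OF sin_le_one, of "exp (t2 * cot t2 * u)"] by simp
  have fup: "strip_mode t 0 u \<le> exp (t * cot t * u)" for u
    unfolding strip_mode_def using mult_left_mono[OF sin_le_one, of "exp (t * cot t * u)"] by simp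
  have sq: "t\<^sup>2 * u \<le> 1" "t2\<^sup>2 * u \<le> 1" if "u \<le> W" for u
    using mult_left_mono[OF that, of "t\<^sup>2"] mult_left_mono[OF that, of "t2\<^sup>2"] small by auto
  \<comment> \<open>The coefficients \<open>t * cot t\<close> and \<open>t2 * cot t2\<close> lie
    between \<open>1 - t^2\<close>, respectively \<open>1 - t2^2\<close>, and \<open>1\<close>; by
    \<open>small\<close> the exponents of the two modes differ by at most \<open>1\<close> on the
    strip.\<close>
  have cle: "t * cot t * u \<le> t2 * cot t2 * u + 1" if u: "0 \<le> u" "u \<le> W" for u
  proof -
    have "t * cot t * u \<le> u" using tc u by (simp add: mult_left_le_one_le)
    moreover have "(1 - t2\<^sup>2) * u \<le> t2 * cot t2 * u" using cot u by (intro mult_right_mono) auto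
    ultimately show ?thesis using sq[OF u(2)] by (simp add: algebra_simps)
  qed
  have cle': "t2 * cot t2 * u \<le> t * cot t * u + 1" if u: "0 \<le> u" "u \<le> W" for u
  proof -
    have "t2 * cot t2 * u \<le> u" using tc2 u by (simp add: mult_left_le_one_le)
    moreover have "(1 - t\<^sup>2) * u \<le> t * cot t * u" using cot u by (intro mult_right_mono) auto
    ultimately show ?thesis using sq[OF u(2)] by (simp add: algebra_simps)
  qed
  let ?A = "exp 1 / sin t2" and ?H = "exp \<tau> / sin t2"
  have fg: "?f u \<le> ennreal ?A * ?g u" if u: "0 \<le> u" "u \<le> W" for u
  proof -
    have "strip_mode t 0 u \<le> exp (t2 * cot t2 * u + 1)"
      using fup[of u] cle[OF u] by (meson exp_le_cancel_iff order_trans)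
    also have "\<dots> = ?A * (exp (t2 * cot t2 * u) * sin t2)" using s2 by (simp add: exp_add)
    also have "\<dots> \<le> ?A * strip_mode t2 1 u" using glow[OF u] s2 by (intro mult_left_mono) auto
    finally show ?thesis using s2 by (subst ennreal_mult'[symmetric]) (auto intro: ennreal_leI)
  qed
  have H: "?g u \<le> ennreal ?H * ?g v" if uv: "i < r" "u \<in> J i" "v \<in> J i" for i u v
  proof -
    have v: "0 \<le> v" "v \<le> W" using uv Jsub[of i] by auto
    have d: "u - v \<le> \<tau>" using uv by (auto simp: J_def algebra_simps)
    have "t2 * cot t2 * (u - v) \<le> \<tau>"
    proof (cases "0 \<le> u - v")
      case True
      then show ?thesis using mult_left_le_one_le[of "u - v" "t2 * cot t2"] tc2 d by linarith
    next
      case False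
      then have "t2 * cot t2 * (u - v) \<le> 0" using tc2 by (intro mult_nonneg_nonpos) auto
      then show ?thesis using \<tau>0 by linarith
    qed
    then have e: "t2 * cot t2 * u \<le> \<tau> + t2 * cot t2 * v" by (simp add: algebra_simps)
    have "strip_mode t2 1 u \<le> exp (\<tau> + t2 * cot t2 * v)"
      using gup[of u] e by (meson exp_le_cancel_iff order_trans)
    also have "\<dots> = ?H * (exp (t2 * cot t2 * v) * sin t2)" using s2 by (simp add: exp_add)
    also have "\<dots> \<le> ?H * strip_mode t2 1 v" using glow[OF v] s2 by (intro mult_left_mono) auto
    finally show ?thesis using s2 by (subst ennreal_mult'[symmetric]) (auto intro: ennreal_leI)
  qed
  \<comment> \<open>At the midpoint the sine of the subsolution equals \<open>1\<close>, so its
    value there is the pure exponential.\<close>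
  let ?N = "Suc r * T" and ?u = "W / 2"
  have u0: "0 \<le> ?u" "?u \<le> W" using W0 by auto
  have bound: "ennreal (strip_rate t) ^ ?N * ?f ?u \<le> of_nat (r ^ Suc r) *
     (ennreal ?A * ennreal ?H * ennreal \<kappa> * ennreal (strip_rate t2) ^ ?N * ?g ?u)"
  proof (rule strip_window_return_bound[OF Jm Jsub Jcov, where f = ?f and g = ?g and ?u0.0 = ?u])
    show "ennreal (strip_rate t) * ?f u \<le> strip_op W ?f u" if "0 \<le> u" "u \<le> W" for u
      using that t tp W by (intro strip_mode_subsolution) auto
    show "strip_op W ?g u \<le> ennreal (strip_rate t2) * ?g u" if "0 \<le> u" "u \<le> W" for u
      using that t2 tp W0 fit by (intro strip_mode_supersolution) auto
    show "(strip_op W ^^ (s * T)) (indicator (J i)) u \<le> ennreal \<kappa> * ennreal (strip_rate t2) ^ (s * T)"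
      if "i < r" "1 \<le> s" "s \<le> r" "u \<in> J i" for i s u
    proof -
      have "\<not> ennreal (\<kappa> * strip_rate t2 ^ (s * T)) \<le> (strip_op W ^^ (s * T)) (indicator {i * \<tau>..Suc i * \<tau>}) u"
        using contra that by (auto simp: J_def)
      then have "(strip_op W ^^ (s * T)) (indicator (J i)) u \<le> ennreal (\<kappa> * strip_rate t2 ^ (s * T))"
        using that by (simp add: J_def)
      then show ?thesis using \<kappa>0 ch by (simp add: ennreal_mult ennreal_power)
    qed
  qed (use fg H u0 in auto)
  have fu: "strip_mode t 0 ?u = exp (t * cot t * ?u)"
    using t unfolding strip_mode_def W by simp
  have gu: "0 \<le> strip_mode t2 1 ?u"
    using glow[OF u0] s2 by (intro order_trans[OF _ glow[OF u0]]) auto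
  have "strip_rate t ^ ?N * strip_mode t 0 ?u \<le>
     real (r ^ Suc r) * (?A * ?H * \<kappa> * strip_rate t2 ^ ?N * strip_mode t2 1 ?u)"
    using bound ch s2 \<kappa>0 gu fu by (intro real_le_of_ennreal_products) auto
  then have "strip_rate t ^ ?N * strip_mode t 0 ?u \<le>
     real r ^ Suc r * (?A * ?H * \<kappa> * strip_rate t2 ^ ?N * strip_mode t2 1 ?u)"
    by simp
  also have "\<dots> \<le> real r ^ Suc r * (?A * ?H * \<kappa> * strip_rate t2 ^ ?N * (exp 1 * strip_mode t 0 ?u))"
  proof -
    have "strip_mode t2 1 ?u \<le> exp (t * cot t * ?u + 1)"
      using gup[of ?u] cle'[OF u0] by (meson exp_le_cancel_iff order_trans)
    then have "strip_mode t2 1 ?u \<le> exp 1 * strip_mode t 0 ?u" unfolding fu by (simp add: exp_add mult.commute)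
    then show ?thesis using ch s2 \<kappa>0 by (intro mult_left_mono) auto
  qed
  also have "\<dots> = strip_rate t ^ ?N * strip_mode t 0 ?u / 2"
  proof -
    have "exp 1 * exp 1 * exp \<tau> * exp (- \<tau> - 2) = (1 :: real)" by (simp flip: exp_add)
    moreover have "real r ^ Suc r * (?A * ?H * \<kappa> * strip_rate t2 ^ ?N * (exp 1 * strip_mode t 0 ?u))
       = (exp 1 * exp 1 * exp \<tau> * exp (- \<tau> - 2)) * (strip_rate t ^ ?N * strip_mode t 0 ?u / 2)"
      unfolding \<kappa>_def power_divide using s2 ch r by (simp add: field_simps power2_eq_square del: power_Suc)
    ultimately show ?thesis by simp
  qed
  finally have "strip_rate t ^ ?N * strip_mode t 0 ?u \<le> 0" by linarith
  moreover have "0 < strip_rate t ^ ?N * strip_mode t 0 ?u" unfolding fu using ch by simp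
  ultimately show False by simp
qed

context tour_graph
begin

abbreviation (input) light_free :: "nat \<Rightarrow> real \<Rightarrow> ('e \<Rightarrow> real) set" where
  "light_free n x \<equiv> {z \<in> space (exp_prod (edges n)). \<forall>c\<in>cycles n. x < mean_weight z c}"

text \<open>\<open>t\<close> fits the strip exactly and gives the subsolution, \<open>t2\<close>
  controls returns on the same strip, and \<open>t3\<close> belongs to the wider strip of the second
  moment. The tour length \<open>k = s * T\<close> is only known to lie between \<open>T\<close> and
  \<open>K\<close>; factors of at least \<open>1\<close> are taken at \<open>T\<close> in
  denominators and at \<open>K\<close> in numerators. The two summands stem from tours with all
  edges shared and from partial overlaps.\<close>

lemma light_cycle_bound:
  fixes n r T K :: nat and t t2 t3 \<mu> lam W \<tau> Mx \<kappa> :: real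
  defines "\<kappa> \<equiv> (strip_rate t / strip_rate t2) ^ (Suc r * T) * (sin t2)\<^sup>2 * exp (- \<tau> - 2) / (2 * real r ^ Suc r)"
    and "Mx \<equiv> exp (W + \<tau> + 1) / sin t3"
  assumes t: "0 < t" "t < pi / 2" and t2: "0 < t2" "t2 < pi / 2" and t3: "0 < t3" "t3 < pi / 2"
    and W: "W = pi / t" and \<tau>: "\<tau> = W / r" and r: "0 < r" and K: "K = r * T"
    and fit: "t2 * (W + 2) \<le> pi" "t3 * (W + \<tau> + 3) \<le> pi"
    and cot: "1 - t\<^sup>2 \<le> t * cot t" "1 - t2\<^sup>2 \<le> t2 * cot t2"
    and small: "t\<^sup>2 * W \<le> 1" "t2\<^sup>2 * W \<le> 1"
    and T: "3 \<le> T" "m0 \<le> T" and \<mu>: "0 < \<mu>"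
    and sparse: "5 * real K ^ 3 * Mx \<le> n"
    and fill: "real K * (K / n + \<mu> * (W + 1)) \<le> 1 / 2"
    and q2: "1 \<le> n * \<mu> * strip_rate t2" and q3: "strip_rate t2 \<le> strip_rate t3"
    and light: "\<mu> * (1 + \<tau> / T) \<le> lam"
  shows "measure (exp_prod (edges n)) (light_free n lam)
    \<le> 2 / \<kappa> * (5 * K / (n * \<mu> * strip_rate t2) ^ T +
        5 * real K ^ 4 * (W + \<tau> + 2) * Mx / n * (strip_rate t3 / strip_rate t2) ^ K)"
proof -
  let ?PP = "exp_prod (edges n)"
  interpret PP: prob_space ?PP by (rule prob_space_exp_prod)
  have tp: "t < pi" "t2 < pi" "t3 < pi" using t t2 t3 by auto
  have ch: "0 < strip_rate t" "0 < strip_rate t2" "0 < strip_rate t3"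
    using strip_rate_pos t t2 t3 tp by auto
  have s2: "0 < sin t2" "0 < sin t3" using t2 t3 tp by (auto simp: sin_gt_zero)
  have \<kappa>0: "0 < \<kappa>" unfolding \<kappa>_def using ch s2 r by simp
  have W0: "0 < W" using W t by simp
  then have \<tau>0: "0 < \<tau>" "r * \<tau> = W" using \<tau> r by auto
  have Mx: "1 \<le> Mx" "0 < Mx"
  proof -
    have "1 \<le> exp (W + \<tau> + 1)" using W0 \<tau>0 by simp
    then have "sin t3 \<le> exp (W + \<tau> + 1)" using sin_le_one[of t3] by linarith
    then show "1 \<le> Mx" unfolding Mx_def using s2 by simp
    then show "0 < Mx" by simp
  qed
  obtain i s u where i: "i < r" and s: "1 \<le> s" "s \<le> r" and u: "u \<in> {i * \<tau>..Suc i * \<tau>}"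
    and ret: "ennreal (\<kappa> * strip_rate t2 ^ (s * T)) \<le> (strip_op W ^^ (s * T)) (indicator {i * \<tau>..Suc i * \<tau>}) u"
    using strip_return[OF t t2 W \<tau> r fit(1) cot small, of T] unfolding \<kappa>_def by blast
  define k where "k = s * T"
  have kT: "T \<le> k" using s by (simp add: k_def)
  have kK: "k \<le> K" using s by (simp add: k_def K)
  have k3: "3 \<le> k" "m0 \<le> k" using kT T by auto
  have K0: "0 < real K" using kK k3 by simp
  have uW: "0 \<le> u" "u \<le> W"
  proof -
    have "real (Suc i) * \<tau> \<le> real r * \<tau>" using i \<tau>0 by (intro mult_right_mono) auto
    then show "u \<le> W" using u \<tau>0 by simp
    have "0 \<le> real i * \<tau>" using \<tau>0 by simp
    then show "0 \<le> u" using u by (meson atLeastAtMost_iff order_trans)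
  qed
  have n0: "0 < n"
  proof (rule ccontr)
    assume "\<not> 0 < n"
    then show False using q2 by simp
  qed
  have Kn: "real K / n \<le> 1 / 2"
  proof -
    have "1 * (real K / n) \<le> real K * (K / n + \<mu> * (W + 1))"
      using K0 kK k3 \<mu> W0 by (intro mult_mono) auto
    then show ?thesis using fill by linarith
  qed
  then have Kn': "2 * K \<le> n" using n0 by (simp add: field_simps) 
  have kn: "k < n" using Kn' kK k3 by linarith
  define p where "p = (\<mu> * exp (- \<mu> * (W + 1))) ^ k * (\<kappa> * strip_rate t2 ^ k)"
  have p0: "0 < p" unfolding p_def using \<mu> \<kappa>0 ch by simp
  let ?L = "simple_lists n k"
  have L: "distinct vs" "length vs = k" "set vs \<subseteq> {..<n}" "set (tour vs) \<subseteq> edges n" "distinct (tour vs)"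
    if "vs \<in> ?L" for vs
    using that k3 set_tour_subset[of vs n] distinct_tour[of vs] by (auto simp: simple_lists_def)
  have pge: "p \<le> measure ?PP {z \<in> space ?PP. steady \<mu> W \<tau> (tour vs) z}" if vs: "vs \<in> ?L" for vs
  proof -
    have "ennreal p = ennreal (\<mu> * exp (- \<mu> * (W + 1))) ^ k * ennreal (\<kappa> * strip_rate t2 ^ k)"
      unfolding p_def using \<mu> \<kappa>0 ch by (subst ennreal_mult) (auto simp: ennreal_power)
    also have "\<dots> \<le> ennreal (\<mu> * exp (- \<mu> * (W + 1))) ^ k * (strip_op W ^^ k) (indicator {i * \<tau>..Suc i * \<tau>}) u"
      using ret unfolding k_def by (intro mult_left_mono) auto
    also have "\<dots> \<le> emeasure ?PP {z \<in> space ?PP. steady \<mu> W \<tau> (tour vs) z}"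
    proof -
      have "\<bar>x - y\<bar> \<le> \<tau>" if "x \<in> {i * \<tau>..Suc i * \<tau>}" "y \<in> {i * \<tau>..Suc i * \<tau>}" for x y
        using that by (auto simp: algebra_simps)
      from emeasure_steady_ge[OF finite_edges L(5)[OF vs] L(4)[OF vs] \<mu> _ uW u this]
      show ?thesis by (simp add: L(2)[OF vs])
    qed
    finally show ?thesis by (simp add: PP.emeasure_eq_measure)
  qed
  let ?g = "\<lambda>v. ennreal (strip_mode t3 1 v / sin t3)"
  let ?q = "n * (\<mu> * strip_rate t3)" and ?q2 = "n * \<mu> * strip_rate t2"
  have q3': "1 \<le> ?q" "?q2 \<le> ?q"
  proof -
    show "?q2 \<le> ?q" using q3 \<mu> by (simp add: mult_left_mono mult.assoc)
    then show "1 \<le> ?q" using q2 by linarith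
  qed
  have card_ge: "(real n - k) ^ k \<le> card ?L"
    using card_simple_lists_ge[of k n] kn by (simp flip: of_nat_diff of_nat_power)
  then have card0: "0 < card ?L"
  proof -
    have "0 < (real n - k) ^ k" using kn by simp
    then have "0 < real (card ?L)" using card_ge by linarith
    then show ?thesis by simp
  qed
  have "measure ?PP {z \<in> space ?PP. \<forall>vs\<in>?L. \<not> steady \<mu> W \<tau> (tour vs) z}
    \<le> (5 * k + k * ((W + \<tau> + 2) * (k * (Mx * (max 1 (n * (\<mu> * strip_rate t3)) ^ k * (5 * real k * k / n))))))
       / (card ?L * p)"
  proof (rule prob_no_steady_tour[where g="?g"])
    fix v assume v: "0 \<le> v" "v \<le> W + \<tau> + 1"
    have fit3: "t3 * ((W + \<tau> + 1) + 2) \<le> pi" using fit(2) by (simp add: algebra_simps)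
    note b = strip_mode_bounds[OF t3 fit3 v]
    have "strip_mode t3 1 v \<le> exp (W + \<tau> + 1)" using b(2) v by (meson exp_le_cancel_iff order_trans)
    then have "strip_mode t3 1 v / sin t3 \<le> Mx" unfolding Mx_def using s2 by (intro divide_right_mono) auto
    moreover have "1 \<le> strip_mode t3 1 v / sin t3" using b(1) s2 by simp
    ultimately show "1 \<le> ?g v \<and> ?g v \<le> ennreal Mx" by (auto intro: ennreal_leI)
    have e: "?g = (\<lambda>v. ennreal (1 / sin t3) * ennreal (strip_mode t3 1 v))"
      using s2 by (intro ext) (simp add: ennreal_mult'[symmetric])
    have "strip_op (W + \<tau> + 1) ?g v = ennreal (1 / sin t3) * strip_op (W + \<tau> + 1) (\<lambda>v. ennreal (strip_mode t3 1 v)) v"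
      unfolding e by (rule strip_op_cmult) measurable
    also have "\<dots> \<le> ennreal (1 / sin t3) * (ennreal (strip_rate t3) * ennreal (strip_mode t3 1 v))"
      using t3 tp W0 \<tau>0 v fit3 by (intro mult_left_mono strip_mode_supersolution) auto
    also have "\<dots> = ennreal (strip_rate t3) * ?g v" using fun_cong[OF e, of v] by (simp add: mult_ac)
    finally show "strip_op (W + \<tau> + 1) ?g v \<le> ennreal (strip_rate t3) * ?g v" .
  next
    have "5 * real k ^ 2 * k * Mx \<le> 5 * real K ^ 2 * K * Mx"
      using kK Mx by (intro mult_right_mono mult_mono power_mono) auto
    then show "5 * real k ^ 2 * k * Mx \<le> n" using sparse by (simp add: power2_eq_square power3_eq_cube mult_ac)
  qed (use k3 W0 \<tau>0 \<mu> ch Mx p0 pge card0 in auto)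
  also have "\<dots> \<le> (5 * k + k * ((W + \<tau> + 2) * (k * (Mx * (?q ^ k * (5 * real k * k / n)))))) / (?q2 ^ k * \<kappa> / 2)"
  proof -
    \<comment> \<open>The loss \<open>(1 - k / n) ^ k\<close> from distinct vertices and the loss
      \<open>exp (- \<mu> * (W + 1)) ^ k\<close> from the density bound cost at most a factor
      \<open>2\<close> together, by \<open>fill\<close> and Bernoulli's inequality.\<close>
    have "1 / 2 \<le> 1 + real k * (- (k / n + \<mu> * (W + 1)))"
    proof -
      have "real k * (k / n + \<mu> * (W + 1)) \<le> real K * (K / n + \<mu> * (W + 1))"
        using kK \<mu> W0 by (intro mult_mono add_mono divide_right_mono) auto
      then show ?thesis using fill unfolding mult_minus_right by linarith
    qed
    also have "\<dots> \<le> (1 + - (k / n + \<mu> * (W + 1))) ^ k"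
    proof (rule Bernoulli_inequality)
      have "1 * (k / n + \<mu> * (W + 1)) \<le> real K * (K / n + \<mu> * (W + 1))"
        using kK k3 \<mu> W0 by (intro mult_mono add_mono divide_right_mono) auto
      then have "k / n + \<mu> * (W + 1) \<le> 1 / 2" using fill unfolding mult_1 by (rule order_trans)
      then show "- 1 \<le> - (k / n + \<mu> * (W + 1))" by (subst neg_le_iff_le) (erule order_trans, simp)
    qed
    also have "\<dots> \<le> ((1 - k / n) * exp (- \<mu> * (W + 1))) ^ k"
    proof (rule power_mono)
      have x: "0 \<le> real k / n" "real k / n \<le> 1" "0 \<le> \<mu> * (W + 1)" using kn \<mu> W0 by auto
      have "1 + - (k / n + \<mu> * (W + 1)) \<le> (1 - k / n) * (1 + (- \<mu> * (W + 1)))"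
        using mult_nonneg_nonneg[OF x(1,3)] by (simp add: algebra_simps)
      also have "\<dots> \<le> (1 - k / n) * exp (- \<mu> * (W + 1))"
        using x exp_ge_add_one_self[of "- \<mu> * (W + 1)"] by (intro mult_left_mono) auto
      finally show "1 + - (k / n + \<mu> * (W + 1)) \<le> (1 - k / n) * exp (- \<mu> * (W + 1))" .
      have "1 * (k / n + \<mu> * (W + 1)) \<le> real K * (K / n + \<mu> * (W + 1))"
        using kK k3 \<mu> W0 by (intro mult_mono add_mono divide_right_mono) auto
      then have "k / n + \<mu> * (W + 1) \<le> 1 / 2" using fill unfolding mult_1 by (rule order_trans)
      then have "k / n + \<mu> * (W + 1) \<le> 1" by (rule order_trans) simp
      then show "0 \<le> 1 + - (k / n + \<mu> * (W + 1))" by (simp only: add_uminus_conv_diff diff_ge_0_iff_ge)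
    qed
    finally have half: "1 / 2 \<le> ((1 - k / n) * exp (- \<mu> * (W + 1))) ^ k" .
    have "?q2 ^ k * \<kappa> / 2 \<le> ((1 - k / n) * exp (- \<mu> * (W + 1))) ^ k * (?q2 ^ k * \<kappa>)"
      using half \<kappa>0 \<mu> ch mult_right_mono[OF half, of "?q2 ^ k * \<kappa>"] by simp
    also have "\<dots> = (real n - k) ^ k * p"
    proof -
      have "(1 - k / n) * n = real n - k" using n0 by (simp add: field_simps)
      then have "(real n - k) ^ k = ((1 - k / n) * n) ^ k" by simp
      then show ?thesis unfolding p_def by (simp add: power_mult_distrib mult_ac)
    qed
    also have "\<dots> \<le> card ?L * p" using card_ge p0 by (intro mult_right_mono) auto
    finally have le: "?q2 ^ k * \<kappa> / 2 \<le> card ?L * p" .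
    have pos: "0 < ?q2 ^ k * \<kappa> / 2" using \<kappa>0 \<mu> ch n0 by simp
    have mx: "max 1 (n * (\<mu> * strip_rate t3)) = ?q" using q3' by simp
    show ?thesis unfolding mx
      using le pos W0 \<tau>0 Mx q3' by (intro divide_left_mono) (auto intro!: add_nonneg_nonneg mult_nonneg_nonneg mult_pos_pos p0 simp: card0)
  qed
  also have "\<dots> = 2 / \<kappa> * (5 * k / ?q2 ^ k + 5 * real k ^ 4 * (W + \<tau> + 2) * Mx / n * (?q / ?q2) ^ k)"
  proof -
    have gen: "(5 * x + x * (w * (x * (Mx * (A * (5 * x * x / y)))))) / (B * \<kappa> / 2)
      = 2 / \<kappa> * (5 * x / B + 5 * x ^ 4 * w * Mx / y * (A / B))" if "0 < B" "0 < y" for A B w x y :: real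
      using that \<kappa>0 by (simp add: field_simps power4_eq_xxxx)
    have "0 < ?q2 ^ k" "0 < real n" using q2 n0 by auto
    from gen[OF this, of "real k" "W + \<tau> + 2" "?q ^ k"] show ?thesis
      unfolding power_divide of_nat_mult of_nat_numeral .
  qed
  also have "\<dots> \<le> 2 / \<kappa> * (5 * K / ?q2 ^ T + 5 * real K ^ 4 * (W + \<tau> + 2) * Mx / n * (strip_rate t3 / strip_rate t2) ^ K)"
  proof -
    have qq: "?q / ?q2 = strip_rate t3 / strip_rate t2" using \<mu> n0 by simp
    have "5 * k / ?q2 ^ k \<le> 5 * K / ?q2 ^ T"
      using kK kT q2 by (intro frac_le power_increasing) auto
    moreover have "5 * real k ^ 4 * (W + \<tau> + 2) * Mx / n * (strip_rate t3 / strip_rate t2) ^ k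
      \<le> 5 * real K ^ 4 * (W + \<tau> + 2) * Mx / n * (strip_rate t3 / strip_rate t2) ^ K"
      using kK W0 \<tau>0 Mx q3 ch
      by (intro mult_mono divide_right_mono power_increasing power_mono) auto
    ultimately show ?thesis unfolding qq using \<kappa>0 by (intro mult_left_mono add_mono) auto
  qed
  finally have final: "measure ?PP {z \<in> space ?PP. \<forall>vs\<in>?L. \<not> steady \<mu> W \<tau> (tour vs) z} \<le> \<dots>" .
  have "measure ?PP (light_free n lam)
    \<le> measure ?PP {z \<in> space ?PP. \<forall>vs\<in>?L. \<not> steady \<mu> W \<tau> (tour vs) z}"
  proof (rule PP.finite_measure_mono)
    show "(light_free n lam) \<subseteq> {z \<in> space ?PP. \<forall>vs\<in>?L. \<not> steady \<mu> W \<tau> (tour vs) z}"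
    proof (clarify)
      fix z vs assume z: "\<forall>c\<in>cycles n. lam < mean_weight z c" and vs: "vs \<in> ?L" and st: "steady \<mu> W \<tau> (tour vs) z"
      \<comment> \<open>The closing condition turns steadiness into a mean weight of at most
        \<open>\<mu> * (1 + \<tau> / k)\<close>.\<close>
      have "excess \<mu> (tour vs) z = (\<Sum>e\<in>set (tour vs). 1 - z e / \<mu>)"
        unfolding excess_def using L(5)[OF vs] by (rule sum_list_distinct_conv_sum_set)
      also have "\<dots> = card (set (tour vs)) - (\<Sum>e\<in>set (tour vs). z e) / \<mu>"
        by (simp add: sum_subtractf sum_divide_distrib)
      also have "card (set (tour vs)) = k" using L(2,5)[OF vs] by (simp add: distinct_card)
      finally have "(\<Sum>e\<in>set (tour vs). z e) / \<mu> \<le> k + \<tau>" using st unfolding steady_def by auto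
      then have "(\<Sum>e\<in>set (tour vs). z e) \<le> \<mu> * (k + \<tau>)" using \<mu> by (simp add: field_simps)
      then have "(\<Sum>e\<in>set (tour vs). z e) / k \<le> \<mu> * (k + \<tau>) / k" by (rule divide_right_mono) simp
      also have "\<dots> = \<mu> * (1 + \<tau> / k)" using k3 by (simp add: field_simps)
      also have "\<dots> \<le> \<mu> * (1 + \<tau> / T)" using kT T \<tau>0 \<mu> by (intro mult_left_mono add_left_mono divide_left_mono) auto
      finally have "mean_weight z (closed_tour edge vs) \<le> lam"
        using light L(2,5)[OF vs] unfolding mean_weight_def set_tour[symmetric] by (simp add: distinct_card)
      moreover have "closed_tour edge vs \<in> cycles n" using vs k3 by (intro closed_tour_in_cycles) auto
      ultimately show False using z by force
    qed
    have "Measurable.pred ?PP (\<lambda>z. steady \<mu> W \<tau> (tour vs) z)" if "vs \<in> ?L" for vs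
      using steady_measurable_exp_prod[OF L(4)[OF that]] .
    then show "{z \<in> space ?PP. \<forall>vs\<in>?L. \<not> steady \<mu> W \<tau> (tour vs) z} \<in> PP.events" by measurable
  qed
  then show ?thesis using final by linarith
qed

end

subsection \<open>Asymptotics\<close>

text \<open>To second order \<open>t * cot t - 1\<close> contributes \<open>- t^2 / 3\<close> and
  \<open>ln (sin t / t)\<close> contributes \<open>- t^2 / 6\<close>. With \<open>t = pi / L\<close>
  this is the source of \<open>pi^2 / 2\<close>.\<close>

lemma ln_strip_rate_asymp:
  "((\<lambda>t. (ln (strip_rate t) - 1) / t\<^sup>2) \<longlongrightarrow> - 1 / 2) (at_right 0)"
proof -
  have "((\<lambda>t::real. (t * (cos t / sin t) + ln (sin t / t) - 1) / t\<^sup>2) \<longlongrightarrow> - 1 / 2) (at_right 0)"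
    by real_asymp
  moreover have "eventually (\<lambda>t. t \<in> {0<..<pi / 2}) (at_right (0::real))"
    by (rule eventually_at_right_real) simp
  then have "eventually (\<lambda>t. (t * (cos t / sin t) + ln (sin t / t) - 1) / t\<^sup>2 = (ln (strip_rate t) - 1) / t\<^sup>2) (at_right 0)"
  proof eventually_elim
    case (elim t)
    then have "0 < sin t" "0 < t" by (auto simp: sin_gt_zero)
    then have "ln (strip_rate t) = t * cot t + ln (sin t / t)"
      unfolding strip_rate_def times_divide_eq_right[symmetric] by (subst ln_mult_pos) auto
    then show ?case by (simp add: cot_def)
  qed
  ultimately show ?thesis by (rule Lim_transform_eventually)
qed

lemma t_cot_ge_asymp: "eventually (\<lambda>t::real. 1 - t\<^sup>2 \<le> t * cot t) (at_right 0)"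
  unfolding cot_def by real_asymp

lemma filterlim_divide_at_right:
  fixes a :: real
  assumes "0 < a"
  shows "filterlim (\<lambda>L. a / L) (at_right 0) at_top"
  unfolding filterlim_at
proof
  show "eventually (\<lambda>L. a / L \<in> {0<..} \<and> a / L \<noteq> 0) at_top"
    using eventually_gt_at_top[of 0] by eventually_elim (use assms in auto)
  show "((\<lambda>L. a / L) \<longlongrightarrow> 0) at_top"
    by (rule real_tendsto_divide_at_top[OF tendsto_const filterlim_ident])
qed

lemma ln_strip_rate_scaled:
  assumes a: "0 < a"
  shows "((\<lambda>L. L\<^sup>2 * (ln (strip_rate (a / L)) - 1)) \<longlongrightarrow> - a\<^sup>2 / 2) at_top"
proof -
  have "((\<lambda>L. a\<^sup>2 * ((ln (strip_rate (a / L)) - 1) / (a / L)\<^sup>2)) \<longlongrightarrow> a\<^sup>2 * (- 1 / 2)) at_top"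
    by (intro tendsto_mult tendsto_const filterlim_compose[OF ln_strip_rate_asymp filterlim_divide_at_right[OF a]])
  moreover have "eventually (\<lambda>L. a\<^sup>2 * ((ln (strip_rate (a / L)) - 1) / (a / L)\<^sup>2) = L\<^sup>2 * (ln (strip_rate (a / L)) - 1)) at_top"
    using eventually_gt_at_top[of 0] by eventually_elim (use a in \<open>simp add: power_divide\<close>)
  ultimately have "((\<lambda>L. L\<^sup>2 * (ln (strip_rate (a / L)) - 1)) \<longlongrightarrow> a\<^sup>2 * (- 1 / 2)) at_top"
    by (rule Lim_transform_eventually)
  then show ?thesis by simp
qed

text \<open>
  \<open>E1\<close> and \<open>E2\<close> bound the exponents of \<open>n\<close> in the two terms of the bound for the failure probability
  (no reuse of edges, and returns to a given cycle).
\<close>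

locale asymp_constants =
  fixes a a2 a3 \<beta> b :: real and s :: nat
  assumes a: "pi < a" and a3: "0 < a3" and a32: "a3 < a2" and a2: "a2 < a" and s: "1 \<le> s"
    and b: "\<beta> + 1 / s < b" and fit: "a3 * (pi / a * (1 + 1 / s\<^sup>2)) < pi"
    and E1: "- (\<beta> - a2\<^sup>2 / 2) / s + (s + 1 / s) * ((a\<^sup>2 - a2\<^sup>2) / 2) + pi / (a * s\<^sup>2) < 0"
    and E2: "pi / a * (1 + 2 / s\<^sup>2) - 1 + s * ((a2\<^sup>2 - a3\<^sup>2) / 2) + (s + 1 / s) * ((a\<^sup>2 - a2\<^sup>2) / 2) < 0"
    and \<beta>2: "0 < \<beta> - a2\<^sup>2 / 2" and \<beta>: "0 < \<beta>"

text \<open>After \<open>a\<close> and \<open>\<beta>\<close> with \<open>pi < a\<close> and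
  \<open>a^2 / 2 < \<beta> < b\<close>, a large \<open>s\<close> decides everything:
  \<open>s\<close> times the left side of \<open>E1\<close> tends to
  \<open>a^2 / 2 - \<beta>\<close>, and the left side of \<open>E2\<close> tends to
  \<open>pi / a - 1\<close>.\<close>

lemma choose_constants:
  fixes b :: real
  assumes b: "pi\<^sup>2 / 2 < b"
  obtains a a2 a3 \<beta> :: real and s :: nat where "asymp_constants a a2 a3 \<beta> b s"
proof -
  have "eventually (\<lambda>a. pi < a \<and> a\<^sup>2 / 2 < b) (at_right pi)"
  proof (intro eventually_conj)
    show "eventually (\<lambda>a. pi < a) (at_right pi)" by (simp add: eventually_at_filter)
    have "((\<lambda>a. a\<^sup>2 / 2) \<longlongrightarrow> pi\<^sup>2 / 2) (at_right pi)" by (intro tendsto_intros) simp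
    from order_tendstoD(2)[OF this b] show "eventually (\<lambda>a. a\<^sup>2 / 2 < b) (at_right pi)" .
  qed
  then obtain a where a: "pi < a" "a\<^sup>2 / 2 < b"
    using eventually_happens'[OF trivial_limit_at_right_real] by blast
  have a0: "0 < a" using a pi_gt_zero by linarith
  obtain \<beta> where \<beta>: "a\<^sup>2 / 2 < \<beta>" "\<beta> < b" using dense[OF a(2)] by blast
  \<comment> \<open>\<open>A2\<close> is so close to \<open>a\<close> that even
    \<open>s^2 * (a^2 - A2^2)\<close> vanishes in the limit. For \<open>A3\<close> it is enough that
    \<open>s * (A2^2 - A3^2)\<close> vanishes; its denominator \<open>1 + 2 / s^2\<close> leaves
    room for the factor \<open>1 + 1 / s^2\<close> of the wider strip in \<open>fit\<close>.\<close>
  define A2 where "A2 s = a * (1 - 1 / s ^ 4)" for s :: real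
  define A3 where "A3 s = a / (1 + 2 / s\<^sup>2)" for s :: real
  have "((\<lambda>s. s * (- (\<beta> - (A2 s)\<^sup>2 / 2) / s + (s + 1 / s) * ((a\<^sup>2 - (A2 s)\<^sup>2) / 2) + pi / (a * s\<^sup>2))) \<longlongrightarrow> a\<^sup>2 / 2 - \<beta>) at_top"
    using a0 unfolding A2_def by real_asymp
  from order_tendstoD(2)[OF this, of 0] have e1: "eventually (\<lambda>s. s * (- (\<beta> - (A2 s)\<^sup>2 / 2) / s + (s + 1 / s) * ((a\<^sup>2 - (A2 s)\<^sup>2) / 2) + pi / (a * s\<^sup>2)) < 0) at_top"
    using \<beta> by simp
  have "((\<lambda>s. pi / a * (1 + 2 / s\<^sup>2) - 1 + s * (((A2 s)\<^sup>2 - (A3 s)\<^sup>2) / 2) + (s + 1 / s) * ((a\<^sup>2 - (A2 s)\<^sup>2) / 2)) \<longlongrightarrow> pi / a - 1) at_top"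
    using a0 unfolding A2_def A3_def by real_asymp
  from order_tendstoD(2)[OF this, of 0] have e2: "eventually (\<lambda>s. pi / a * (1 + 2 / s\<^sup>2) - 1 + s * (((A2 s)\<^sup>2 - (A3 s)\<^sup>2) / 2) + (s + 1 / s) * ((a\<^sup>2 - (A2 s)\<^sup>2) / 2) < 0) at_top"
    using a a0 by simp
  have "((\<lambda>s. \<beta> + 1 / s) \<longlongrightarrow> \<beta>) at_top" by real_asymp
  from order_tendstoD(2)[OF this \<beta>(2)] have e3: "eventually (\<lambda>s. \<beta> + 1 / s < b) at_top" .
  have "eventually (\<lambda>s. s * (- (\<beta> - (A2 s)\<^sup>2 / 2) / s + (s + 1 / s) * ((a\<^sup>2 - (A2 s)\<^sup>2) / 2) + pi / (a * s\<^sup>2)) < 0 \<and>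
    pi / a * (1 + 2 / s\<^sup>2) - 1 + s * (((A2 s)\<^sup>2 - (A3 s)\<^sup>2) / 2) + (s + 1 / s) * ((a\<^sup>2 - (A2 s)\<^sup>2) / 2) < 0 \<and>
    \<beta> + 1 / s < b \<and> 2 \<le> s) at_top"
    by (intro eventually_conj e1 e2 e3 eventually_ge_at_top)
  then have "eventually (\<lambda>i. real i * (- (\<beta> - (A2 (real i))\<^sup>2 / 2) / real i + (real i + 1 / real i) * ((a\<^sup>2 - (A2 (real i))\<^sup>2) / 2) + pi / (a * (real i)\<^sup>2)) < 0 \<and>
    pi / a * (1 + 2 / (real i)\<^sup>2) - 1 + real i * (((A2 (real i))\<^sup>2 - (A3 (real i))\<^sup>2) / 2) + (real i + 1 / real i) * ((a\<^sup>2 - (A2 (real i))\<^sup>2) / 2) < 0 \<and>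
    \<beta> + 1 / real i < b \<and> 2 \<le> real i) sequentially"
    by (rule eventually_compose_filterlim[OF _ filterlim_real_sequentially])
  then obtain s :: nat where s: "real s * (- (\<beta> - (A2 s)\<^sup>2 / 2) / s + (s + 1 / s) * ((a\<^sup>2 - (A2 s)\<^sup>2) / 2) + pi / (a * s\<^sup>2)) < 0"
    "pi / a * (1 + 2 / s\<^sup>2) - 1 + s * (((A2 s)\<^sup>2 - (A3 s)\<^sup>2) / 2) + (s + 1 / s) * ((a\<^sup>2 - (A2 s)\<^sup>2) / 2) < 0"
    "\<beta> + 1 / s < b" "2 \<le> real s"
    using eventually_happens'[OF sequentially_bot] by (auto simp: )
  have s4: "4 \<le> (real s)\<^sup>2" using power_mono[OF s(4), of 2] by simp
  define x where "x = (real s)\<^sup>2"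
  have x: "4 \<le> x" "real s ^ 4 = x\<^sup>2" using s4 by (auto simp: x_def simp flip: power_mult)
  have x1: "1 / x\<^sup>2 < 1" using x by (simp add: field_simps)
  have A2: "A2 s = a * (1 - 1 / x\<^sup>2)" and A3: "A3 s = a / (1 + 2 / x)"
    unfolding A2_def A3_def x(2) by (auto simp: x_def)
  show thesis
  proof (rule that, unfold_locales)
    show "pi < a" by (rule a)
    show "0 < A3 s" unfolding A3 using a0 x by (intro divide_pos_pos add_pos_nonneg) auto
    show "A2 s < a" unfolding A2 using a0 x by simp
    show "A3 s < A2 s"
    proof -
      have "1 < (1 - 1 / x\<^sup>2) * (1 + 2 / x)"
      proof -
        have "4 * x \<le> x * x" using x by (intro mult_right_mono) auto
        then have "x + 2 < 2 * x\<^sup>2" using x(1) unfolding power2_eq_square by linarith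
        then have "0 < (2 * x\<^sup>2 - x - 2) / x ^ 3" using x by simp
        also have "\<dots> = (1 - 1 / x\<^sup>2) * (1 + 2 / x) - 1" using x by (simp add: field_simps power2_eq_square power3_eq_cube)
        finally show ?thesis by simp
      qed
      then have "a * 1 < a * ((1 - 1 / x\<^sup>2) * (1 + 2 / x))" using a0 by (intro mult_strict_left_mono)
      then show ?thesis unfolding A2 A3 using x by (subst pos_divide_less_eq) (auto simp: mult_ac add_pos_nonneg)
    qed
    show "1 \<le> s" using s(4) by simp
    show "\<beta> + 1 / s < b" by (rule s(3))
    show "A3 s * (pi / a * (1 + 1 / s\<^sup>2)) < pi"
    proof -
      have "A3 s * (pi / a * (1 + 1 / s\<^sup>2)) = pi * ((1 + 1 / x) / (1 + 2 / x))" unfolding A3 using a0 by (simp add: x_def)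
      also have "\<dots> < pi * 1"
      proof (rule mult_strict_left_mono)
        have "0 < 1 + 2 / x" "1 + 1 / x < 1 + 2 / x" using x(1) by (auto simp: add_pos_pos divide_strict_right_mono)
        then show "(1 + 1 / x) / (1 + 2 / x) < 1" by simp
      qed simp
      finally show ?thesis by simp
    qed
    show "- (\<beta> - (A2 s)\<^sup>2 / 2) / s + (s + 1 / s) * ((a\<^sup>2 - (A2 s)\<^sup>2) / 2) + pi / (a * s\<^sup>2) < 0"
      using s(1,4) by (auto simp: mult_less_0_iff)
    show "pi / a * (1 + 2 / s\<^sup>2) - 1 + s * (((A2 s)\<^sup>2 - (A3 s)\<^sup>2) / 2) + (s + 1 / s) * ((a\<^sup>2 - (A2 s)\<^sup>2) / 2) < 0"
      by (rule s(2))
    have "0 \<le> A2 s" "A2 s \<le> a" unfolding A2 using a0 x1 by (auto simp: mult_left_le)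
    then have "(A2 s)\<^sup>2 \<le> a\<^sup>2" by (intro power_mono) auto
    then show "0 < \<beta> - (A2 s)\<^sup>2 / 2" using \<beta> by simp
    show "0 < \<beta>" using \<beta>(1) by (smt (verit) zero_le_power2 divide_nonneg_nonneg)
  qed
qed

lemma tendsto_poly_times_exp:
  fixes P e :: "real \<Rightarrow> real"
  assumes P: "eventually (\<lambda>L. 0 \<le> P L) at_top"
    and Pe: "\<And>c. 0 < c \<Longrightarrow> ((\<lambda>L. P L * exp (- c * L)) \<longlongrightarrow> 0) at_top"
    and e: "(e \<longlongrightarrow> E) at_top" and E: "E < 0"
  shows "((\<lambda>L. P L * exp (L * e L)) \<longlongrightarrow> 0) at_top"
proof (rule tendsto_sandwich[OF _ _ tendsto_const Pe[of "- E / 2"]])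
  have "eventually (\<lambda>L. e L < E / 2) at_top" using order_tendstoD(2)[OF e, of "E / 2"] E by simp
  then show "eventually (\<lambda>L. P L * exp (L * e L) \<le> P L * exp (- (- E / 2) * L)) at_top"
    using P eventually_gt_at_top[of 0]
  proof eventually_elim
    case (elim L)
    then have "L * e L \<le> L * (E / 2)" by (intro mult_left_mono) auto
    then show ?case using elim by (intro mult_left_mono) (auto simp: mult.commute)
  qed
  show "eventually (\<lambda>L. 0 \<le> P L * exp (L * e L)) at_top" using P by eventually_elim auto
qed (use E in auto)

section \<open>The parameters as functions of \<open>L = ln n\<close>\<close>

context asymp_constants
begin

definition r where "r = s\<^sup>2"
text \<open>Gains and losses per edge are of relative order \<open>1 / L^2\<close>; over about
  \<open>L^3\<close> edges they accumulate to a power of \<open>n\<close>. Over \<open>T\<close>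
  edges the gain has an exponent of order \<open>L / s\<close>, which must beat the window width
  \<open>\<tau>\<close> of order \<open>L / s^2\<close>; \<open>r = s^2\<close> windows are fine
  enough for this.\<close>

definition T where "T L = nat \<lceil>L ^ 3 / s\<rceil>" for L :: real
definition K where "K L = r * T L" for L :: real
definition W where "W L = pi * L / a" for L :: real
definition \<tau> where "\<tau> L = W L / r" for L :: real
definition \<mu> where "\<mu> L = (1 + \<beta> / L\<^sup>2) / (exp 1 * exp L)" for L :: real
definition q2 where "q2 L = (1 + \<beta> / L\<^sup>2) * strip_rate (a2 / L) / exp 1" for L :: real
text \<open>A smooth upper bound for \<open>K\<close>, free of the rounding in \<open>T\<close>, to
  which asymptotic expansion applies.\<close>

definition KB where "KB L = real r * (L ^ 3 / s + 1)" for L :: real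

lemma a0: "0 < a" "0 < a2" "0 < real s" "0 < real r" "real r = (real s)\<^sup>2"
proof -
  show "0 < a" using a pi_gt_zero by linarith
qed (use a3 a32 s in \<open>auto simp: r_def\<close>)

lemma T_bounds: "0 \<le> L \<Longrightarrow> L ^ 3 / s \<le> T L" "0 \<le> L \<Longrightarrow> T L \<le> L ^ 3 / s + 1"
proof -
  assume "0 \<le> L"
  then have "0 \<le> L ^ 3 / s" by simp
  then show "L ^ 3 / s \<le> T L" "T L \<le> L ^ 3 / s + 1" unfolding T_def by linarith+
qed

lemma K_le: "0 \<le> L \<Longrightarrow> K L \<le> KB L"
  unfolding K_def KB_def using T_bounds(2)[of L] by (simp add: mult_left_mono)

lemma T_asymp: "((\<lambda>L. T L / L ^ 3) \<longlongrightarrow> 1 / s) at_top"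
proof (rule tendsto_sandwich)
  show "eventually (\<lambda>L. 1 / s \<le> T L / L ^ 3) at_top"
    using eventually_gt_at_top[of 0]
  proof eventually_elim
    case (elim L)
    then show ?case using T_bounds(1)[of L] a0 by (simp add: field_simps)
  qed
  show "eventually (\<lambda>L. T L / L ^ 3 \<le> 1 / s + 1 / L ^ 3) at_top"
    using eventually_gt_at_top[of 0]
  proof eventually_elim
    case (elim L)
    then have "T L / L ^ 3 \<le> (L ^ 3 / s + 1) / L ^ 3" using T_bounds(2)[of L] by (intro divide_right_mono) auto
    also have "\<dots> = 1 / s + 1 / L ^ 3" using elim by (simp add: field_simps)
    finally show ?case .
  qed
  show "((\<lambda>L. 1 / s + 1 / L ^ 3) \<longlongrightarrow> 1 / real s) at_top" by real_asymp
qed auto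

lemma T_at_top: "filterlim (\<lambda>L. real (T L)) at_top at_top"
proof (rule filterlim_at_top_mono)
  show "filterlim (\<lambda>L. L ^ 3 / s) at_top at_top" using a0 by real_asymp
  show "eventually (\<lambda>L. L ^ 3 / s \<le> T L) at_top"
    using eventually_ge_at_top[of 0] by eventually_elim (rule T_bounds)
qed

lemma eventually_angle:
  fixes x :: real
  shows "0 < x \<Longrightarrow> eventually (\<lambda>L. 0 < x / L \<and> x / L < pi / 2 \<and> x / L < pi) at_top"
proof -
  assume x: "0 < x"
  have "((\<lambda>L. x / L) \<longlongrightarrow> 0) at_top" by real_asymp
  from order_tendstoD(2)[OF this, of "pi / 2"] have "eventually (\<lambda>L. x / L < pi / 2) at_top" by simp
  then show ?thesis using eventually_gt_at_top[of 0]
  proof eventually_elim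
    case (elim L)
    moreover have "x / L < pi" using elim pi_gt_zero by linarith
    ultimately show ?case using x by auto
  qed
qed

lemma eventually_cot:
  fixes x :: real
  shows "0 < x \<Longrightarrow> eventually (\<lambda>L. 1 - (x / L)\<^sup>2 \<le> x / L * cot (x / L)) at_top"
  using eventually_compose_filterlim[OF t_cot_ge_asymp filterlim_divide_at_right[of x]] by simp

lemma eventually_fit:
  "eventually (\<lambda>L. a2 / L * (W L + 2) \<le> pi \<and> a3 / L * (W L + \<tau> L + 3) \<le> pi) at_top"
proof -
  have "((\<lambda>L. a2 / L * (W L + 2)) \<longlongrightarrow> a2 * (pi * inverse a)) at_top"
    unfolding W_def using a0 by real_asymp
  moreover have "a2 * (pi * inverse a) < pi" using a2 a0 by (simp add: field_simps)
  ultimately have 1: "eventually (\<lambda>L. a2 / L * (W L + 2) < pi) at_top" by (rule order_tendstoD)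
  have "((\<lambda>L. a3 / L * (W L + \<tau> L + 3)) \<longlongrightarrow> a3 * (pi / a * (1 + 1 / s\<^sup>2))) at_top"
  proof -
    have "((\<lambda>L. a3 * (pi / a * (1 + 1 / s\<^sup>2)) + 3 * a3 / L) \<longlongrightarrow> a3 * (pi / a * (1 + 1 / s\<^sup>2))) at_top" by real_asymp
    moreover have "eventually (\<lambda>L. a3 * (pi / a * (1 + 1 / s\<^sup>2)) + 3 * a3 / L = a3 / L * (W L + \<tau> L + 3)) at_top"
      using eventually_gt_at_top[of 0]
      by eventually_elim (use a0 in \<open>simp add: W_def \<tau>_def field_simps\<close>)
    ultimately show ?thesis by (rule Lim_transform_eventually)
  qed
  from order_tendstoD(2)[OF this fit] have 2: "eventually (\<lambda>L. a3 / L * (W L + \<tau> L + 3) < pi) at_top" .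
  from 1 2 show ?thesis by eventually_elim auto
qed

lemma eventually_square_small:
  fixes x :: real
  shows "0 < x \<Longrightarrow> eventually (\<lambda>L. (x / L)\<^sup>2 * W L \<le> 1) at_top"
proof -
  assume "0 < x"
  then have "((\<lambda>L. (x / L)\<^sup>2 * W L) \<longlongrightarrow> 0) at_top" unfolding W_def using a0 by real_asymp
  from order_tendstoD(2)[OF this, of 1] show ?thesis by (auto elim: eventually_mono)
qed

lemma poly_factor1:
  "0 < c \<Longrightarrow> ((\<lambda>L. KB L / (sin (a2 / L))\<^sup>2 * exp (- c * L)) \<longlongrightarrow> 0) at_top"
  unfolding KB_def using a0 by real_asymp

lemma poly_factor2:
  "0 < c \<Longrightarrow> ((\<lambda>L. KB L ^ 4 * (W L + \<tau> L + 2) / (sin (a2 / L) ^ 2 * sin (a3 / L)) * exp (- c * L)) \<longlongrightarrow> 0) at_top"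
  unfolding KB_def W_def \<tau>_def using a0 a3 by real_asymp

lemma poly_factor3:
  "0 < c \<Longrightarrow> ((\<lambda>L. KB L ^ 3 / sin (a3 / L) * exp (- c * L)) \<longlongrightarrow> 0) at_top"
  unfolding KB_def using a0 a3 by real_asymp

lemma fill_asymp:
  "eventually (\<lambda>L. real (K L) * (K L / exp L + \<mu> L * (W L + 1)) \<le> 1 / 2) at_top"
proof -
  have "((\<lambda>L. KB L * (KB L / exp L + \<mu> L * (W L + 1))) \<longlongrightarrow> 0) at_top"
    unfolding KB_def W_def \<mu>_def using a0 \<beta> by real_asymp
  from order_tendstoD(2)[OF this, of "1 / 2"]
  have "eventually (\<lambda>L. KB L * (KB L / exp L + \<mu> L * (W L + 1)) < 1 / 2) at_top" by simp
  then show ?thesis using eventually_gt_at_top[of 0]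
  proof eventually_elim
    case (elim L)
    have "real (K L) * (K L / exp L + \<mu> L * (W L + 1)) \<le> KB L * (KB L / exp L + \<mu> L * (W L + 1))"
      using K_le[of L] elim a0 \<beta> order_trans[OF _ K_le[of L]]
      by (intro mult_mono add_mono divide_right_mono add_nonneg_nonneg) (auto simp: \<mu>_def W_def)
    then show ?case using elim by linarith
  qed
qed

lemma ln_q2_asymp: "((\<lambda>L. L\<^sup>2 * ln (q2 L)) \<longlongrightarrow> \<beta> - a2\<^sup>2 / 2) at_top"
proof -
  have "((\<lambda>L. L\<^sup>2 * ln (1 + \<beta> / L\<^sup>2) + L\<^sup>2 * (ln (strip_rate (a2 / L)) - 1)) \<longlongrightarrow> \<beta> + - a2\<^sup>2 / 2) at_top"
  proof (rule tendsto_add[OF _ ln_strip_rate_scaled[OF a0(2)]])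
    show "((\<lambda>L. L\<^sup>2 * ln (1 + \<beta> / L\<^sup>2)) \<longlongrightarrow> \<beta>) at_top" using \<beta> by real_asymp
  qed
  moreover have "eventually (\<lambda>L. L\<^sup>2 * ln (1 + \<beta> / L\<^sup>2) + L\<^sup>2 * (ln (strip_rate (a2 / L)) - 1) = L\<^sup>2 * ln (q2 L)) at_top"
    using eventually_angle[OF a0(2)] eventually_gt_at_top[of 0]
  proof eventually_elim
    case (elim L)
    then have "0 < strip_rate (a2 / L)" "0 < 1 + \<beta> / L\<^sup>2" using \<beta> by (auto intro!: strip_rate_pos add_pos_nonneg)
    then have q2: "ln (q2 L) = ln (1 + \<beta> / L\<^sup>2) + ln (strip_rate (a2 / L)) - 1"
      unfolding q2_def by (simp add: ln_div ln_mult_pos)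
    show ?case unfolding q2 by (simp add: algebra_simps)
  qed
  ultimately show ?thesis by (auto dest: Lim_transform_eventually)
qed

lemma q2_ge_1: "eventually (\<lambda>L. 1 \<le> q2 L) at_top"
  using order_tendstoD(1)[OF ln_q2_asymp \<beta>2] eventually_angle[OF a0(2)] eventually_gt_at_top[of 0]
proof eventually_elim
  case (elim L)
  have "0 < strip_rate (a2 / L)" using elim by (auto intro!: strip_rate_pos)
  then have "0 < q2 L" unfolding q2_def using elim \<beta> by (auto intro!: divide_pos_pos mult_pos_pos add_pos_nonneg)
  moreover have "0 < ln (q2 L)" using elim by (simp add: zero_less_mult_iff)
  ultimately show ?case by simp
qed

lemma ln_rate_diff_asymp:
  assumes "0 < x" "0 < y"
  shows "((\<lambda>L. L\<^sup>2 * (ln (strip_rate (x / L)) - ln (strip_rate (y / L)))) \<longlongrightarrow> (y\<^sup>2 - x\<^sup>2) / 2) at_top"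
  using tendsto_diff[OF ln_strip_rate_scaled[OF assms(1)] ln_strip_rate_scaled[OF assms(2)]]
  by (simp add: right_diff_distrib[symmetric] diff_divide_distrib)

lemma rate_mono: "eventually (\<lambda>L. strip_rate (a2 / L) \<le> strip_rate (a3 / L)) at_top"
proof -
  have "a3\<^sup>2 < a2\<^sup>2" using a3 a32 by (intro power_strict_mono) auto
  then have "0 < (a2\<^sup>2 - a3\<^sup>2) / 2" by simp
  from order_tendstoD(1)[OF ln_rate_diff_asymp[OF a3 a0(2)] this]
  show ?thesis using eventually_angle[OF a0(2)] eventually_angle[OF a3]
  proof eventually_elim
    case (elim L)
    have "0 < strip_rate (a2 / L)" "0 < strip_rate (a3 / L)" using elim by (auto intro!: strip_rate_pos)
    moreover have "ln (strip_rate (a2 / L)) < ln (strip_rate (a3 / L))" using elim by (simp add: zero_less_mult_iff)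
    ultimately show ?case by simp
  qed
qed

text \<open>The closing error \<open>\<tau> / T\<close> is at most \<open>1 / (s * L^2)\<close>, and
  the gap in \<open>\<beta> + 1 / s < b\<close> absorbs the cross term.\<close>

lemma light_asymp: "eventually (\<lambda>L. \<mu> L * (1 + \<tau> L / T L) \<le> (1 + b / L\<^sup>2) / (exp 1 * exp L)) at_top"
proof -
  have "((\<lambda>L :: real. \<beta> + 1 / s + \<beta> / (s * L\<^sup>2)) \<longlongrightarrow> \<beta> + 1 / s) at_top"
    using a0 \<beta> by real_asymp
  from order_tendstoD(2)[OF this b] show ?thesis using eventually_gt_at_top[of 0]
  proof eventually_elim
    case (elim L)
    have T: "L ^ 3 / s \<le> T L" using elim T_bounds by simp
    have T0: "0 < L ^ 3 / s" using elim a0 by simp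
    have "\<tau> L / T L \<le> \<tau> L / (L ^ 3 / s)"
      using T T0 elim a0 order_less_le_trans[OF T0 T]
      by (intro divide_left_mono mult_pos_pos) (auto simp: \<tau>_def W_def)
    also have "\<dots> = pi / a / (s * L\<^sup>2)"
      using elim a0 by (simp add: \<tau>_def W_def field_simps power2_eq_square power3_eq_cube)
    also have "\<dots> \<le> 1 / (s * L\<^sup>2)" using elim a a0 by (intro divide_right_mono) auto
    finally have "(1 + \<beta> / L\<^sup>2) * (1 + \<tau> L / T L) \<le> (1 + \<beta> / L\<^sup>2) * (1 + 1 / (s * L\<^sup>2))"
      using \<beta> by (intro mult_left_mono add_left_mono) auto
    also have "\<dots> = 1 + (\<beta> + 1 / s + \<beta> / (s * L\<^sup>2)) / L\<^sup>2" using elim a0 by (simp add: field_simps)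
    also have "\<dots> \<le> 1 + b / L\<^sup>2" using elim by (intro add_left_mono divide_right_mono) auto
    finally show ?case unfolding \<mu>_def by (simp add: divide_right_mono)
  qed
qed

text \<open>The exponent \<open>W + \<tau>\<close> equals \<open>(1 - d) * L\<close> with
  \<open>d > 0\<close> by \<open>E2\<close>, so a width below \<open>L\<close> leaves
  \<open>exp (d * L)\<close> against factors of polynomial growth.\<close>

lemma sparse_asymp:
  "eventually (\<lambda>L. 5 * real (K L) ^ 3 * (exp (W L + \<tau> L + 1) / sin (a3 / L)) \<le> exp L) at_top"
proof -
  define d where "d = 1 - pi / a * (1 + 1 / s\<^sup>2)"
  have d: "0 < d"
  proof -
    have "(a\<^sup>2 - a2\<^sup>2) / 2 \<ge> 0" "(a2\<^sup>2 - a3\<^sup>2) / 2 \<ge> 0"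
      using a2 a32 a3 power_mono[of a2 a 2] power_mono[of a3 a2 2] by auto
    then have "0 \<le> s * ((a2\<^sup>2 - a3\<^sup>2) / 2)" "0 \<le> (s + 1 / s) * ((a\<^sup>2 - a2\<^sup>2) / 2)"
      by (auto intro!: mult_nonneg_nonneg)
    then have "pi / a * (1 + 2 / s\<^sup>2) < 1" using E2 by linarith
    moreover have "pi / a * (1 + 1 / s\<^sup>2) \<le> pi / a * (1 + 2 / s\<^sup>2)"
      using a0 by (intro mult_left_mono add_left_mono divide_right_mono) auto
    ultimately show ?thesis unfolding d_def by linarith
  qed
  have "((\<lambda>L. 5 * exp 1 * (KB L ^ 3 / sin (a3 / L) * exp (- d * L))) \<longlongrightarrow> 5 * exp 1 * 0) at_top"
    by (intro tendsto_mult tendsto_const poly_factor3 d)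
  then have "eventually (\<lambda>L. 5 * exp 1 * (KB L ^ 3 / sin (a3 / L) * exp (- d * L)) < 1) at_top"
    by (rule order_tendstoD) simp
  then show ?thesis using eventually_angle[OF a3] eventually_gt_at_top[of 0]
  proof eventually_elim
    case (elim L)
    have s3: "0 < sin (a3 / L)" using elim by (intro sin_gt_zero) auto
    have WL: "W L + \<tau> L + 1 = L + 1 + - d * L" unfolding W_def \<tau>_def d_def using a0 by (simp add: field_simps)
    have "5 * real (K L) ^ 3 * (exp (W L + \<tau> L + 1) / sin (a3 / L)) \<le> 5 * KB L ^ 3 * (exp (W L + \<tau> L + 1) / sin (a3 / L))"
      using K_le[of L] elim s3 by (intro mult_right_mono mult_left_mono power_mono) auto
    also have "\<dots> = exp L * (5 * exp 1 * (KB L ^ 3 / sin (a3 / L) * exp (- d * L)))"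
      unfolding WL exp_add by (simp add: mult_ac)
    also have "\<dots> \<le> exp L * 1" using elim by (intro mult_left_mono) auto
    finally show ?case by simp
  qed
qed

definition bound where
  "bound L = 2 / ((strip_rate (a / L) / strip_rate (a2 / L)) ^ (Suc r * T L) * (sin (a2 / L))\<^sup>2 * exp (- \<tau> L - 2) / (2 * real r ^ Suc r)) *
    (5 * K L / q2 L ^ T L + 5 * real (K L) ^ 4 * (W L + \<tau> L + 2) * (exp (W L + \<tau> L + 1) / sin (a3 / L)) / exp L *
      (strip_rate (a3 / L) / strip_rate (a2 / L)) ^ K L)"

text \<open>Each summand is at most a factor of polynomial growth times \<open>exp (L * e)\<close>,
  with \<open>e\<close> converging to the left side of \<open>E1\<close> or of \<open>E2\<close>.
  The two occurrences of \<open>\<tau>\<close> in \<open>e2\<close> come from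
  \<open>1 / \<kappa>\<close> and from \<open>Mx\<close>.\<close>

lemma bound_asymp: "(bound \<longlongrightarrow> 0) at_top"
proof -
  let ?C = "4 * real r ^ Suc r * exp 2"
  define e1 where "e1 L = \<tau> L / L + real (Suc r) * (T L / L ^ 3) * (L\<^sup>2 * (ln (strip_rate (a2 / L)) - ln (strip_rate (a / L))))
    - T L / L ^ 3 * (L\<^sup>2 * ln (q2 L))" for L
  define e2 where "e2 L = \<tau> L / L + real (Suc r) * (T L / L ^ 3) * (L\<^sup>2 * (ln (strip_rate (a2 / L)) - ln (strip_rate (a / L))))
    + (W L + \<tau> L) / L - 1 + real r * (T L / L ^ 3) * (L\<^sup>2 * (ln (strip_rate (a3 / L)) - ln (strip_rate (a2 / L))))" for L
  have lin: "((\<lambda>L. W L / L) \<longlongrightarrow> pi / a) at_top" "((\<lambda>L. \<tau> L / L) \<longlongrightarrow> pi / (a * s\<^sup>2)) at_top"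
    "((\<lambda>L. (W L + \<tau> L) / L) \<longlongrightarrow> pi / a + pi / (a * s\<^sup>2)) at_top"
  proof -
    have ev: "eventually (\<lambda>L. pi / a = W L / L \<and> pi / (a * s\<^sup>2) = \<tau> L / L \<and> pi / a + pi / (a * s\<^sup>2) = (W L + \<tau> L) / L) at_top"
      using eventually_gt_at_top[of 0] by eventually_elim (use a0 in \<open>simp add: W_def \<tau>_def field_simps\<close>)
    show "((\<lambda>L. W L / L) \<longlongrightarrow> pi / a) at_top" "((\<lambda>L. \<tau> L / L) \<longlongrightarrow> pi / (a * s\<^sup>2)) at_top"
      "((\<lambda>L. (W L + \<tau> L) / L) \<longlongrightarrow> pi / a + pi / (a * s\<^sup>2)) at_top"
      by (rule Lim_transform_eventually[OF tendsto_const], rule eventually_mono[OF ev], simp)+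
  qed
  have e1: "(e1 \<longlongrightarrow> pi / (a * s\<^sup>2) + real (Suc r) * (1 / s) * ((a\<^sup>2 - a2\<^sup>2) / 2) - 1 / s * (\<beta> - a2\<^sup>2 / 2)) at_top"
    unfolding e1_def
    by (intro tendsto_intros lin T_asymp ln_rate_diff_asymp[OF a0(2,1)] ln_q2_asymp)
  have e2: "(e2 \<longlongrightarrow> pi / (a * s\<^sup>2) + real (Suc r) * (1 / s) * ((a\<^sup>2 - a2\<^sup>2) / 2) + (pi / a + pi / (a * s\<^sup>2)) - 1
     + real r * (1 / s) * ((a2\<^sup>2 - a3\<^sup>2) / 2)) at_top"
    unfolding e2_def
    by (intro tendsto_intros lin T_asymp ln_rate_diff_asymp[OF a0(2,1)] ln_rate_diff_asymp[OF a3 a0(2)])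
  have rs: "real (Suc r) * (1 / s) = s + 1 / s" "real r * (1 / s) = s"
    using a0 by (auto simp: field_simps power2_eq_square)
  have e1_neg: "pi / (a * s\<^sup>2) + real (Suc r) * (1 / s) * ((a\<^sup>2 - a2\<^sup>2) / 2) - 1 / s * (\<beta> - a2\<^sup>2 / 2) < 0"
    unfolding rs using E1 by (simp add: field_simps)
  have e2_neg: "pi / (a * s\<^sup>2) + real (Suc r) * (1 / s) * ((a\<^sup>2 - a2\<^sup>2) / 2) + (pi / a + pi / (a * s\<^sup>2)) - 1
     + real r * (1 / s) * ((a2\<^sup>2 - a3\<^sup>2) / 2) < 0"
  proof -
    have "pi / (a * s\<^sup>2) + (pi / a + pi / (a * s\<^sup>2)) = pi / a * (1 + 2 / s\<^sup>2)" using a0 by (simp add: field_simps)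
    then show ?thesis unfolding rs using E2 by linarith
  qed
  have ev: "eventually (\<lambda>L. 0 < L \<and> 0 < sin (a2 / L) \<and> 0 < sin (a3 / L) \<and> 0 < strip_rate (a / L) \<and> 0 < strip_rate (a2 / L) \<and> 0 < strip_rate (a3 / L)) at_top"
    using eventually_angle[OF a0(1)] eventually_angle[OF a0(2)] eventually_angle[OF a3] eventually_gt_at_top[of 0]
    by eventually_elim (auto intro!: strip_rate_pos sin_gt_zero)
  have pos1: "eventually (\<lambda>L. 0 \<le> KB L / (sin (a2 / L))\<^sup>2) at_top"
    using eventually_gt_at_top[of 0] by eventually_elim (use a0 in \<open>auto simp: KB_def\<close>)
  have pos2: "eventually (\<lambda>L. 0 \<le> KB L ^ 4 * (W L + \<tau> L + 2) / (sin (a2 / L) ^ 2 * sin (a3 / L))) at_top"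
    using ev by eventually_elim
      (use a0 in \<open>auto simp: KB_def W_def \<tau>_def intro!: divide_nonneg_nonneg mult_nonneg_nonneg add_nonneg_nonneg\<close>)
  have "((\<lambda>L. ?C * (5 * (KB L / (sin (a2 / L))\<^sup>2 * exp (L * e1 L)) +
      5 * exp 1 * (KB L ^ 4 * (W L + \<tau> L + 2) / (sin (a2 / L) ^ 2 * sin (a3 / L)) * exp (L * e2 L)))) \<longlongrightarrow> ?C * (5 * 0 + 5 * exp 1 * 0)) at_top"
    by (intro tendsto_intros tendsto_poly_times_exp[OF pos1 poly_factor1 e1 e1_neg]
         tendsto_poly_times_exp[OF pos2 poly_factor2 e2 e2_neg])
  then have lim: "((\<lambda>L. ?C * (5 * (KB L / (sin (a2 / L))\<^sup>2 * exp (L * e1 L)) +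
      5 * exp 1 * (KB L ^ 4 * (W L + \<tau> L + 2) / (sin (a2 / L) ^ 2 * sin (a3 / L)) * exp (L * e2 L)))) \<longlongrightarrow> 0) at_top"
    by simp
  have le: "eventually (\<lambda>L. 0 \<le> bound L \<and> bound L \<le> ?C * (5 * (KB L / (sin (a2 / L))\<^sup>2 * exp (L * e1 L)) +
      5 * exp 1 * (KB L ^ 4 * (W L + \<tau> L + 2) / (sin (a2 / L) ^ 2 * sin (a3 / L)) * exp (L * e2 L)))) at_top"
    using ev q2_ge_1
  proof eventually_elim
    case (elim L)
    define c c2 c3 q k t w where "c = strip_rate (a / L)" and "c2 = strip_rate (a2 / L)" and "c3 = strip_rate (a3 / L)"
      and "q = q2 L" and "k = K L" and "t = T L" and "w = W L + \<tau> L + 2"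
    have ch: "0 < c" "0 < c2" "0 < c3" "0 < q" "0 < L" using elim by (auto simp: c_def c2_def c3_def q_def)
    have w0: "0 \<le> w" unfolding w_def W_def \<tau>_def using ch a0 by (intro add_nonneg_nonneg) auto
    have kk: "real k \<le> KB L" using K_le[of L] ch by (simp add: k_def)
    have pw: "x ^ m = exp (m * ln x)" if "0 < x" for x :: real and m :: nat
      using that by (simp add: exp_of_nat_mult)
    have L3: "L * (T L / L ^ 3 * (L\<^sup>2 * y)) = t * y" for y :: real
      using ch by (simp add: t_def field_simps power2_eq_square power3_eq_cube)
    have x1: "exp (L * e1 L) = exp (\<tau> L) * (c2 / c) ^ (Suc r * t) / q ^ t"
    proof -
      have "L * e1 L = \<tau> L + real (Suc r) * (t * (ln c2 - ln c)) - t * ln q"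
      proof -
        have "L * (x / L + m * u * v - u * v') = x + m * (L * (u * v)) - L * (u * v')" for x m u v v'
          using ch by (simp add: algebra_simps)
        then show ?thesis
          unfolding e1_def c_def[symmetric] c2_def[symmetric] q_def[symmetric] by (simp only: L3)
      qed
      moreover have "(c2 / c) ^ (Suc r * t) = exp (real (Suc r) * (t * (ln c2 - ln c)))"
        using ch by (subst pw) (auto simp: ln_div algebra_simps)
      ultimately show ?thesis using ch by (simp add: exp_add exp_diff pw)
    qed
    have x2: "exp 1 * exp (L * e2 L) = exp (\<tau> L) * (c2 / c) ^ (Suc r * t) * (exp (W L + \<tau> L + 1) / exp L) * (c3 / c2) ^ k"
    proof -
      have "L * e2 L = \<tau> L + real (Suc r) * (t * (ln c2 - ln c)) + (W L + \<tau> L - L) + real r * (t * (ln c3 - ln c2))"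
      proof -
        have "L * (x / L + m * u * v + y / L - 1 + m' * u * v') = x + m * (L * (u * v)) + (y - L) + m' * (L * (u * v'))" for x y m m' u v v'
          using ch by (simp add: algebra_simps)
        then show ?thesis
          unfolding e2_def c_def[symmetric] c2_def[symmetric] c3_def[symmetric] by (simp only: L3)
      qed
      moreover have "(c2 / c) ^ (Suc r * t) = exp (real (Suc r) * (t * (ln c2 - ln c)))"
        using ch by (subst pw) (auto simp: ln_div algebra_simps)
      moreover have "(c3 / c2) ^ k = exp (real r * (t * (ln c3 - ln c2)))"
        using ch unfolding k_def K_def t_def by (subst pw) (auto simp: ln_div mult.assoc)
      ultimately show ?thesis by (simp add: exp_add exp_diff exp_double power2_eq_square)
    qed
    have inv: "2 / ((c / c2) ^ (Suc r * t) * (sin (a2 / L))\<^sup>2 * exp (- \<tau> L - 2) / (2 * real r ^ Suc r))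
       = ?C * (exp (\<tau> L) * (c2 / c) ^ (Suc r * t) / (sin (a2 / L))\<^sup>2)"
    proof -
      have gen: "2 / (X / Y * S * Z / (2 * R)) = 4 * R * E * (F * (Y / X) / S)" if "Z = 1 / (E * F)" "0 < X" "0 < Y" "0 < S" "0 < E" "0 < F" "0 < R"
        for X Y S Z R E F :: real using that(2-) unfolding that(1) by (simp add: field_simps)
      show ?thesis unfolding power_divide
        using ch elim a0 by (intro gen) (auto simp: exp_diff exp_minus field_simps)
    qed
    let ?P = "exp (\<tau> L) * (c2 / c) ^ (Suc r * t)"
    have b_eq: "bound L = ?C * (?P / (sin (a2 / L))\<^sup>2) * (5 * k / q ^ t + 5 * real k ^ 4 * w * (exp (W L + \<tau> L + 1) / sin (a3 / L)) / exp L * (c3 / c2) ^ k)"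
      unfolding bound_def c_def[symmetric] c2_def[symmetric] c3_def[symmetric] q_def[symmetric]
        k_def[symmetric] t_def[symmetric] w_def[symmetric] inv by simp
    also have "\<dots> = ?C * (5 * (real k / (sin (a2 / L))\<^sup>2 * exp (L * e1 L)) +
        5 * (real k ^ 4 * w / (sin (a2 / L) ^ 2 * sin (a3 / L)) * (exp 1 * exp (L * e2 L))))"
    proof -
      have "C * (P / S2) * (5 * k' / Q + 5 * k' ^ 4 * w * (M / s3) / E * G)
          = C * (5 * (k' / S2 * (P / Q)) + 5 * (k' ^ 4 * w / (S2 * s3) * (P * (M / E) * G)))"
        for C P S2 k' Q M s3 E G :: real
        by (simp add: divide_inverse algebra_simps)
      then show ?thesis unfolding x1 x2 of_nat_mult of_nat_numeral .
    qed
    also have "\<dots> \<le> ?C * (5 * (KB L / (sin (a2 / L))\<^sup>2 * exp (L * e1 L)) +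
        5 * (KB L ^ 4 * w / (sin (a2 / L) ^ 2 * sin (a3 / L)) * (exp 1 * exp (L * e2 L))))"
      using kk w0 elim
      by (intro mult_left_mono add_mono mult_right_mono divide_right_mono power_mono) auto
    finally have up: "bound L \<le> ?C * (5 * (KB L / (sin (a2 / L))\<^sup>2 * exp (L * e1 L)) +
        5 * exp 1 * (KB L ^ 4 * (W L + \<tau> L + 2) / (sin (a2 / L) ^ 2 * sin (a3 / L)) * exp (L * e2 L)))"
      unfolding w_def by (simp add: mult_ac)
    have "0 \<le> bound L"
      unfolding b_eq using ch w0 elim
      by (intro mult_nonneg_nonneg add_nonneg_nonneg divide_nonneg_nonneg) auto
    with up show ?case by blast
  qed
  show ?thesis
    by (rule tendsto_sandwich[OF _ _ tendsto_const lim]) (use le in \<open>auto elim: eventually_mono\<close>)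
qed

end

lemma (in tour_graph) light_cycle_whp:
  assumes b: "pi\<^sup>2 / 2 < b"
  shows "(\<lambda>n. measure (exp_prod (edges n)) (light_free n ((1 + b / (ln (real n))\<^sup>2) / (exp 1 * real n)))) \<longlonglongrightarrow> 0"
proof -
  obtain a a2 a3 \<beta> :: real and s :: nat where "asymp_constants a a2 a3 \<beta> b s"
    by (rule choose_constants[OF b])
  then interpret C: asymp_constants a a2 a3 \<beta> b s .
  have big_T: "eventually (\<lambda>L. real (max 3 m0) \<le> real (C.T L)) at_top"
    using C.T_at_top unfolding filterlim_at_top by blast
  \<comment> \<open>All estimates are in the real variable \<open>L\<close>; the premise
    \<open>exp L = real n\<close> ties it to \<open>n\<close>, and \<open>L = ln (real n)\<close> is
    substituted only afterwards.\<close>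
  have ev: "eventually (\<lambda>L. \<forall>n. exp L = real n \<longrightarrow> measure (exp_prod (edges n)) (light_free n ((1 + b / L\<^sup>2) / (exp 1 * real n))) \<le> C.bound L) at_top"
    using C.eventually_angle[OF C.a0(1)] C.eventually_angle[OF C.a0(2)] C.eventually_angle[OF C.a3]
      C.eventually_fit C.eventually_cot[OF C.a0(1)] C.eventually_cot[OF C.a0(2)]
      C.eventually_square_small[OF C.a0(1)] C.eventually_square_small[OF C.a0(2)]
      C.sparse_asymp C.fill_asymp C.q2_ge_1 C.rate_mono C.light_asymp big_T eventually_gt_at_top[of 0]
  proof eventually_elim
    case (elim L)
    show ?case
    proof (intro allI impI)
      fix n assume n: "exp L = real n"
      have q2: "real n * C.\<mu> L * strip_rate (a2 / L) = C.q2 L"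
        unfolding C.\<mu>_def C.q2_def n[symmetric] by simp
      have \<mu>: "0 < C.\<mu> L" unfolding C.\<mu>_def using C.\<beta> by (auto intro!: divide_pos_pos add_pos_nonneg)
      have "measure (exp_prod (edges n)) (light_free n ((1 + b / L\<^sup>2) / (exp 1 * real n)))
        \<le> 2 / ((strip_rate (a / L) / strip_rate (a2 / L)) ^ (Suc C.r * C.T L) * (sin (a2 / L))\<^sup>2 * exp (- C.\<tau> L - 2) / (2 * real C.r ^ Suc C.r)) *
          (5 * C.K L / (real n * C.\<mu> L * strip_rate (a2 / L)) ^ C.T L +
           5 * real (C.K L) ^ 4 * (C.W L + C.\<tau> L + 2) * (exp (C.W L + C.\<tau> L + 1) / sin (a3 / L)) / n *
             (strip_rate (a3 / L) / strip_rate (a2 / L)) ^ C.K L)"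
      proof (rule light_cycle_bound)
        show "C.W L = pi / (a / L)" by (simp add: C.W_def)
        show "C.\<tau> L = C.W L / real C.r" by (simp add: C.\<tau>_def)
        show "0 < C.r" using C.a0 by simp
        show "C.K L = C.r * C.T L" by (simp add: C.K_def)
        show "3 \<le> C.T L" "m0 \<le> C.T L" using elim(14) by auto
        show "1 \<le> real n * C.\<mu> L * strip_rate (a2 / L)" using elim(11) unfolding q2 .
      qed (use elim \<mu> in \<open>simp_all only: n[symmetric]\<close>)
      also have "\<dots> = C.bound L" unfolding C.bound_def q2 n ..
      finally show "measure (exp_prod (edges n)) (light_free n ((1 + b / L\<^sup>2) / (exp 1 * real n))) \<le> C.bound L" .
    qed
  qed
  have lnlim: "filterlim (\<lambda>n. ln (real n)) at_top sequentially"
    by (rule filterlim_compose[OF ln_at_top filterlim_real_sequentially])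
  have lim: "(\<lambda>n. C.bound (ln (real n))) \<longlonglongrightarrow> 0"
    by (rule filterlim_compose[OF C.bound_asymp lnlim])
  have "eventually (\<lambda>n. measure (exp_prod (edges n)) (light_free n ((1 + b / (ln (real n))\<^sup>2) / (exp 1 * real n))) \<le> C.bound (ln (real n))) sequentially"
    using eventually_compose_filterlim[OF ev lnlim] eventually_gt_at_top[of 0]
    by eventually_elim auto
  then show ?thesis by (intro tendsto_sandwich[OF _ _ tendsto_const lim]) auto
qed

subsection \<open>Counting short cycles\<close>

lemma ln_le_half_diff_inverse:
  fixes y :: real
  assumes "1 \<le> y"
  shows "ln y \<le> (y - 1 / y) / 2"
proof -
  have "(1 - 1 / 1) / 2 - ln 1 \<le> (y - 1 / y) / 2 - ln y"
  proof (rule DERIV_nonneg_imp_nondecreasing[of 1 y "\<lambda>y. (y - 1 / y) / 2 - ln y"])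
    fix x assume x: "1 \<le> x" "x \<le> y"
    have "((\<lambda>y. (y - 1 / y) / 2 - ln y) has_real_derivative (1 - 1 / x)\<^sup>2 / 2) (at x)"
      using x by (auto intro!: derivative_eq_intros simp: field_simps power2_eq_square)
    moreover have "0 \<le> (1 - 1 / x)\<^sup>2 / 2" by simp
    ultimately show "\<exists>d. ((\<lambda>y. (y - 1 / y) / 2 - ln y) has_real_derivative d) (at x) \<and> 0 \<le> d" by blast
  qed (use assms in auto)
  then show ?thesis by simp
qed

text \<open>The correction \<open>1 / (4 * k)\<close> telescopes against the error of each induction
  step, and \<open>3 / 4\<close> makes the claim an equality at \<open>k = 1\<close>. The explicit
  constant matters, since the probability of a light cycle will be bounded by
  \<open>2 * exp (- 3 / 4)\<close>, which has to be below \<open>1\<close>.\<close>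

lemma stirling_upper_aux:
  "1 \<le> k \<Longrightarrow> (k + 1 / 2) * ln k - k - ln (fact k) \<le> - 3 / 4 - 1 / (4 * real k)"
proof (induction k rule: dec_induct)
  case (step k)
  define x where "x = real k"
  have x: "1 \<le> x" using step by (simp add: x_def)
  have "ln ((x + 1) / x) \<le> ((x + 1) / x - 1 / ((x + 1) / x)) / 2"
    using x by (intro ln_le_half_diff_inverse) simp
  then have "(x + 1 / 2) * ln ((x + 1) / x) \<le> (x + 1 / 2) * (((x + 1) / x - 1 / ((x + 1) / x)) / 2)"
    using x by (intro mult_left_mono) auto
  also have "\<dots> = 1 + 1 / (4 * x) - 1 / (4 * (x + 1))"
    using x by (simp add: divide_simps) (simp add: algebra_simps)
  finally have "(x + 1 / 2) * (ln (x + 1) - ln x) \<le> 1 + 1 / (4 * x) - 1 / (4 * (x + 1))"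
    using x by (simp add: ln_div)
  moreover have fact: "ln (fact (Suc k)) = ln (x + 1) + ln (fact k)"
    using x by (simp add: x_def ln_mult_pos add.commute)
  moreover have "(x + 1 / 2) * ln x - x - ln (fact k) \<le> - 3 / 4 - 1 / (4 * x)"
    using step.IH by (simp add: x_def)
  ultimately have le: "((x + 1 / 2) * ln x - x - ln (fact k)) + (x + 1 / 2) * (ln (x + 1) - ln x) - 1
      \<le> - 3 / 4 - 1 / (4 * (x + 1))" by linarith
  have eq: "(Suc k + 1 / 2) * ln (Suc k) - Suc k - ln (fact (Suc k))
     = ((x + 1 / 2) * ln x - x - ln (fact k)) + (x + 1 / 2) * (ln (x + 1) - ln x) - 1"
    unfolding fact by (simp add: x_def algebra_simps)
  have rk: "real (Suc k) = x + 1" by (simp add: x_def)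
  show ?case unfolding eq unfolding rk by (rule le)
qed simp

lemma power_div_fact_le:
  assumes "1 \<le> k"
  shows "real k ^ k * exp (- real k) / fact k \<le> exp (- 3 / 4) / sqrt k"
proof -
  have k: "0 < real k" using assms by simp
  have "real k ^ k * exp (- real k) / fact k * sqrt k = exp ((k + 1 / 2) * ln k - k - ln (fact k))"
  proof -
    have e1: "exp (k * ln k) = real k ^ k" using k by (subst exp_of_nat_mult) simp
    have "exp (ln (sqrt k)) = sqrt k" using k by (subst exp_ln) auto
    then have e2: "exp (ln k / 2) = sqrt k" using k by (simp only: ln_sqrt)
    have "(k + 1 / 2) * ln k - k - ln (fact k) = k * ln k + ln k / 2 - k - ln (fact k)"
      by (simp add: distrib_right)
    then have "exp ((k + 1 / 2) * ln k - k - ln (fact k)) = exp (k * ln k) * exp (ln k / 2) / exp k / exp (ln (fact k))"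
      by (simp only: exp_diff exp_add)
    also have "\<dots> = real k ^ k * sqrt k / exp k / fact k" unfolding e1 e2 by simp
    also have "\<dots> = real k ^ k * exp (- real k) / fact k * sqrt k" by (simp add: exp_minus divide_inverse)
    finally show ?thesis by (rule sym)
  qed
  also have "\<dots> \<le> exp (- 3 / 4)"
  proof -
    have "0 \<le> 1 / (4 * real k)" by simp
    then have "(k + 1 / 2) * ln k - k - ln (fact k) \<le> - 3 / 4"
      using stirling_upper_aux[OF assms] by linarith
    then show ?thesis by simp
  qed
  finally show ?thesis using k by (simp add: field_simps)
qed

text \<open>Telescoping comparison with the integral. The sum starts at the smallest possible length
  \<open>2\<close>; a term for \<open>k = 1\<close> would raise the bound to \<open>3\<close>, too
  much for the first moment to stay below \<open>1\<close>.\<close>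

lemma sum_inverse_three_halves_le:
  "1 \<le> m \<Longrightarrow> (\<Sum>k=2..m. 1 / (real k * sqrt k)) \<le> 2 - 2 / sqrt m"
proof (induction m rule: dec_induct)
  case (step m)
  define a b where "a = sqrt m" and "b = sqrt (Suc m)"
  have ab: "0 < a" "a \<le> b" "a * a = m" "b * b = Suc m" using step by (auto simp: a_def b_def)
  have "1 / (real (Suc m) * b) \<le> 2 / a - 2 / b"
  proof -
    have "(b - a) * (b + a) = b * b - a * a" by (simp add: algebra_simps)
    then have "(b - a) * (b + a) = 1" unfolding ab(3,4) by simp
    moreover have "0 < b + a" using ab(1,2) by simp
    ultimately have d: "b - a = 1 / (b + a)" by (simp add: eq_divide_eq)
    have "2 / a - 2 / b = 2 * (b - a) / (a * b)" using ab(1,2) by (simp add: field_simps)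
    also have "\<dots> = 2 / (a * b * (b + a))" unfolding d by simp
    finally have e: "2 / a - 2 / b = 2 / (a * b * (b + a))" .
    have "a * (b + a) \<le> b * (b + b)" using ab(1,2) by (intro mult_mono) auto
    then have "a * (b + a) * b \<le> b * (b + b) * b" using ab(1,2) by (intro mult_right_mono) auto
    also have "\<dots> = 2 * ((b * b) * b)" by (simp add: algebra_simps)
    finally have "a * b * (b + a) \<le> 2 * (real (Suc m) * b)" unfolding ab(4) by (simp only: mult_ac)
    then have "2 / (2 * (real (Suc m) * b)) \<le> 2 / (a * b * (b + a))"
      using ab(1,2) by (intro divide_left_mono) auto
    then show ?thesis unfolding e by simp
  qed
  moreover have "(\<Sum>k=2..Suc m. 1 / (real k * sqrt k)) = (\<Sum>k=2..m. 1 / (real k * sqrt k)) + 1 / (real (Suc m) * sqrt (Suc m))"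
    using step by (subst sum.nat_ivl_Suc') auto
  ultimately show ?case using step.IH unfolding a_def b_def by linarith
qed simp

lemma sum_inverse_sqrt_le: "(\<Sum>k=1..m. 1 / sqrt (real k)) \<le> 2 * sqrt m"
proof (induction m)
  case (Suc m)
  define a b where "a = sqrt m" and "b = sqrt (Suc m)"
  have ab: "0 \<le> a" "0 < b" "a * a = m" "b * b = Suc m" by (auto simp: a_def b_def)
  have "2 * a * b \<le> a * a + b * b" using zero_le_power2[of "a - b"] by (simp add: power2_eq_square algebra_simps)
  then have "1 + 2 * a * b \<le> 2 * (b * b)" unfolding ab(3,4) by simp
  then have "1 \<le> (2 * b - 2 * a) * b" by (simp add: algebra_simps)
  then have "1 / b \<le> 2 * b - 2 * a" using ab(2) by (simp add: pos_divide_le_eq)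
  then show ?case using Suc by (simp add: a_def b_def)
qed simp

text \<open>The sum is cut at \<open>y\<close>. Up to \<open>y\<close> the subtracted
  \<open>1\<close> matters: the numerator is at most
  \<open>\<delta> * k * exp (\<delta> * y)\<close>, so short lengths carry a factor
  \<open>\<delta>\<close>. Beyond \<open>y\<close> the full \<open>exp (\<delta> * x)\<close> is
  paid, but the denominator is at least \<open>y * sqrt y\<close>. Later
  \<open>y = L^2\<close>.\<close>

lemma short_window_sum_le:
  fixes \<delta> x y :: real
  assumes \<delta>: "0 \<le> \<delta>" and y: "1 \<le> y"
  shows "(\<Sum>k \<in>{k \<in> {2..n}. real k \<le> x}. ((1 + \<delta>) ^ k - 1) / (k * sqrt k))
    \<le> 2 * \<delta> * exp (\<delta> * y) * sqrt y + max 0 x * exp (\<delta> * x) / (y * sqrt y)"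
proof -
  let ?K = "{k \<in> {2..n}. real k \<le> x}"
  let ?u = "\<lambda>k. if real k \<le> y then \<delta> * exp (\<delta> * y) * (1 / sqrt k) else 0" and ?v = "\<lambda>k. if real k \<le> y then 0 else exp (\<delta> * x) / (y * sqrt y)"
  have "(\<Sum>k \<in>?K. ((1 + \<delta>) ^ k - 1) / (k * sqrt k)) \<le> (\<Sum>k \<in>?K.
      ?u k + ?v k)"
  proof (rule sum_mono)
    fix k assume k: "k \<in> ?K"
    have le_exp: "(1 + \<delta>) ^ k \<le> exp (\<delta> * k)"
    proof -
      have "(1 + \<delta>) ^ k \<le> exp \<delta> ^ k" using \<delta> by (intro power_mono exp_ge_add_one_self) auto
      then show ?thesis by (simp add: exp_of_nat_mult[symmetric] mult.commute)
    qed
    show "((1 + \<delta>) ^ k - 1) / (k * sqrt k) \<le>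
      ?u k + ?v k"
    proof (cases "real k \<le> y")
      case True
      have "1 - \<delta> * k \<le> exp (- (\<delta> * k))" using exp_ge_add_one_self[of "- (\<delta> * k)"] by simp
      then have "exp (\<delta> * k) * (1 - \<delta> * k) \<le> 1"
        using mult_left_mono[of "1 - \<delta> * k" "exp (- (\<delta> * k))" "exp (\<delta> * k)"] by (simp add: exp_minus)
      then have "exp (\<delta> * k) - 1 \<le> \<delta> * k * exp (\<delta> * k)" by (simp add: algebra_simps)
      also have "\<dots> \<le> \<delta> * k * exp (\<delta> * y)" using \<delta> True by (intro mult_left_mono) (auto intro: mult_left_mono)
      finally have "(1 + \<delta>) ^ k - 1 \<le> \<delta> * k * exp (\<delta> * y)" using le_exp by linarith
      then have "((1 + \<delta>) ^ k - 1) / (k * sqrt k) \<le> \<delta> * k * exp (\<delta> * y) / (k * sqrt k)"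
        by (intro divide_right_mono) auto
      also have "\<dots> = \<delta> * exp (\<delta> * y) * (1 / sqrt k)" using k by simp
      finally show ?thesis using True by simp
    next
      case False
      have "((1 + \<delta>) ^ k - 1) \<le> exp (\<delta> * x)"
      proof -
        have "exp (\<delta> * k) \<le> exp (\<delta> * x)" using k \<delta> by (auto intro: mult_left_mono)
        then show ?thesis using le_exp by linarith
      qed
      moreover have "y * sqrt y \<le> k * sqrt k" using False y by (intro mult_mono) auto
      ultimately have "((1 + \<delta>) ^ k - 1) / (k * sqrt k) \<le> exp (\<delta> * x) / (y * sqrt y)"
        using y by (intro frac_le) auto
      then show ?thesis using False by simp
    qed
  qed
  also have "\<dots> = (\<Sum>k \<in>?K. ?u k)
     + (\<Sum>k \<in>?K. ?v k)"
    by (rule sum.distrib)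
  also have "\<dots> \<le> 2 * \<delta> * exp (\<delta> * y) * sqrt y + max 0 x * exp (\<delta> * x) / (y * sqrt y)"
  proof (rule add_mono)
    let ?m = "nat \<lfloor>y\<rfloor>"
    have m: "real ?m \<le> y" using y by linarith
    have "(\<Sum>k \<in>?K. ?u k)
      = (\<Sum>k | k \<in> {2..n} \<and> real k \<le> x \<and> real k \<le> y. \<delta> * exp (\<delta> * y) * (1 / sqrt k))"
      by (subst sum.inter_filter[symmetric]) (auto intro!: sum.cong)
    also have "\<dots> \<le> (\<Sum>k=1..?m. \<delta> * exp (\<delta> * y) * (1 / sqrt k))"
      using \<delta> by (intro sum_mono2) (auto simp: le_nat_floor)
    also have "\<dots> \<le> \<delta> * exp (\<delta> * y) * (2 * sqrt ?m)"
      unfolding sum_distrib_left[symmetric] using \<delta> by (intro mult_left_mono sum_inverse_sqrt_le) auto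
    also have "\<dots> \<le> \<delta> * exp (\<delta> * y) * (2 * sqrt y)" using \<delta> m by (intro mult_left_mono) auto
    finally show "(\<Sum>k \<in>?K. ?u k)
      \<le> 2 * \<delta> * exp (\<delta> * y) * sqrt y" by (simp add: mult_ac)
    have "(\<Sum>k \<in>?K. ?v k)
      \<le> (\<Sum>k \<in>?K. exp (\<delta> * x) / (y * sqrt y))"
      using y by (intro sum_mono) auto
    also have "\<dots> = real (card ?K) * (exp (\<delta> * x) / (y * sqrt y))" by simp
    also have "\<dots> \<le> max 0 x * (exp (\<delta> * x) / (y * sqrt y))"
    proof (rule mult_right_mono)
      have "card ?K \<le> card {1..nat \<lfloor>x\<rfloor>}" by (intro card_mono) (auto simp: le_nat_floor)
      then show "real (card ?K) \<le> max 0 x" by simp linarith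
    qed (use y in auto)
    finally show "(\<Sum>k \<in>?K. ?v k)
      \<le> max 0 x * exp (\<delta> * x) / (y * sqrt y)" by simp
  qed
  finally show ?thesis .
qed

section \<open>Total weight of a single cycle and first moments\<close>

lemma nn_integral_power_div_fact:
  assumes "0 \<le> s" "s \<le> t"
  shows "(\<integral>\<^sup>+x. ennreal (x ^ k / fact k) * indicator {s..t} x \<partial>lborel)
    = ennreal (t ^ Suc k / fact (Suc k) - s ^ Suc k / fact (Suc k))"
proof (rule nn_integral_FTC_Icc[where F = "\<lambda>x. x ^ Suc k / fact (Suc k)"])
  fix x :: real
  show "((\<lambda>x. x ^ Suc k / fact (Suc k)) has_real_derivative x ^ k / fact k) (at x)"
  proof -
    have "real (Suc k) * x ^ (Suc k - Suc 0) / fact (Suc k) = x ^ k / fact k" by (simp del: of_nat_Suc)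
    then show ?thesis using DERIV_cdivide[OF DERIV_pow[of "Suc k" x], of "fact (Suc k)"] by (simp only:)
  qed
qed (use assms in \<open>auto\<close>)

text \<open>The sum has an Erlang density; without its factor \<open>exp (- x)\<close> this
  integrates to a difference of powers.\<close>

lemma iid_sum_window:
  assumes iid: "iid_exponential_weights M E X" and E: "finite E" and c: "c \<subseteq> E" "c \<noteq> {}" and st: "0 \<le> s" "s \<le> t"
  shows "measure M {\<omega> \<in> space M. s < (\<Sum>e\<in>c. X e \<omega>) \<and> (\<Sum>e\<in>c. X e \<omega>) \<le> t} \<le> (t ^ card c - s ^ card c) / fact (card c)"
    and "measure M {\<omega> \<in> space M. (\<Sum>e\<in>c. X e \<omega>) \<le> t} \<le> t ^ card c / fact (card c)"
proof -
  interpret prob_space M using iid by (simp add: iid_exponential_weights_def)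
  have fc: "finite c" using finite_subset[OF c(1) E] .
  obtain k where k: "card c = Suc k" using c fc by (cases "card c") auto
  have D: "distributed M lborel (\<lambda>\<omega>. \<Sum>e\<in>c. X e \<omega>) (erlang_density (card c - 1) 1)"
    using iid c fc unfolding iid_exponential_weights_def
    by (intro exponential_distributed_sum) (auto intro: indep_vars_subset)
  have [measurable]: "(\<lambda>\<omega>. \<Sum>e\<in>c. X e \<omega>) \<in> borel_measurable M"
    using distributed_measurable[OF D] by simp
  have dens: "erlang_density k 1 x \<le> x ^ k / fact k" if "0 \<le> x" for x
    using that by (auto simp: erlang_density_def intro!: divide_right_mono mult_left_le)
  \<comment> \<open>Both claims are instances, the second with \<open>A\<close> a half line and
    \<open>s' = 0\<close>, since the density vanishes on negative numbers.\<close>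
  have key: "emeasure M ((\<lambda>\<omega>. \<Sum>e\<in>c. X e \<omega>) -` A \<inter> space M) \<le> ennreal ((t ^ card c - s' ^ card c) / fact (card c))"
    if A: "A \<in> sets borel" "\<And>x. x \<in> A \<Longrightarrow> 0 \<le> x \<Longrightarrow> s' \<le> x \<and> x \<le> t" and s': "0 \<le> s'" "s' \<le> t" for A s'
  proof -
    have "emeasure M ((\<lambda>\<omega>. \<Sum>e\<in>c. X e \<omega>) -` A \<inter> space M) = (\<integral>\<^sup>+x. ennreal (erlang_density k 1 x) * indicator A x \<partial>lborel)"
      using distributed_emeasure[OF D, of A] A k by simp
    also have "\<dots> \<le> (\<integral>\<^sup>+x. ennreal (x ^ k / fact k) * indicator {s'..t} x \<partial>lborel)"
    proof (rule nn_integral_mono)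
      fix x :: real
      show "ennreal (erlang_density k 1 x) * indicator A x \<le> ennreal (x ^ k / fact k) * indicator {s'..t} x"
      proof (cases "x \<in> A \<and> 0 \<le> x")
        case True
        then show ?thesis using A(2)[of x] dens[of x] by (auto intro: ennreal_leI)
      qed (auto simp: erlang_density_def indicator_def)
    qed
    also have "\<dots> = ennreal ((t ^ card c - s' ^ card c) / fact (card c))"
      using s' by (subst nn_integral_power_div_fact) (auto simp: k diff_divide_distrib)
    finally show ?thesis .
  qed
  have pos: "0 \<le> (t ^ card c - s' ^ card c) / fact (card c)" if "0 \<le> s'" "s' \<le> t" for s'
    using that by (intro divide_nonneg_nonneg) (auto intro: power_mono)
  have "{\<omega> \<in> space M. s < (\<Sum>e\<in>c. X e \<omega>) \<and> (\<Sum>e\<in>c. X e \<omega>) \<le> t} = (\<lambda>\<omega>. \<Sum>e\<in>c. X e \<omega>) -` {s<..t} \<inter> space M"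
    by auto
  then show "measure M {\<omega> \<in> space M. s < (\<Sum>e\<in>c. X e \<omega>) \<and> (\<Sum>e\<in>c. X e \<omega>) \<le> t} \<le> (t ^ card c - s ^ card c) / fact (card c)"
    using key[of "{s<..t}" s] st pos[OF st] by (simp add: emeasure_eq_measure)
  have "{\<omega> \<in> space M. (\<Sum>e\<in>c. X e \<omega>) \<le> t} = (\<lambda>\<omega>. \<Sum>e\<in>c. X e \<omega>) -` {..t} \<inter> space M" by auto
  then show "measure M {\<omega> \<in> space M. (\<Sum>e\<in>c. X e \<omega>) \<le> t} \<le> t ^ card c / fact (card c)"
    using key[of "{..t}" 0] st pos[of 0] k by (simp add: emeasure_eq_measure)
qed

context tour_graph
begin

lemma card_cycle_bounds:
  assumes "c \<in> cycles n"
  shows "2 \<le> card c" "card c \<le> n" "m0 \<le> card c"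
proof -
  obtain vs where vs: "vs \<in> simple_lists n (card c)" "m0 \<le> card c" using assms by (rule cyclesE)
  then show "m0 \<le> card c" "2 \<le> card c" using m0 by auto
  have "card (set vs) \<le> card {..<n}" using vs by (intro card_mono) (auto simp: simple_lists_def)
  then show "card c \<le> n" using vs by (auto simp: simple_lists_def distinct_card)
qed

lemma sum_cycles_le:
  assumes F: "\<And>k. 2 \<le> k \<Longrightarrow> 0 \<le> (F k :: real)"
  shows "(\<Sum>c | c \<in> cycles n \<and> P (card c). F (card c)) \<le> (\<Sum>k | k \<in> {2..n} \<and> P k. real n ^ k / k * F k)"
proof -
  let ?C = "{c \<in> cycles n. P (card c)}" and ?K = "{k \<in> {2..n}. P k}"
  have "(\<Sum>c\<in>?C. F (card c)) = (\<Sum>k\<in>?K. \<Sum>c | c \<in> ?C \<and> card c = k. F (card c))"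
    using card_cycle_bounds by (intro sum.group[symmetric]) auto
  also have "\<dots> \<le> (\<Sum>k\<in>?K. real n ^ k / k * F k)"
  proof (rule sum_mono)
    fix k assume k: "k \<in> ?K"
    have "(\<Sum>c | c \<in> ?C \<and> card c = k. F (card c)) = real (card {c \<in> ?C. card c = k}) * F k" by simp
    also have "\<dots> \<le> real n ^ k / k * F k"
    proof (rule mult_right_mono)
      have sub: "card {c \<in> ?C. card c = k} \<le> card {c \<in> cycles n. card c = k}" by (intro card_mono) auto
      have "real k * real (card {c \<in> ?C. card c = k}) \<le> real n ^ k"
      proof (cases "m0 \<le> k")
        case True
        have "k * card {c \<in> ?C. card c = k} \<le> n ^ k"
          using card_cycles_le[OF True, of n] mult_le_mono2[OF sub, of k] by linarith
        then show ?thesis by (metis of_nat_le_iff of_nat_mult of_nat_power)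
      next
        case False
        then have none: "{c \<in> ?C. card c = k} = {}" using card_cycle_bounds(3) by auto
        show ?thesis unfolding none by simp
      qed
      then show "real (card {c \<in> ?C. card c = k}) \<le> real n ^ k / k" using k by (simp add: field_simps)
    qed (use F k in auto)
    finally show "(\<Sum>c | c \<in> ?C \<and> card c = k. F (card c)) \<le> real n ^ k / k * F k" .
  qed
  finally show ?thesis by simp
qed

text \<open>This is why \<open>1 / (e n)\<close> is the critical scale: \<open>n\<close> cancels,
  and at \<open>x = 1\<close> there remains a Stirling quotient divided by \<open>k\<close>, of
  order \<open>k ^ (- 3 / 2)\<close>, whose sum converges.\<close>

lemma cycle_term_eq:
  assumes "0 < n" "1 \<le> k"
  shows "real n ^ k / k * ((k * (x / (exp 1 * n))) ^ k / fact k) = x ^ k / k * (real k ^ k * exp (- real k) / fact k)"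
proof -
  have e: "exp (- real k) = 1 / exp 1 ^ k" by (simp add: exp_of_nat_mult[symmetric] exp_minus divide_inverse)
  show ?thesis unfolding e using assms by (simp add: power_mult_distrib power_divide)
qed

text \<open>A union bound. Any bound below \<open>1\<close> that is uniform in \<open>n\<close> will
  do, as it only has to keep the probability of the conditioning event away from
  \<open>0\<close>.\<close>

lemma prob_light_cycle_le:
  assumes iid: "iid_exponential_weights M (edges n) X" and n: "0 < n"
  shows "measure M {\<omega> \<in> space M. \<exists>c\<in>cycles n. mean_weight (\<lambda>e. X e \<omega>) c \<le> 1 / (exp 1 * n)} \<le> 2 * exp (- 3 / 4)"
proof -
  interpret prob_space M using iid by (simp add: iid_exponential_weights_def)
  have Xm: "X e \<in> borel_measurable M" if "e \<in> edges n" for e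
  proof -
    have "distributed M lborel (X e) (exponential_density 1)"
      using iid that by (simp add: iid_exponential_weights_def)
    from distributed_measurable[OF this] show ?thesis by simp
  qed
  define F where "F k = (k * (1 / (exp 1 * n))) ^ k / fact k" for k :: nat
  have cb: "c \<subseteq> edges n" "c \<noteq> {}" "0 < card c" if "c \<in> cycles n" for c
    using that cycles_subset card_cycle_bounds(1)[OF that] by auto
  let ?A = "\<lambda>c. {\<omega> \<in> space M. (\<Sum>e\<in>c. X e \<omega>) \<le> card c * (1 / (exp 1 * n))}"
  have Am: "?A c \<in> events" if "c \<in> cycles n" for c
  proof -
    have "(\<lambda>\<omega>. \<Sum>e\<in>c. X e \<omega>) \<in> borel_measurable M" using cb[OF that] Xm by (intro borel_measurable_sum) auto
    then show ?thesis by measurable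
  qed
  have "{\<omega> \<in> space M. \<exists>c\<in>cycles n. mean_weight (\<lambda>e. X e \<omega>) c \<le> 1 / (exp 1 * n)} = (\<Union>c\<in>cycles n. ?A c)"
    using cb(3) by (auto simp: mean_weight_def divide_le_eq mult.commute)
  also have "measure M \<dots> \<le> (\<Sum>c\<in>cycles n. measure M (?A c))"
    using Am by (intro finite_measure_subadditive_finite) auto
  also have "\<dots> \<le> (\<Sum>c\<in>cycles n. F (card c))"
    unfolding F_def
  proof (rule sum_mono)
    fix c assume c: "c \<in> cycles n"
    have "0 \<le> card c * (1 / (exp 1 * n))" by simp
    from iid_sum_window(2)[OF iid finite_edges cb(1,2)[OF c] order_refl this]
    show "measure M (?A c) \<le> (card c * (1 / (exp 1 * n))) ^ card c / fact (card c)" .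
  qed
  also have "\<dots> \<le> (\<Sum>k=2..n. real n ^ k / k * F k)"
  proof -
    have "{c. c \<in> cycles n \<and> True} = cycles n" "{k. k \<in> {2..n} \<and> True} = {2..n}" by auto
    then show ?thesis using sum_cycles_le[of F n "\<lambda>_. True"] by (simp add: F_def)
  qed
  also have "\<dots> \<le> (\<Sum>k=2..n. exp (- 3 / 4) * (1 / (real k * sqrt k)))"
  proof (rule sum_mono)
    fix k assume k: "k \<in> {2..n}"
    have "real n ^ k / k * F k = 1 / k * (real k ^ k * exp (- real k) / fact k)"
      using cycle_term_eq[of n k 1] n k unfolding F_def by simp
    also have "\<dots> \<le> 1 / k * (exp (- 3 / 4) / sqrt k)"
      using k by (intro mult_left_mono power_div_fact_le) auto
    finally show "real n ^ k / k * F k \<le> exp (- 3 / 4) * (1 / (real k * sqrt k))" by simp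
  qed
  also have "\<dots> \<le> exp (- 3 / 4) * (2 - 2 / sqrt n)"
    unfolding sum_distrib_left[symmetric] using n by (intro mult_left_mono sum_inverse_three_halves_le) auto
  also have "\<dots> \<le> 2 * exp (- 3 / 4)" by (simp add: right_diff_distrib)
  finally show ?thesis .
qed

text \<open>The lower end of the window contributes the \<open>- 1\<close> in
  \<open>(1 + \<delta>) ^ k - 1\<close>, without which the bound for short cycles would be of
  constant order.\<close>

lemma prob_short_window_le:
  assumes iid: "iid_exponential_weights M (edges n) X" and n: "0 < n" and \<delta>: "0 \<le> \<delta>" and y: "1 \<le> y"
  shows "measure M {\<omega> \<in> space M. \<exists>c\<in>cycles n. real (card c) \<le> x \<and>
      1 / (exp 1 * n) < mean_weight (\<lambda>e. X e \<omega>) c \<and> mean_weight (\<lambda>e. X e \<omega>) c \<le> (1 + \<delta>) / (exp 1 * n)}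
    \<le> 2 * \<delta> * exp (\<delta> * y) * sqrt y + max 0 x * exp (\<delta> * x) / (y * sqrt y)"
proof -
  interpret prob_space M using iid by (simp add: iid_exponential_weights_def)
  have Xm: "X e \<in> borel_measurable M" if "e \<in> edges n" for e
  proof -
    have "distributed M lborel (X e) (exponential_density 1)"
      using iid that by (simp add: iid_exponential_weights_def)
    from distributed_measurable[OF this] show ?thesis by simp
  qed
  define F where "F k = ((k * ((1 + \<delta>) / (exp 1 * n))) ^ k - (k * (1 / (exp 1 * n))) ^ k) / fact k" for k :: nat
  have F0: "0 \<le> F k" for k
  proof -
    have "k * (1 / (exp 1 * n)) \<le> k * ((1 + \<delta>) / (exp 1 * n))"
      using \<delta> by (intro mult_left_mono divide_right_mono) auto
    then have "(k * (1 / (exp 1 * n))) ^ k \<le> (k * ((1 + \<delta>) / (exp 1 * n))) ^ k" by (intro power_mono) auto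
    then show ?thesis unfolding F_def by simp
  qed
  have cb: "c \<subseteq> edges n" "c \<noteq> {}" "0 < card c" if "c \<in> cycles n" for c
    using that cycles_subset card_cycle_bounds(1)[OF that] by auto
  let ?A = "\<lambda>c. {\<omega> \<in> space M. card c * (1 / (exp 1 * n)) < (\<Sum>e\<in>c. X e \<omega>) \<and> (\<Sum>e\<in>c. X e \<omega>) \<le> card c * ((1 + \<delta>) / (exp 1 * n))}"
  let ?C = "{c \<in> cycles n. real (card c) \<le> x}"
  have Am: "?A c \<in> events" if "c \<in> cycles n" for c
  proof -
    have "(\<lambda>\<omega>. \<Sum>e\<in>c. X e \<omega>) \<in> borel_measurable M" using cb[OF that] Xm by (intro borel_measurable_sum) auto
    then show ?thesis by measurable
  qed
  have "measure M {\<omega> \<in> space M. \<exists>c\<in>cycles n. real (card c) \<le> x \<and>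
      1 / (exp 1 * n) < mean_weight (\<lambda>e. X e \<omega>) c \<and> mean_weight (\<lambda>e. X e \<omega>) c \<le> (1 + \<delta>) / (exp 1 * n)} \<le> measure M (\<Union>c\<in>?C. ?A c)"
  proof (rule finite_measure_mono)
    show "{\<omega> \<in> space M. \<exists>c\<in>cycles n. real (card c) \<le> x \<and>
      1 / (exp 1 * n) < mean_weight (\<lambda>e. X e \<omega>) c \<and> mean_weight (\<lambda>e. X e \<omega>) c \<le> (1 + \<delta>) / (exp 1 * n)} \<subseteq> (\<Union>c\<in>?C. ?A c)"
    proof
      fix \<omega> assume "\<omega> \<in> {\<omega> \<in> space M. \<exists>c\<in>cycles n. real (card c) \<le> x \<and>
        1 / (exp 1 * n) < mean_weight (\<lambda>e. X e \<omega>) c \<and> mean_weight (\<lambda>e. X e \<omega>) c \<le> (1 + \<delta>) / (exp 1 * n)}"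
      then obtain c where \<omega>: "\<omega> \<in> space M" and c: "c \<in> cycles n" "real (card c) \<le> x"
        and w: "1 / (exp 1 * n) < mean_weight (\<lambda>e. X e \<omega>) c" "mean_weight (\<lambda>e. X e \<omega>) c \<le> (1 + \<delta>) / (exp 1 * n)"
        by blast
      have k0: "0 < real (card c)" using cb(3)[OF c(1)] by simp
      have "\<omega> \<in> ?A c"
        using \<omega> w unfolding mean_weight_def pos_less_divide_eq[OF k0] pos_divide_le_eq[OF k0] mult.commute[of _ "real (card c)"]
        by blast
      then show "\<omega> \<in> (\<Union>c\<in>?C. ?A c)" using c by blast
    qed
    show "(\<Union>c\<in>?C. ?A c) \<in> events" using Am by (intro sets.finite_UN) auto
  qed
  also have "\<dots> \<le> (\<Sum>c\<in>?C. measure M (?A c))"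
    using Am by (intro finite_measure_subadditive_finite) auto
  also have "\<dots> \<le> (\<Sum>c\<in>?C. F (card c))"
    unfolding F_def
  proof (rule sum_mono)
    fix c assume "c \<in> ?C"
    then have c: "c \<in> cycles n" by simp
    have "0 \<le> card c * (1 / (exp 1 * n))" by simp
    moreover have "card c * (1 / (exp 1 * n)) \<le> card c * ((1 + \<delta>) / (exp 1 * n))"
      using \<delta> by (intro mult_left_mono divide_right_mono) auto
    ultimately show "measure M (?A c) \<le> ((card c * ((1 + \<delta>) / (exp 1 * n))) ^ card c - (card c * (1 / (exp 1 * n))) ^ card c) / fact (card c)"
      by (rule iid_sum_window(1)[OF iid finite_edges cb(1,2)[OF c]])
  qed
  also have "\<dots> \<le> (\<Sum>k \<in>{k \<in> {2..n}. real k \<le> x}. real n ^ k / k * F k)"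
    by (rule sum_cycles_le[OF F0])
  also have "\<dots> \<le> (\<Sum>k \<in>{k \<in> {2..n}. real k \<le> x}. ((1 + \<delta>) ^ k - 1) / (k * sqrt k))"
  proof (rule sum_mono)
    fix k assume k: "k \<in> {k \<in> {2..n}. real k \<le> x}"
    have kn: "0 < n" "1 \<le> k" using n k by auto
    define h where "h = real k ^ k * exp (- real k) / fact k"
    have "real n ^ k / k * F k = (1 + \<delta>) ^ k / k * h - 1 ^ k / k * h"
      unfolding F_def h_def diff_divide_distrib right_diff_distrib cycle_term_eq[OF kn, of "1 + \<delta>"] cycle_term_eq[OF kn, of 1] ..
    also have "\<dots> = ((1 + \<delta>) ^ k - 1) / k * h" by (simp add: diff_divide_distrib left_diff_distrib)
    finally have "real n ^ k / k * F k = ((1 + \<delta>) ^ k - 1) / k * (real k ^ k * exp (- real k) / fact k)" unfolding h_def .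
    also have "\<dots> \<le> ((1 + \<delta>) ^ k - 1) / k * (exp (- 3 / 4) / sqrt k)"
      using k \<delta> by (intro mult_left_mono power_div_fact_le divide_nonneg_nonneg) auto
    also have "\<dots> \<le> ((1 + \<delta>) ^ k - 1) / k * (1 / sqrt k)"
      using k \<delta> by (intro mult_left_mono divide_right_mono divide_nonneg_nonneg) auto
    finally show "real n ^ k / k * F k \<le> ((1 + \<delta>) ^ k - 1) / (k * sqrt k)" by simp
  qed
  also have "\<dots> \<le> 2 * \<delta> * exp (\<delta> * y) * sqrt y + max 0 x * exp (\<delta> * x) / (y * sqrt y)"
    by (rule short_window_sum_le[OF \<delta> y])
  finally show ?thesis .
qed

end

subsection \<open>The minimum mean-weight cycle\<close>

text \<open>The second moment argument runs on the product space; this transfers it to i.i.d.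
  weights on an arbitrary probability space.\<close>

lemma iid_distr:
  assumes iid: "iid_exponential_weights M E X" and E: "E \<noteq> {}"
  shows "distr M (exp_prod E) (\<lambda>\<omega>. \<lambda>e\<in>E. X e \<omega>) = exp_prod E"
    and "(\<lambda>\<omega>. \<lambda>e\<in>E. X e \<omega>) \<in> measurable M (exp_prod E)"
proof -
  interpret prob_space M using iid by (simp add: iid_exponential_weights_def)
  have D: "distributed M lborel (X e) (exponential_density 1)" if "e \<in> E" for e
    using iid that by (simp add: iid_exponential_weights_def)
  have Xm: "X e \<in> measurable M borel" if "e \<in> E" for e
    using distributed_measurable[OF D[OF that]] by simp
  have "distr M borel (X e) = exp_measure" if "e \<in> E" for e
  proof -
    have "distr M borel (X e) = distr M lborel (X e)" by (rule distr_cong) auto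
    also have "\<dots> = exp_measure"
      using distributed_distr_eq_density[OF D[OF that]] by (simp add: exp_measure_def)
    finally show ?thesis .
  qed
  then have e: "Pi\<^sub>M E (\<lambda>e. distr M borel (X e)) = exp_prod E" by (intro PiM_cong) auto
  have s: "sets (Pi\<^sub>M E (\<lambda>_. borel :: real measure)) = sets (exp_prod E)"
    by (intro sets_PiM_cong) auto
  have "distr M (Pi\<^sub>M E (\<lambda>_. borel)) (\<lambda>\<omega>. \<lambda>e\<in>E. X e \<omega>) = Pi\<^sub>M E (\<lambda>e. distr M borel (X e))"
    using iid Xm E by (subst indep_vars_iff_distr_eq_PiM'[symmetric]) (auto simp: iid_exponential_weights_def)
  then have "distr M (Pi\<^sub>M E (\<lambda>_. borel)) (\<lambda>\<omega>. \<lambda>e\<in>E. X e \<omega>) = exp_prod E" unfolding e .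
  moreover have "distr M (exp_prod E) (\<lambda>\<omega>. \<lambda>e\<in>E. X e \<omega>) = distr M (Pi\<^sub>M E (\<lambda>_. borel)) (\<lambda>\<omega>. \<lambda>e\<in>E. X e \<omega>)"
    using s by (intro distr_cong) auto
  ultimately show "distr M (exp_prod E) (\<lambda>\<omega>. \<lambda>e\<in>E. X e \<omega>) = exp_prod E" by simp
  show "(\<lambda>\<omega>. \<lambda>e\<in>E. X e \<omega>) \<in> measurable M (exp_prod E)"
    using Xm by (intro measurable_restrict) simp
qed

lemma arg_min_eq_SOME:
  fixes f :: "'c \<Rightarrow> 'b :: linorder"
  shows "arg_min f (\<lambda>c. c \<in> C) = (SOME c. c \<in> {c \<in> C. \<forall>d\<in>C. f c \<le> f d})"
  unfolding arg_min_def is_arg_min_def by (rule arg_cong[where f = Eps]) (auto simp: not_less)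

text \<open>The choice made by \<open>arg_min\<close> depends on \<open>\<omega>\<close> only
  through the set of minimisers, and there are finitely many such sets, each attained on a
  measurable event.\<close>

lemma arg_min_measurable:
  fixes f :: "'c \<Rightarrow> 'a \<Rightarrow> real"
  assumes C: "finite C" and f [measurable]: "\<And>c. c \<in> C \<Longrightarrow> f c \<in> borel_measurable M"
  shows "{\<omega> \<in> space M. R (arg_min (\<lambda>c. f c \<omega>) (\<lambda>c. c \<in> C))} \<in> sets M"
proof -
  let ?S = "\<lambda>\<omega>. {c \<in> C. \<forall>d\<in>C. f c \<omega> \<le> f d \<omega>}"
  have m: "{\<omega> \<in> space M. ?S \<omega> = T} \<in> sets M" if T: "T \<subseteq> C" for T
  proof -
    have "?S \<omega> = T \<longleftrightarrow> (\<forall>c\<in>C. c \<in> T \<longleftrightarrow> (\<forall>d\<in>C. f c \<omega> \<le> f d \<omega>))" for \<omega> using T by blast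
    moreover have "{\<omega> \<in> space M. \<forall>c\<in>C. c \<in> T \<longleftrightarrow> (\<forall>d\<in>C. f c \<omega> \<le> f d \<omega>)} \<in> sets M"
      using C by measurable
    ultimately show ?thesis by simp
  qed
  have "{\<omega> \<in> space M. R (arg_min (\<lambda>c. f c \<omega>) (\<lambda>c. c \<in> C))}
    = (\<Union>T\<in>{T \<in> Pow C. R (SOME c. c \<in> T)}. {\<omega> \<in> space M. ?S \<omega> = T})"
    unfolding arg_min_eq_SOME by auto
  also have "\<dots> \<in> sets M" using C m by (intro sets.finite_UN) auto
  finally show ?thesis .
qed

text \<open>\<open>\<eta> n\<close> is \<open>1 / Suc j\<close> for the largest
  \<open>j \<le> n\<close> whose threshold \<open>N j\<close> has been passed; it decreases slowly
  enough for the estimate at \<open>\<eta> n\<close> to be valid at \<open>n\<close>.\<close>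

lemma diagonal_vanishing:
  fixes f :: "real \<Rightarrow> nat \<Rightarrow> real"
  assumes f: "\<And>\<epsilon>. 0 < \<epsilon> \<Longrightarrow> f \<epsilon> \<longlonglongrightarrow> 0"
  shows "\<exists>\<eta>. \<eta> \<longlonglongrightarrow> 0 \<and> (\<lambda>n. f (\<eta> n) n) \<longlonglongrightarrow> 0"
proof -
  have "\<exists>N. \<forall>n\<ge>N. \<bar>f (1 / Suc j) n\<bar> < 1 / Suc j" for j
    using LIMSEQ_D[OF f[of "1 / Suc j"], of "1 / Suc j"] by simp
  then obtain N where N: "N j \<le> n \<Longrightarrow> \<bar>f (1 / Suc j) n\<bar> < 1 / Suc j" for j n by metis
  define A where "A n = {j. j \<le> n \<and> N j \<le> n}" for n
  \<comment> \<open>The inserted \<open>0\<close> keeps the maximum meaningful before any threshold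
    has been passed.\<close>
  define J where "J n = Max (insert 0 (A n))" for n
  have fin: "finite (A n)" for n by (simp add: A_def)
  have J_ge: "j \<le> J n" if "j \<le> n" "N j \<le> n" for j n
    unfolding J_def using fin that by (intro Max_ge) (auto simp: A_def)
  have J_in: "N (J n) \<le> n" if "N 0 \<le> n" for n
  proof -
    have "J n \<in> insert 0 (A n)" unfolding J_def using fin by (intro Max_in) auto
    then show ?thesis using that by (auto simp: A_def)
  qed
  define \<eta> where "\<eta> n = 1 / real (Suc (J n))" for n
  have "filterlim J at_top sequentially"
    unfolding filterlim_at_top
  proof
    fix j
    show "eventually (\<lambda>n. j \<le> J n) sequentially"
      using eventually_ge_at_top[of "max j (N j)"] by eventually_elim (auto intro: J_ge)
  qed
  from filterlim_compose[OF LIMSEQ_inverse_real_of_nat this]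
  have \<eta>: "\<eta> \<longlonglongrightarrow> 0" unfolding \<eta>_def by (simp add: inverse_eq_divide)
  moreover have "(\<lambda>n. f (\<eta> n) n) \<longlonglongrightarrow> 0"
  proof (rule Lim_null_comparison[OF _ \<eta>])
    show "eventually (\<lambda>n. norm (f (\<eta> n) n) \<le> \<eta> n) sequentially"
      using eventually_ge_at_top[of "N 0"]
    proof eventually_elim
      case (elim n)
      then show ?case using N[OF J_in[OF elim]] by (simp add: \<eta>_def)
    qed
  qed
  ultimately show ?thesis by blast
qed

abbreviation (input) length_bound :: "real \<Rightarrow> nat \<Rightarrow> real" where
  "length_bound \<eta> n \<equiv> (2 / pi\<^sup>2 - \<eta>) * (ln (real n))\<^sup>2 * ln (ln (real n))"

lemma two_exp_bound: "2 * exp (- 3 / 4 :: real) < 1"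
proof -
  have "1 + 3 / 4 + (3 / 4)\<^sup>2 / 2 \<le> exp (3 / 4 :: real)" by (rule exp_lower_Taylor_quadratic) simp
  then have "2 < exp (3 / 4 :: real)" by (simp add: power2_eq_square)
  then show ?thesis by (simp add: exp_minus field_simps)
qed

context tour_graph
begin

lemma cycles_nonempty:
  assumes "m0 \<le> n"
  shows "cycles n \<noteq> {}"
proof -
  have "[0..<m0] \<in> simple_lists n m0" using assms by (auto simp: simple_lists_def)
  then show ?thesis using closed_tour_in_cycles by blast
qed

lemma edges_nonempty:
  assumes "m0 \<le> n"
  shows "edges n \<noteq> {}"
proof -
  have "0 < n" "1 < n" using assms m0 by auto
  then have "edge 0 1 \<in> edges n" unfolding edges_def by (intro CollectI exI[of _ 0] exI[of _ 1] conjI refl) auto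
  then show ?thesis by auto
qed

lemma min_mean_cycle_least:
  assumes "m0 \<le> n"
  shows "min_mean_cycle (cycles n) w \<in> cycles n"
    and "c \<in> cycles n \<Longrightarrow> mean_weight w (min_mean_cycle (cycles n) w) \<le> mean_weight w c"
  using arg_min_if_finite[OF finite_cycles cycles_nonempty[OF assms], of "mean_weight w"]
  unfolding min_mean_cycle_def arg_min_on_def by (auto simp: not_less)

lemma mean_weight_cycle_measurable:
  assumes iid: "iid_exponential_weights M (edges n) X" and c: "c \<in> cycles n"
  shows "(\<lambda>\<omega>. mean_weight (\<lambda>e. X e \<omega>) c) \<in> borel_measurable M"
proof -
  have "X e \<in> borel_measurable M" if "e \<in> c" for e
  proof -
    have "distributed M lborel (X e) (exponential_density 1)"
      using iid that cycles_subset[OF c] by (auto simp: iid_exponential_weights_def)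
    from distributed_measurable[OF this] show ?thesis by simp
  qed
  then have "(\<lambda>\<omega>. \<Sum>e\<in>c. X e \<omega>) \<in> borel_measurable M" by (intro borel_measurable_sum) auto
  then show ?thesis unfolding mean_weight_def by measurable
qed

lemma prob_no_light_cycle_eq:
  assumes iid: "iid_exponential_weights M (edges n) X" and n: "m0 \<le> n"
  shows "measure M {\<omega> \<in> space M. \<forall>c\<in>cycles n. t < mean_weight (\<lambda>e. X e \<omega>) c}
    = measure (exp_prod (edges n)) (light_free n t)"
proof -
  let ?f = "\<lambda>\<omega>. \<lambda>e\<in>edges n. X e \<omega>"
  let ?B = "(light_free n t)"
  note D = iid_distr[OF iid edges_nonempty[OF n]]
  have [measurable]: "(\<lambda>z. mean_weight z c) \<in> borel_measurable (exp_prod (edges n))" if "c \<in> cycles n" for c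
  proof -
    have "(\<lambda>z. z e) \<in> borel_measurable (exp_prod (edges n))" if "e \<in> c" for e
      using subsetD[OF cycles_subset[OF \<open>c \<in> cycles n\<close>] that] by simp
    then have "(\<lambda>z. \<Sum>e\<in>c. z e) \<in> borel_measurable (exp_prod (edges n))" by (rule borel_measurable_sum)
    then show ?thesis unfolding mean_weight_def by measurable
  qed
  have B: "?B \<in> sets (exp_prod (edges n))" by measurable
  have mw: "mean_weight (?f \<omega>) c = mean_weight (\<lambda>e. X e \<omega>) c" if "c \<in> cycles n" for \<omega> c
    unfolding mean_weight_def using cycles_subset[OF that]
    by (intro arg_cong2[where f = "(/)"] refl sum.cong) auto
  have "measure (exp_prod (edges n)) ?B = measure (distr M (exp_prod (edges n)) ?f) ?B" unfolding D(1) ..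
  also have "\<dots> = measure M (?f -` ?B \<inter> space M)" by (rule measure_distr[OF D(2) B])
  also have "?f -` ?B \<inter> space M = {\<omega> \<in> space M. \<forall>c\<in>cycles n. t < mean_weight (\<lambda>e. X e \<omega>) c}"
    using mw measurable_space[OF D(2)] by auto
  finally show ?thesis ..
qed

text \<open>With \<open>y = L^2\<close> and \<open>c = 2 / pi^2 - \<eta>\<close> the second summand
  is of order \<open>L^2 * ln L * L^(b c) / L^3\<close>, and \<open>b * c < 1\<close> makes it
  vanish. The \<open>max 0\<close> covers \<open>\<eta>\<close> so large that \<open>c\<close> is
  negative.\<close>

lemma short_window_asymp:
  fixes b \<eta> :: real
  assumes b: "0 < b" and \<eta>: "0 < \<eta>" and neg: "b * (2 / pi\<^sup>2 - \<eta>) < 1"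
  shows "((\<lambda>L. 2 * (b / L\<^sup>2) * exp (b / L\<^sup>2 * L\<^sup>2) * sqrt (L\<^sup>2) +
      max 0 ((2 / pi\<^sup>2 - \<eta>) * L\<^sup>2 * ln L) * exp (b / L\<^sup>2 * ((2 / pi\<^sup>2 - \<eta>) * L\<^sup>2 * ln L)) / (L\<^sup>2 * sqrt (L\<^sup>2))) \<longlongrightarrow> 0) at_top"
proof -
  define d where "d = 1 - b * (2 / pi\<^sup>2 - \<eta>)"
  have d: "0 < d" using neg by (simp add: d_def)
  have lim: "((\<lambda>L. 2 * b * exp b / L + 2 / pi\<^sup>2 * (ln L * exp (- d * ln L))) \<longlongrightarrow> 0) at_top"
  proof -
    have "((\<lambda>L. ln L * exp (- d * ln L)) \<longlongrightarrow> 0) at_top" using d by real_asymp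
    moreover have "((\<lambda>L. 2 * b * exp b / L) \<longlongrightarrow> 0) at_top"
      by (rule real_tendsto_divide_at_top[OF tendsto_const filterlim_ident])
    ultimately show ?thesis by (intro tendsto_add_zero tendsto_mult_right_zero)
  qed
  have le: "eventually (\<lambda>L. norm (2 * (b / L\<^sup>2) * exp (b / L\<^sup>2 * L\<^sup>2) * sqrt (L\<^sup>2) +
      max 0 ((2 / pi\<^sup>2 - \<eta>) * L\<^sup>2 * ln L) * exp (b / L\<^sup>2 * ((2 / pi\<^sup>2 - \<eta>) * L\<^sup>2 * ln L)) / (L\<^sup>2 * sqrt (L\<^sup>2)))
    \<le> 2 * b * exp b / L + 2 / pi\<^sup>2 * (ln L * exp (- d * ln L))) at_top"
    using eventually_gt_at_top[of 1]
  proof eventually_elim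
    case (elim L)
    have L: "0 < L" "0 < ln L" using elim by auto
    have fst: "2 * (b / L\<^sup>2) * exp (b / L\<^sup>2 * L\<^sup>2) * sqrt (L\<^sup>2) = 2 * b * exp b / L"
      using L by (simp add: power2_eq_square)
    have "max 0 ((2 / pi\<^sup>2 - \<eta>) * L\<^sup>2 * ln L) \<le> 2 / pi\<^sup>2 * (L\<^sup>2 * ln L)"
    proof -
      have "(2 / pi\<^sup>2 - \<eta>) * (L\<^sup>2 * ln L) \<le> 2 / pi\<^sup>2 * (L\<^sup>2 * ln L)"
        using L \<eta> by (intro mult_right_mono) auto
      then show ?thesis using L by (simp add: mult.assoc)
    qed
    then have "max 0 ((2 / pi\<^sup>2 - \<eta>) * L\<^sup>2 * ln L) * exp (b / L\<^sup>2 * ((2 / pi\<^sup>2 - \<eta>) * L\<^sup>2 * ln L)) / (L\<^sup>2 * sqrt (L\<^sup>2))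
      \<le> 2 / pi\<^sup>2 * (L\<^sup>2 * ln L) * exp (b / L\<^sup>2 * ((2 / pi\<^sup>2 - \<eta>) * L\<^sup>2 * ln L)) / (L\<^sup>2 * sqrt (L\<^sup>2))"
      using L by (intro divide_right_mono mult_right_mono) auto
    also have "\<dots> = 2 / pi\<^sup>2 * (ln L * (exp (b / L\<^sup>2 * ((2 / pi\<^sup>2 - \<eta>) * L\<^sup>2 * ln L)) / L))"
      using L by (simp add: power2_eq_square)
    also have "exp (b / L\<^sup>2 * ((2 / pi\<^sup>2 - \<eta>) * L\<^sup>2 * ln L)) / L = exp (- d * ln L)"
    proof -
      have e: "b / L\<^sup>2 * ((2 / pi\<^sup>2 - \<eta>) * L\<^sup>2 * ln L) = b * (2 / pi\<^sup>2 - \<eta>) * ln L" using L by simp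
      have "- d * ln L = b * (2 / pi\<^sup>2 - \<eta>) * ln L - ln L" by (simp add: d_def algebra_simps)
      then have "exp (- d * ln L) = exp (b * (2 / pi\<^sup>2 - \<eta>) * ln L) / exp (ln L)" by (simp only: exp_diff)
      then show ?thesis unfolding e using L by simp
    qed
    finally have snd: "max 0 ((2 / pi\<^sup>2 - \<eta>) * L\<^sup>2 * ln L) * exp (b / L\<^sup>2 * ((2 / pi\<^sup>2 - \<eta>) * L\<^sup>2 * ln L)) / (L\<^sup>2 * sqrt (L\<^sup>2))
      \<le> 2 / pi\<^sup>2 * (ln L * exp (- d * ln L))" .
    have "0 \<le> 2 * (b / L\<^sup>2) * exp (b / L\<^sup>2 * L\<^sup>2) * sqrt (L\<^sup>2) +
      max 0 ((2 / pi\<^sup>2 - \<eta>) * L\<^sup>2 * ln L) * exp (b / L\<^sup>2 * ((2 / pi\<^sup>2 - \<eta>) * L\<^sup>2 * ln L)) / (L\<^sup>2 * sqrt (L\<^sup>2))"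
      using b by (intro add_nonneg_nonneg mult_nonneg_nonneg divide_nonneg_nonneg) auto
    then show ?case using fst snd unfolding real_norm_def by linarith
  qed
  show ?thesis by (rule Lim_null_comparison[OF le lim])
qed

text \<open>If the minimum exceeds \<open>(1 + b / L^2) / (e n)\<close>, there is no light cycle,
  which the second moment makes unlikely; otherwise the minimal cycle is itself a short cycle in the
  window, which the first moment makes unlikely.\<close>

lemma short_min_cycle_vanishing:
  fixes M :: "nat \<Rightarrow> 'a measure" and X :: "nat \<Rightarrow> 'e \<Rightarrow> 'a \<Rightarrow> real" and \<eta> :: real
  assumes iid: "\<And>n. iid_exponential_weights (M n) (edges n) (X n)" and \<eta>: "0 < \<eta>"
  shows "(\<lambda>n. measure (M n) {\<omega> \<in> space (M n).
      real (card (min_mean_cycle (cycles n) (\<lambda>e. X n e \<omega>))) < length_bound \<eta> n \<and>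
      1 / (exp 1 * real n) < mean_weight (\<lambda>e. X n e \<omega>) (min_mean_cycle (cycles n) (\<lambda>e. X n e \<omega>))}) \<longlonglongrightarrow> 0"
proof -
  \<comment> \<open>At \<open>b = pi^2 / 2\<close> the product is
    \<open>1 - \<eta> * pi^2 / 2\<close>, so by continuity a slightly larger \<open>b\<close> serves
    both moments.\<close>
  have "eventually (\<lambda>b. pi\<^sup>2 / 2 < b \<and> b * (2 / pi\<^sup>2 - \<eta>) < 1) (at_right (pi\<^sup>2 / 2))"
  proof (intro eventually_conj)
    show "eventually (\<lambda>b. pi\<^sup>2 / 2 < b) (at_right (pi\<^sup>2 / 2))" by (simp add: eventually_at_filter)
    have "((\<lambda>b. b * (2 / pi\<^sup>2 - \<eta>)) \<longlongrightarrow> pi\<^sup>2 / 2 * (2 / pi\<^sup>2 - \<eta>)) (at_right (pi\<^sup>2 / 2))"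
      by (intro tendsto_mult tendsto_const tendsto_ident_at)
    moreover have "pi\<^sup>2 / 2 * (2 / pi\<^sup>2 - \<eta>) < 1" using \<eta> by (simp add: right_diff_distrib)
    ultimately show "eventually (\<lambda>b. b * (2 / pi\<^sup>2 - \<eta>) < 1) (at_right (pi\<^sup>2 / 2))" by (rule order_tendstoD)
  qed
  then obtain b where b: "pi\<^sup>2 / 2 < b" "b * (2 / pi\<^sup>2 - \<eta>) < 1"
    using eventually_happens'[OF trivial_limit_at_right_real] by blast
  have "0 < pi\<^sup>2 / 2" by simp
  then have b0: "0 < b" using b(1) by (rule less_trans)
  let ?\<delta> = "\<lambda>n. b / (ln (real n))\<^sup>2" and ?y = "\<lambda>n. (ln (real n))\<^sup>2"
  let ?G = "\<lambda>n. 2 * ?\<delta> n * exp (?\<delta> n * ?y n) * sqrt (?y n) + max 0 (length_bound \<eta> n) * exp (?\<delta> n * length_bound \<eta> n) / (?y n * sqrt (?y n))"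
  let ?H = "\<lambda>n. measure (exp_prod (edges n)) (light_free n ((1 + ?\<delta> n) / (exp 1 * real n)))"
  have lnlim: "filterlim (\<lambda>n. ln (real n)) at_top sequentially"
    by (rule filterlim_compose[OF ln_at_top filterlim_real_sequentially])
  have G: "?G \<longlonglongrightarrow> 0"
    using filterlim_compose[OF short_window_asymp[OF b0 \<eta> b(2)] lnlim] .
  have lim: "(\<lambda>n. ?H n + ?G n) \<longlonglongrightarrow> 0"
    using tendsto_add[OF light_cycle_whp[OF b(1)] G] by simp
  have "eventually (\<lambda>n. 1 \<le> ln (real n)) sequentially" using lnlim unfolding filterlim_at_top by blast
  then have "eventually (\<lambda>n. norm (measure (M n) {\<omega> \<in> space (M n).
      real (card (min_mean_cycle (cycles n) (\<lambda>e. X n e \<omega>))) < length_bound \<eta> n \<and>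
      1 / (exp 1 * real n) < mean_weight (\<lambda>e. X n e \<omega>) (min_mean_cycle (cycles n) (\<lambda>e. X n e \<omega>))}) \<le> ?H n + ?G n) sequentially"
    using eventually_ge_at_top[of "max 1 m0"]
  proof eventually_elim
    case (elim n)
    have n: "m0 \<le> n" "0 < n" using elim by auto
    interpret prob_space "M n" using iid by (simp add: iid_exponential_weights_def)
    let ?c = "\<lambda>\<omega>. min_mean_cycle (cycles n) (\<lambda>e. X n e \<omega>)" and ?w = "\<lambda>\<omega>. mean_weight (\<lambda>e. X n e \<omega>)"
    let ?A = "{\<omega> \<in> space (M n). \<forall>c\<in>cycles n. (1 + ?\<delta> n) / (exp 1 * n) < ?w \<omega> c}"
    let ?B = "{\<omega> \<in> space (M n). \<exists>c\<in>cycles n. real (card c) \<le> length_bound \<eta> n \<and> 1 / (exp 1 * n) < ?w \<omega> c \<and> ?w \<omega> c \<le> (1 + ?\<delta> n) / (exp 1 * n)}"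
    have [measurable]: "(\<lambda>\<omega>. ?w \<omega> c) \<in> borel_measurable (M n)" if "c \<in> cycles n" for c
      by (rule mean_weight_cycle_measurable[OF iid that])
    have A: "?A \<in> events" and B: "?B \<in> events" by measurable
    have "measure (M n) {\<omega> \<in> space (M n). real (card (?c \<omega>)) < length_bound \<eta> n \<and> 1 / (exp 1 * n) < ?w \<omega> (?c \<omega>)} \<le> measure (M n) (?A \<union> ?B)"
    proof (rule finite_measure_mono)
      show "{\<omega> \<in> space (M n). real (card (?c \<omega>)) < length_bound \<eta> n \<and> 1 / (exp 1 * n) < ?w \<omega> (?c \<omega>)} \<subseteq> ?A \<union> ?B"
      proof
        fix \<omega> assume \<omega>: "\<omega> \<in> {\<omega> \<in> space (M n). real (card (?c \<omega>)) < length_bound \<eta> n \<and> 1 / (exp 1 * n) < ?w \<omega> (?c \<omega>)}"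
        note least = min_mean_cycle_least[OF n(1), where w = "\<lambda>e. X n e \<omega>"]
        show "\<omega> \<in> ?A \<union> ?B"
        proof (cases "?w \<omega> (?c \<omega>) \<le> (1 + ?\<delta> n) / (exp 1 * n)")
          case True
          then have "real (card (?c \<omega>)) \<le> length_bound \<eta> n \<and> 1 / (exp 1 * n) < ?w \<omega> (?c \<omega>) \<and> ?w \<omega> (?c \<omega>) \<le> (1 + ?\<delta> n) / (exp 1 * n)"
            using \<omega> by auto
          then show ?thesis using \<omega> least(1) by blast
        next
          case False
          then have lt: "(1 + ?\<delta> n) / (exp 1 * n) < ?w \<omega> (?c \<omega>)" by simp
          have "\<forall>c\<in>cycles n. (1 + ?\<delta> n) / (exp 1 * n) < ?w \<omega> c"
            by (intro ballI less_le_trans[OF lt least(2)])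
          then show ?thesis using \<omega> by blast
        qed
      qed
    qed (use A B in auto)
    also have "\<dots> \<le> measure (M n) ?A + measure (M n) ?B" by (rule measure_Un_le[OF A B])
    also have "measure (M n) ?A = ?H n" by (rule prob_no_light_cycle_eq[OF iid n(1)])
    also have "measure (M n) ?B \<le> ?G n"
      using b0 elim n by (intro prob_short_window_le iid) auto
    finally show ?case by simp
  qed
  then show ?thesis by (rule Lim_null_comparison[OF _ lim])
qed

text \<open>Conditioning costs only a constant factor: the conditioning event has probability at
  least \<open>c0 > 0\<close> for all large \<open>n\<close>, so the conditional probability of
  failure is at most \<open>f (\<eta> n) n / c0\<close>.\<close>

theorem min_mean_cycle_long:
  fixes M :: "nat \<Rightarrow> 'a measure" and X :: "nat \<Rightarrow> 'e \<Rightarrow> 'a \<Rightarrow> real"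
  assumes iid: "\<And>n. iid_exponential_weights (M n) (edges n) (X n)"
  shows "\<exists>\<eta> :: nat \<Rightarrow> real. \<eta> \<longlonglongrightarrow> 0 \<and>
       (\<lambda>n. \<P>(\<omega> in M n.
              real (card (min_mean_cycle (cycles n) (\<lambda>e. X n e \<omega>)))
                \<ge> length_bound (\<eta> n) n
            \<bar> mean_weight (\<lambda>e. X n e \<omega>) (min_mean_cycle (cycles n) (\<lambda>e. X n e \<omega>))
                > 1 / (exp 1 * real n))) \<longlonglongrightarrow> 1"
proof -
  let ?c = "\<lambda>n \<omega>. min_mean_cycle (cycles n) (\<lambda>e. X n e \<omega>)" and ?w = "\<lambda>n \<omega>. mean_weight (\<lambda>e. X n e \<omega>)"
  define f where "f = (\<lambda>\<eta> n. measure (M n) {\<omega> \<in> space (M n). real (card (?c n \<omega>)) < length_bound \<eta> n \<and> 1 / (exp 1 * real n) < ?w n \<omega> (?c n \<omega>)})"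
  have "f \<epsilon> \<longlonglongrightarrow> 0" if "0 < \<epsilon>" for \<epsilon>
    unfolding f_def by (rule short_min_cycle_vanishing[OF iid that])
  from diagonal_vanishing[of f, OF this]
  obtain \<eta> where \<eta>: "\<eta> \<longlonglongrightarrow> 0" "(\<lambda>n. f (\<eta> n) n) \<longlonglongrightarrow> 0" by blast
  define c0 where "c0 = 1 - 2 * exp (- 3 / 4 :: real)"
  have c0: "0 < c0" using two_exp_bound by (simp add: c0_def)
  have "(\<lambda>n. f (\<eta> n) n / c0) \<longlonglongrightarrow> 0 / c0" by (intro tendsto_divide \<eta> tendsto_const) (use c0 in simp)
  then have lim: "(\<lambda>n. f (\<eta> n) n / c0) \<longlonglongrightarrow> 0" by simp
  let ?P = "\<lambda>n. \<P>(\<omega> in M n. real (card (?c n \<omega>)) \<ge> length_bound (\<eta> n) n \<bar> ?w n \<omega> (?c n \<omega>) > 1 / (exp 1 * real n))"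
  have "eventually (\<lambda>n. norm (?P n - 1) \<le> f (\<eta> n) n / c0) sequentially"
    using eventually_ge_at_top[of "max 1 m0"]
  proof eventually_elim
    case (elim n)
    have n: "m0 \<le> n" "0 < n" using elim by auto
    interpret prob_space "M n" using iid by (simp add: iid_exponential_weights_def)
    have wm [measurable]: "(\<lambda>\<omega>. ?w n \<omega> c) \<in> borel_measurable (M n)" if "c \<in> cycles n" for c
      by (rule mean_weight_cycle_measurable[OF iid that])
    let ?t = "1 / (exp 1 * real n)"
    let ?Q = "{\<omega> \<in> space (M n). ?t < ?w n \<omega> (?c n \<omega>)}"
    let ?R = "{\<omega> \<in> space (M n). length_bound (\<eta> n) n \<le> real (card (?c n \<omega>))}"
    let ?L = "{\<omega> \<in> space (M n). \<exists>c\<in>cycles n. ?w n \<omega> c \<le> ?t}"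
    have Q_iff: "?t < ?w n \<omega> (?c n \<omega>) \<longleftrightarrow> \<not> (\<exists>c\<in>cycles n. ?w n \<omega> c \<le> ?t)" for \<omega>
    proof
      assume lt: "?t < ?w n \<omega> (?c n \<omega>)"
      show "\<not> (\<exists>c\<in>cycles n. ?w n \<omega> c \<le> ?t)"
      proof
        assume "\<exists>c\<in>cycles n. ?w n \<omega> c \<le> ?t"
        then obtain c where c: "c \<in> cycles n" "?w n \<omega> c \<le> ?t" by blast
        show False using min_mean_cycle_least(2)[OF n(1) c(1), of "\<lambda>e. X n e \<omega>"] c(2) lt by linarith
      qed
    next
      assume "\<not> (\<exists>c\<in>cycles n. ?w n \<omega> c \<le> ?t)"
      then show "?t < ?w n \<omega> (?c n \<omega>)" using min_mean_cycle_least(1)[OF n(1)] by (metis not_le)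
    qed
    have Q_eq: "?Q = space (M n) - ?L" unfolding Q_iff by blast
    have L: "?L \<in> events" by measurable
    then have Q: "?Q \<in> events" unfolding Q_eq by auto
    have R: "?R \<in> events"
      unfolding min_mean_cycle_def by (rule arg_min_measurable[OF finite_cycles wm])
    have "prob ?Q = 1 - prob ?L" unfolding Q_eq by (rule prob_compl[OF L])
    then have Qc: "c0 \<le> prob ?Q" using prob_light_cycle_le[OF iid n(2)] by (simp add: c0_def)
    have split: "prob ?Q = prob (?R \<inter> ?Q) + f (\<eta> n) n"
    proof -
      have "prob ?Q = prob ((?R \<inter> ?Q) \<union> (?Q - ?R))" by (rule arg_cong[where f = prob]) blast
      also have "\<dots> = prob (?R \<inter> ?Q) + prob (?Q - ?R)"
        by (rule finite_measure_Union[OF sets.Int[OF R Q] sets.Diff[OF Q R]]) blast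
      also have "?Q - ?R = {\<omega> \<in> space (M n). real (card (?c n \<omega>)) < length_bound (\<eta> n) n \<and> ?t < ?w n \<omega> (?c n \<omega>)}"
        unfolding not_le[symmetric] by blast
      finally show ?thesis unfolding f_def .
    qed
    have ratio: "y / z = 1 - x / z" if "z = y + x" "c0 \<le> z" for x y z
    proof -
      have "0 < z" using that(2) c0 by linarith
      then show ?thesis using that(1) by (simp add: field_simps)
    qed
    have RQ: "?R \<inter> ?Q = {\<omega> \<in> space (M n). length_bound (\<eta> n) n \<le> real (card (?c n \<omega>)) \<and> ?t < ?w n \<omega> (?c n \<omega>)}" by blast
    have f0: "0 \<le> f (\<eta> n) n" unfolding f_def by simp
    have "?P n = prob (?R \<inter> ?Q) / prob ?Q" unfolding cond_prob_def RQ ..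
    also have "\<dots> = 1 - f (\<eta> n) n / prob ?Q" by (rule ratio[OF split Qc])
    finally have P: "?P n = 1 - f (\<eta> n) n / prob ?Q" .
    have "0 \<le> f (\<eta> n) n / prob ?Q" by (rule divide_nonneg_nonneg[OF f0 measure_nonneg])
    then have "norm (?P n - 1) = f (\<eta> n) n / prob ?Q" unfolding P real_norm_def by linarith
    also have "\<dots> \<le> f (\<eta> n) n / c0" by (rule divide_left_mono[OF Qc f0 mult_pos_pos[OF less_le_trans[OF c0 Qc] c0]])
    finally show ?case .
  qed
  then have "(\<lambda>n. ?P n - 1) \<longlonglongrightarrow> 0" by (rule Lim_null_comparison[OF _ lim])
  then have "?P \<longlonglongrightarrow> 1" unfolding LIM_zero_iff .
  with \<eta>(1) show ?thesis by (intro exI[of _ \<eta>] conjI)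
qed

end

interpretation directed: tour_graph "\<lambda>u v. (u, v) :: nat \<times> nat" 2
  by unfold_locales (blast, simp, blast)

interpretation undirected: tour_graph "\<lambda>u v. {u, v} :: nat set" 3
  by standard (auto simp: doubleton_eq_iff)

theorem theorem6p7:
  fixes M :: "nat \<Rightarrow> 'a measure" and X :: "nat \<Rightarrow> nat \<times> nat \<Rightarrow> 'a \<Rightarrow> real"
    and N :: "nat \<Rightarrow> 'b measure" and Y :: "nat \<Rightarrow> nat set \<Rightarrow> 'b \<Rightarrow> real"
  assumes directed: "\<And>n. iid_exponential_weights (M n) (complete_arcs n) (X n)"
    and undirected: "\<And>n. iid_exponential_weights (N n) (complete_edges n) (Y n)"
  shows
    "(\<exists>\<eta> :: nat \<Rightarrow> real. \<eta> \<longlonglongrightarrow> 0 \<and>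
       (\<lambda>n. \<P>(\<omega> in M n.
              real (card (min_mean_cycle (directed_cycles n) (\<lambda>e. X n e \<omega>)))
                \<ge> (2 / pi\<^sup>2 - \<eta> n) * (ln (real n))\<^sup>2 * ln (ln (real n))
            \<bar> mean_weight (\<lambda>e. X n e \<omega>) (min_mean_cycle (directed_cycles n) (\<lambda>e. X n e \<omega>))
                > 1 / (exp 1 * real n))) \<longlonglongrightarrow> 1) \<and>
     (\<exists>\<eta> :: nat \<Rightarrow> real. \<eta> \<longlonglongrightarrow> 0 \<and>
       (\<lambda>n. \<P>(\<omega> in N n.
              real (card (min_mean_cycle (undirected_cycles n) (\<lambda>e. Y n e \<omega>)))
                \<ge> (2 / pi\<^sup>2 - \<eta> n) * (ln (real n))\<^sup>2 * ln (ln (real n))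
            \<bar> mean_weight (\<lambda>e. Y n e \<omega>) (min_mean_cycle (undirected_cycles n) (\<lambda>e. Y n e \<omega>))
                > 1 / (exp 1 * real n))) \<longlonglongrightarrow> 1)"
proof -
  have "directed.edges = complete_arcs" "directed.cycles = directed_cycles"
    by (intro ext, force simp: directed.edges_def complete_arcs_def)
      (intro ext, simp only: directed.cycles_def directed_cycles_def)
  note arcs = directed.min_mean_cycle_long[of M X, unfolded this, OF directed]
  have "undirected.edges = complete_edges" "undirected.cycles = undirected_cycles"
    by (intro ext, simp only: undirected.edges_def complete_edges_def)
      (intro ext, simp only: undirected.cycles_def undirected_cycles_def)
  note edges = undirected.min_mean_cycle_long[of N Y, unfolded this, OF undirected]
  show ?thesis by (rule conjI[OF arcs edges])
qed

end
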